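(* Let $\mathcal D$ be a finite-dimensional complex vector space, $\mathfrak g=\operatorname{End}(\mathcal D)$, $x\in\mathfrak g$ nilpotent, and $\{x,h,y\}$ an $\mathfrak{sl}(2)$-triple in $\mathfrak g$ containing $x$. Write $\mathcal D=\bigoplus_iM_i\otimes L_i$, where $L_i$ is the simple $\mathfrak{sl}(2)$-module of highest weight $i$ and $M_i=\operatorname{Hom}_{\mathfrak{sl}(2)}(L_i,\mathcal D)$, so that $\mathfrak g=\bigoplus_{i,j}\operatorname{Hom}(M_j,M_i)\otimes L_i\otimes L_j^*$, and put $$C=\bigoplus_{i,j}\operatorname{Hom}(M_j,M_i)\otimes\ker(y,L_i)\otimes\ker(y^{i+1},L_j^* )\ \subseteq\ \mathfrak g .$$ Then $T_x=x+C$ is a normal slice in $\mathfrak g$ to the nilpotent orbit of $x$ at $x$.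
   Context: $G=GL(\mathcal D)$ acts on $\mathfrak g$ by conjugation. Lusztig strata of $\mathfrak g$: for $w\in\mathfrak g$ with Jordan decomposition $w=s+\nu$ let $\mathfrak l=Z_{\mathfrak g}(s)$ and $Z_r(\mathfrak l)=\{u\in Z(\mathfrak l): Z_{\mathfrak g}(u)=\mathfrak l\}$; the stratum through $w$ is $G\cdot(Z_r(\mathfrak l)+\nu)$. A normal slice in $\mathfrak g$ to a nilpotent orbit $\alpha$ at $x\in\alpha$ is a submanifold $\mathcal S\subset\mathfrak g$ containing $x$ such that (IN) $T_x(\mathfrak g)=T_x(\alpha)\oplus T_x(\mathcal S)$, and (C) there is an action of $\mathbb G_m$ on $\mathcal S$ which contracts $\mathcal S$ to $x$ and preserves the intersections of $\mathcal S$ with the Lusztig strata of $\mathfrak g$. The convention for $\mathfrak{sl}(2)$-triples is $[h,x]=2x$, $[h,y]=-2y$, $[x,y]=h$. *)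

theory Defs
  imports "HOL-Analysis.Analysis" "HOL-Library.Function_Algebras"
begin

section \<open>Complex vector spaces\<close>

class complex_vector = ab_group_add +
  fixes scaleC :: "complex \<Rightarrow> 'a \<Rightarrow> 'a"  (infixr "*\<^sub>C" 75)
  assumes scaleC_add_right: "a *\<^sub>C (u + v) = a *\<^sub>C u + a *\<^sub>C v"
    and scaleC_add_left: "(a + b) *\<^sub>C u = a *\<^sub>C u + b *\<^sub>C u"
    and scaleC_scaleC: "a *\<^sub>C (b *\<^sub>C u) = (a * b) *\<^sub>C u"
    and scaleC_one: "1 *\<^sub>C u = u"

global_interpretation complex_vector: vector_space "scaleC :: complex \<Rightarrow> 'a \<Rightarrow> 'a::complex_vector"
  defines csubspace = complex_vector.subspace
    and cspan = complex_vector.span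
  by unfold_locales (simp_all add: scaleC_add_right scaleC_add_left scaleC_scaleC scaleC_one)

class complex_normed_vector = real_normed_vector + complex_vector +
  assumes scaleR_scaleC: "r *\<^sub>R u = complex_of_real r *\<^sub>C u"
    and norm_scaleC: "norm (a *\<^sub>C u) = cmod a * norm u"

text \<open>Every finite-dimensional complex vector space (the zero space included) carries a norm, and
  all norms on it induce the same topology and the same differentiable structure, so the norm that
  comes with this class only serves to give access to the canonical topology.\<close>

class findim_complex_vector = complex_normed_vector +
  assumes finite_spanning_set:
    "\<exists>B. finite B \<and> (\<forall>v. \<exists>c :: 'a \<Rightarrow> complex. v = (\<Sum>b\<in>B. c b *\<^sub>C b))"

instantiation complex :: findim_complex_vector
begin
definition "scaleC_complex = ((*) :: complex \<Rightarrow> complex \<Rightarrow> complex)"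
instance
proof
  show "\<exists>B::complex set. finite B \<and> (\<forall>v. \<exists>c. v = (\<Sum>b\<in>B. c b *\<^sub>C b))"
    by (rule exI[of _ "{1}"]) (auto simp: scaleC_complex_def)
qed (simp_all add: scaleC_complex_def algebra_simps norm_mult scaleR_conv_of_real)
end

instantiation "fun" :: (type, complex_vector) complex_vector
begin
definition "scaleC_fun a f = (\<lambda>t. a *\<^sub>C f t)"
instance
  by standard (simp_all add: scaleC_fun_def plus_fun_def fun_eq_iff
      scaleC_add_right scaleC_add_left scaleC_scaleC scaleC_one)
end

lemma bounded_linear_scaleC_comp:
  fixes f :: "'a::real_normed_vector \<Rightarrow>\<^sub>L 'b::complex_normed_vector"
  shows "bounded_linear (\<lambda>v. a *\<^sub>C blinfun_apply f v)"
proof (rule bounded_linear_intro)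
  show "norm (a *\<^sub>C blinfun_apply f v) \<le> norm v * (cmod a * norm f)" for v
    using mult_left_mono[OF norm_blinfun[of f v], of "cmod a"]
    by (simp add: norm_scaleC ac_simps)
qed (simp_all add: blinfun.add_right scaleC_add_right blinfun.scaleR_right scaleR_scaleC
      scaleC_scaleC mult.commute)

instantiation blinfun :: (real_normed_vector, complex_normed_vector) complex_normed_vector
begin
definition "scaleC_blinfun a f = Blinfun (\<lambda>v. a *\<^sub>C blinfun_apply f v)"

lemma blinfun_apply_scaleC:
  "blinfun_apply (a *\<^sub>C f) v = a *\<^sub>C blinfun_apply f v"
  for f :: "'a \<Rightarrow>\<^sub>L 'b"
  by (simp add: scaleC_blinfun_def bounded_linear_Blinfun_apply bounded_linear_scaleC_comp)

instance
proof
  fix a b :: complex and r :: real and f g :: "'a \<Rightarrow>\<^sub>L 'b"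
  show "a *\<^sub>C (f + g) = a *\<^sub>C f + a *\<^sub>C g" "(a + b) *\<^sub>C f = a *\<^sub>C f + b *\<^sub>C f"
    "a *\<^sub>C b *\<^sub>C f = (a * b) *\<^sub>C f" "1 *\<^sub>C f = f" "r *\<^sub>R f = complex_of_real r *\<^sub>C f"
    by (rule blinfun_eqI; simp add: blinfun_apply_scaleC blinfun.add_left blinfun.scaleR_left
        scaleC_add_right scaleC_add_left scaleC_scaleC scaleC_one scaleR_scaleC)+
  have le: "norm (c *\<^sub>C u) \<le> cmod c * norm u" for c and u :: "'a \<Rightarrow>\<^sub>L 'b"
  proof (rule norm_blinfun_bound)
    show "norm (blinfun_apply (c *\<^sub>C u) v) \<le> cmod c * norm u * norm v" for v
      using mult_left_mono[OF norm_blinfun[of u v], of "cmod c"]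
      by (simp add: blinfun_apply_scaleC norm_scaleC ac_simps)
  qed simp
  show "norm (a *\<^sub>C f) = cmod a * norm f"
  proof (cases "a = 0")
    case True
    then show ?thesis using le[of 0 f] by simp
  next
    case False
    have "f = inverse a *\<^sub>C (a *\<^sub>C f)"
      by (rule blinfun_eqI) (simp add: False blinfun_apply_scaleC scaleC_scaleC scaleC_one)
    then have "norm f \<le> cmod (inverse a) * norm (a *\<^sub>C f)"
      using le[of "inverse a" "a *\<^sub>C f"] by simp
    then have "cmod a * norm f \<le> norm (a *\<^sub>C f)"
      using False by (simp add: norm_inverse norm_divide field_simps)
    then show ?thesis using le[of a f] by simp
  qed
qed
end

definition clinear_on :: "'a::complex_vector set \<Rightarrow> ('a \<Rightarrow> 'b::complex_vector) \<Rightarrow> bool" where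
  "clinear_on V f \<longleftrightarrow> (\<forall>u\<in>V. \<forall>v\<in>V. f (u + v) = f u + f v) \<and> (\<forall>c. \<forall>u\<in>V. f (c *\<^sub>C u) = c *\<^sub>C f u)"

definition direct_sum_of :: "'a::complex_vector set \<Rightarrow> 'a set \<Rightarrow> 'a set \<Rightarrow> bool" where
  "direct_sum_of V A B \<longleftrightarrow>
     csubspace A \<and> csubspace B \<and> V = {a + b |a b. a \<in> A \<and> b \<in> B} \<and> A \<inter> B = {0}"


section \<open>Submanifolds, tangent spaces, regular maps\<close>

text \<open>Throughout, \<open>V\<close> is a finite-dimensional complex subspace of the ambient type, considered as a
  complex manifold in its own right.\<close>

definition holomorphic_in :: "'a::complex_normed_vector set \<Rightarrow> 'a set \<Rightarrow> ('a \<Rightarrow> 'a) \<Rightarrow> bool" where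
  "holomorphic_in V U f \<longleftrightarrow> (\<forall>u\<in>U. \<exists>D. (f has_derivative D) (at u within U) \<and> clinear_on V D)"

definition csubmanifold :: "'a::complex_normed_vector set \<Rightarrow> 'a set \<Rightarrow> bool" where
  "csubmanifold V S \<longleftrightarrow> S \<subseteq> V \<and>
     (\<forall>p\<in>S. \<exists>U W \<phi> \<psi> E. openin (top_of_set V) U \<and> p \<in> U \<and> openin (top_of_set V) W \<and>
        homeomorphism U W \<phi> \<psi> \<and> holomorphic_in V U \<phi> \<and> holomorphic_in V W \<psi> \<and>
        csubspace E \<and> E \<subseteq> V \<and> \<phi> ` (S \<inter> U) = E \<inter> W)"

text \<open>Tangent vectors are the velocities of holomorphic arcs.\<close>

definition tangent_space :: "'a::complex_normed_vector set \<Rightarrow> 'a \<Rightarrow> 'a set" where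
  "tangent_space S p = {v. \<exists>\<gamma> :: complex \<Rightarrow> 'a. \<exists>\<epsilon>>0.
     \<gamma> 0 = p \<and> \<gamma> ` ball 0 \<epsilon> \<subseteq> S \<and>
     (\<forall>t\<in>ball 0 \<epsilon>. \<exists>w. (\<gamma> has_derivative (\<lambda>s. s *\<^sub>C w)) (at t)) \<and>
     (\<gamma> has_derivative (\<lambda>s. s *\<^sub>C v)) (at 0)}"

inductive_set polynomial_functions :: "'a::complex_vector set \<Rightarrow> (complex \<times> 'a \<Rightarrow> complex) set"
  for V :: "'a set"
where
  const: "(\<lambda>_. c) \<in> polynomial_functions V"
| param: "fst \<in> polynomial_functions V"
| linear: "clinear_on V f \<Longrightarrow> (\<lambda>q. f (snd q)) \<in> polynomial_functions V"
| add: "P \<in> polynomial_functions V \<Longrightarrow> Q \<in> polynomial_functions V \<Longrightarrow>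
          (\<lambda>q. P q + Q q) \<in> polynomial_functions V"
| mult: "P \<in> polynomial_functions V \<Longrightarrow> Q \<in> polynomial_functions V \<Longrightarrow>
          (\<lambda>q. P q * Q q) \<in> polynomial_functions V"

text \<open>Regular functions on a subset \<open>X\<close> of \<open>\<complex> \<times> V\<close>: Zariski-locally quotients of polynomials.\<close>

definition regular_function ::
    "'a::complex_vector set \<Rightarrow> (complex \<times> 'a) set \<Rightarrow> (complex \<times> 'a \<Rightarrow> complex) \<Rightarrow> bool" where
  "regular_function V X f \<longleftrightarrow>
     (\<forall>p\<in>X. \<exists>P\<in>polynomial_functions V. \<exists>Q\<in>polynomial_functions V.
        Q p \<noteq> 0 \<and> (\<forall>q\<in>X. Q q \<noteq> 0 \<longrightarrow> f q = P q / Q q))"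

definition regular_map ::
    "'a::complex_vector set \<Rightarrow> (complex \<times> 'a) set \<Rightarrow> (complex \<times> 'a \<Rightarrow> 'a) \<Rightarrow> bool" where
  "regular_map V X F \<longleftrightarrow>
     (\<forall>f :: 'a \<Rightarrow> complex. clinear_on V f \<longrightarrow> regular_function V X (\<lambda>q. f (F q)))"

definition Gm_action :: "'a::complex_vector set \<Rightarrow> 'a set \<Rightarrow> (complex \<Rightarrow> 'a \<Rightarrow> 'a) \<Rightarrow> bool" where
  "Gm_action V S act \<longleftrightarrow>
     (\<forall>t s. t \<noteq> 0 \<longrightarrow> s \<in> S \<longrightarrow> act t s \<in> S) \<and>
     (\<forall>s\<in>S. act 1 s = s) \<and>
     (\<forall>t u s. t \<noteq> 0 \<longrightarrow> u \<noteq> 0 \<longrightarrow> s \<in> S \<longrightarrow> act (t * u) s = act t (act u s)) \<and>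
     regular_map V ((- {0}) \<times> S) (\<lambda>(t, s). act t s)"

definition contracts_to ::
    "'a::complex_normed_vector set \<Rightarrow> (complex \<Rightarrow> 'a \<Rightarrow> 'a) \<Rightarrow> 'a \<Rightarrow> bool" where
  "contracts_to S act x \<longleftrightarrow> (\<forall>s\<in>S. ((\<lambda>t. act t s) \<longlongrightarrow> x) (at 0))"


section \<open>The Lie algebra of endomorphisms, orbits and Lusztig strata\<close>

text \<open>The vector space \<open>\<D>\<close> is the type \<open>'d\<close>. The type \<open>'d \<Rightarrow>\<^sub>L 'd\<close> consists of the real-linear
  endomorphisms, all of which are bounded.\<close>

definition End_D :: "('d::findim_complex_vector \<Rightarrow>\<^sub>L 'd) set" where
  "End_D = {A. clinear_on UNIV (blinfun_apply A)}"

definition GL_D :: "('d::findim_complex_vector \<Rightarrow>\<^sub>L 'd) set" where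
  "GL_D = {g \<in> End_D. \<exists>g'\<in>End_D. g o\<^sub>L g' = id_blinfun \<and> g' o\<^sub>L g = id_blinfun}"

definition lie_bracket ::
    "('d::findim_complex_vector \<Rightarrow>\<^sub>L 'd) \<Rightarrow> ('d \<Rightarrow>\<^sub>L 'd) \<Rightarrow> ('d \<Rightarrow>\<^sub>L 'd)" where
  "lie_bracket A B = (A o\<^sub>L B) - (B o\<^sub>L A)"

definition nilpotent_op :: "('d::findim_complex_vector \<Rightarrow>\<^sub>L 'd) \<Rightarrow> bool" where
  "nilpotent_op A \<longleftrightarrow> (\<exists>n. \<forall>v. (blinfun_apply A ^^ n) v = 0)"

definition semisimple_op :: "('d::findim_complex_vector \<Rightarrow>\<^sub>L 'd) \<Rightarrow> bool" where
  "semisimple_op A \<longleftrightarrow> cspan {v. \<exists>c. blinfun_apply A v = c *\<^sub>C v} = UNIV"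

definition jordan_decomposition ::
    "('d::findim_complex_vector \<Rightarrow>\<^sub>L 'd) \<Rightarrow> ('d \<Rightarrow>\<^sub>L 'd) \<Rightarrow> ('d \<Rightarrow>\<^sub>L 'd) \<Rightarrow> bool" where
  "jordan_decomposition w s \<nu> \<longleftrightarrow> s \<in> End_D \<and> \<nu> \<in> End_D \<and> w = s + \<nu> \<and>
     semisimple_op s \<and> nilpotent_op \<nu> \<and> lie_bracket s \<nu> = 0"

definition conj_saturation ::
    "('d::findim_complex_vector \<Rightarrow>\<^sub>L 'd) set \<Rightarrow> ('d \<Rightarrow>\<^sub>L 'd) set" where
  "conj_saturation X = {g o\<^sub>L u o\<^sub>L g' |g g' u. g \<in> GL_D \<and> g' \<in> GL_D \<and>
     g o\<^sub>L g' = id_blinfun \<and> g' o\<^sub>L g = id_blinfun \<and> u \<in> X}"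

definition conj_orbit :: "('d::findim_complex_vector \<Rightarrow>\<^sub>L 'd) \<Rightarrow> ('d \<Rightarrow>\<^sub>L 'd) set" where
  "conj_orbit w = conj_saturation {w}"

definition centralizer :: "('d::findim_complex_vector \<Rightarrow>\<^sub>L 'd) \<Rightarrow> ('d \<Rightarrow>\<^sub>L 'd) set" where
  "centralizer s = {u \<in> End_D. lie_bracket s u = 0}"

definition lie_center :: "('d::findim_complex_vector \<Rightarrow>\<^sub>L 'd) set \<Rightarrow> ('d \<Rightarrow>\<^sub>L 'd) set" where
  "lie_center \<ll> = {u \<in> \<ll>. \<forall>v\<in>\<ll>. lie_bracket u v = 0}"

definition regular_center :: "('d::findim_complex_vector \<Rightarrow>\<^sub>L 'd) set \<Rightarrow> ('d \<Rightarrow>\<^sub>L 'd) set" where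
  "regular_center \<ll> = {u \<in> lie_center \<ll>. centralizer u = \<ll>}"

definition lusztig_strata :: "('d::findim_complex_vector \<Rightarrow>\<^sub>L 'd) set set" where
  "lusztig_strata = {conj_saturation {u + \<nu> |u. u \<in> regular_center (centralizer s)} |w s \<nu>.
     w \<in> End_D \<and> jordan_decomposition w s \<nu>}"

definition normal_slice ::
    "('d::findim_complex_vector \<Rightarrow>\<^sub>L 'd) set \<Rightarrow> ('d \<Rightarrow>\<^sub>L 'd) \<Rightarrow> ('d \<Rightarrow>\<^sub>L 'd) set \<Rightarrow> bool" where
  "normal_slice \<alpha> x S \<longleftrightarrow>
     csubmanifold End_D S \<and> x \<in> S \<and>
     direct_sum_of (tangent_space End_D x) (tangent_space \<alpha> x) (tangent_space S x) \<and>
     (\<exists>act. Gm_action End_D S act \<and> contracts_to S act x \<and>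
        (\<forall>\<Sigma>\<in>lusztig_strata. \<forall>t. t \<noteq> 0 \<longrightarrow> act t ` (S \<inter> \<Sigma>) = S \<inter> \<Sigma>))"


section \<open>\<open>sl(2)\<close>-modules and the subspace \<open>C\<close>\<close>

definition sl2_triple ::
    "('d::findim_complex_vector \<Rightarrow>\<^sub>L 'd) \<Rightarrow> ('d \<Rightarrow>\<^sub>L 'd) \<Rightarrow> ('d \<Rightarrow>\<^sub>L 'd) \<Rightarrow> bool" where
  "sl2_triple x h y \<longleftrightarrow> x \<in> End_D \<and> h \<in> End_D \<and> y \<in> End_D \<and>
     lie_bracket h x = 2 *\<^sub>C x \<and> lie_bracket h y = (-2) *\<^sub>C y \<and> lie_bracket x y = h"

text \<open>The simple module \<open>L\<^sub>i\<close> of highest weight \<open>i\<close>, in the basis \<open>e\<^sub>k = y\<^sup>k e\<^sub>0\<close> \<open>(0 \<le> k \<le> i)\<close> with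
  \<open>e\<^sub>0\<close> a highest weight vector; \<open>l k\<close> is the coefficient of \<open>e\<^sub>k\<close> in \<open>l\<close>. Thus
  \<open>h e\<^sub>k = (i - 2k) e\<^sub>k\<close>, \<open>y e\<^sub>k = e\<^sub>k\<^sub>+\<^sub>1\<close> (zero for \<open>k = i\<close>) and \<open>x e\<^sub>k = k (i - k + 1) e\<^sub>k\<^sub>-\<^sub>1\<close>.\<close>

definition simple_module :: "nat \<Rightarrow> (nat \<Rightarrow> complex) set" where
  "simple_module i = {l. \<forall>k>i. l k = 0}"

definition simple_x :: "nat \<Rightarrow> (nat \<Rightarrow> complex) \<Rightarrow> nat \<Rightarrow> complex" where
  "simple_x i l = (\<lambda>k. of_nat (k + 1) * (of_nat i - of_nat k) * l (k + 1))"

definition simple_h :: "nat \<Rightarrow> (nat \<Rightarrow> complex) \<Rightarrow> nat \<Rightarrow> complex" where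
  "simple_h i l = (\<lambda>k. (of_nat i - 2 * of_nat k) * l k)"

definition simple_y :: "nat \<Rightarrow> (nat \<Rightarrow> complex) \<Rightarrow> nat \<Rightarrow> complex" where
  "simple_y i l = (\<lambda>k. if k = 0 \<or> i < k then 0 else l (k - 1))"

text \<open>The contragredient action of \<open>y\<close> on \<open>L\<^sub>j\<^sup>*\<close>.\<close>

definition dual_y :: "nat \<Rightarrow> ((nat \<Rightarrow> complex) \<Rightarrow> complex) \<Rightarrow> (nat \<Rightarrow> complex) \<Rightarrow> complex" where
  "dual_y j \<xi> = (\<lambda>l. - \<xi> (simple_y j l))"

definition ker_y :: "nat \<Rightarrow> (nat \<Rightarrow> complex) set" where
  "ker_y i = {l \<in> simple_module i. simple_y i l = 0}"

text \<open>The kernel of \<open>y\<^sup>n\<close> on \<open>L\<^sub>j\<^sup>*\<close>; functionals are functions of which only the values on \<open>L\<^sub>j\<close>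
  matter.\<close>

definition ker_y_pow_dual :: "nat \<Rightarrow> nat \<Rightarrow> ((nat \<Rightarrow> complex) \<Rightarrow> complex) set" where
  "ker_y_pow_dual n j = {\<xi>. clinear_on (simple_module j) \<xi> \<and>
     (\<forall>l\<in>simple_module j. (dual_y j ^^ n) \<xi> l = 0)}"

text \<open>\<open>M\<^sub>i = Hom(L\<^sub>i, \<D>)\<close>; homomorphisms are extended by zero outside \<open>L\<^sub>i\<close> so that equality of
  homomorphisms is equality of functions.\<close>

definition multiplicity_space ::
    "('d::findim_complex_vector \<Rightarrow>\<^sub>L 'd) \<Rightarrow> ('d \<Rightarrow>\<^sub>L 'd) \<Rightarrow> ('d \<Rightarrow>\<^sub>L 'd) \<Rightarrow> nat \<Rightarrow>
      ((nat \<Rightarrow> complex) \<Rightarrow> 'd) set" where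
  "multiplicity_space x h y i = {m. clinear_on (simple_module i) m \<and>
     (\<forall>l. l \<notin> simple_module i \<longrightarrow> m l = 0) \<and>
     (\<forall>l\<in>simple_module i. m (simple_x i l) = blinfun_apply x (m l) \<and>
        m (simple_h i l) = blinfun_apply h (m l) \<and> m (simple_y i l) = blinfun_apply y (m l))}"

text \<open>\<open>A\<close> is the endomorphism \<open>\<phi> \<otimes> l \<otimes> \<xi>\<close>, with \<open>\<phi> \<in> Hom(M\<^sub>j, M\<^sub>i)\<close>, \<open>l \<in> L\<^sub>i\<close>, \<open>\<xi> \<in> L\<^sub>j\<^sup>*\<close>. The
  isomorphism of \<open>\<Oplus>\<^sub>k M\<^sub>k \<otimes> L\<^sub>k\<close> with \<open>\<D>\<close> sends \<open>m \<otimes> l'\<close> to \<open>m l'\<close>, so \<open>A\<close> is the unique linear map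
  sending \<open>m l'\<close> to \<open>\<xi>(l') \<phi>(m)(l)\<close> for \<open>m \<in> M\<^sub>j\<close>, \<open>l' \<in> L\<^sub>j\<close> and vanishing on the other summands.\<close>

definition is_pure_tensor ::
    "('d::findim_complex_vector \<Rightarrow>\<^sub>L 'd) \<Rightarrow> ('d \<Rightarrow>\<^sub>L 'd) \<Rightarrow> ('d \<Rightarrow>\<^sub>L 'd) \<Rightarrow> nat \<Rightarrow>
      (((nat \<Rightarrow> complex) \<Rightarrow> 'd) \<Rightarrow> ((nat \<Rightarrow> complex) \<Rightarrow> 'd)) \<Rightarrow> (nat \<Rightarrow> complex) \<Rightarrow>
      ((nat \<Rightarrow> complex) \<Rightarrow> complex) \<Rightarrow> ('d \<Rightarrow>\<^sub>L 'd) \<Rightarrow> bool" where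
  "is_pure_tensor x h y j \<phi> l \<xi> A \<longleftrightarrow> A \<in> End_D \<and>
     (\<forall>k. \<forall>m\<in>multiplicity_space x h y k. \<forall>l'\<in>simple_module k.
        blinfun_apply A (m l') = (if k = j then \<xi> l' *\<^sub>C \<phi> m l else 0))"

definition slice_space ::
    "('d::findim_complex_vector \<Rightarrow>\<^sub>L 'd) \<Rightarrow> ('d \<Rightarrow>\<^sub>L 'd) \<Rightarrow> ('d \<Rightarrow>\<^sub>L 'd) \<Rightarrow> ('d \<Rightarrow>\<^sub>L 'd) set" where
  "slice_space x h y = cspan {A. \<exists>i j \<phi> l \<xi>.
     clinear_on (multiplicity_space x h y j) \<phi> \<and>
     \<phi> ` multiplicity_space x h y j \<subseteq> multiplicity_space x h y i \<and>
     l \<in> ker_y i \<and> \<xi> \<in> ker_y_pow_dual (i + 1) j \<and>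
     is_pure_tensor x h y j \<phi> l \<xi> A}"

end

theory Submission
  imports Defs
begin

text \<open>Since \<open>x\<close> is nilpotent, \<open>\<D>\<close> is a direct sum of strings \<open>v, y v, \<dots>, y\<^sup>j v\<close> of vectors
  with \<open>x v = 0\<close> and \<open>h v = j v\<close>. In terms of the positions in the strings, \<open>C\<close> is a set of
  admissible blocks, and every block is moved into an admissible one or to zero by adding
  commutators with \<open>x\<close>; hence \<open>C\<close> and \<open>[\<gg>, x]\<close> span \<open>\<gg>\<close>.

  A velocity \<open>V\<close> at \<open>x\<close> of an arc of conjugates of \<open>x\<close> satisfies a linear condition for every
  \<open>k\<close>, since the rank of the \<open>k\<close>-th powers is constant: the derivative of the \<open>k\<close>-th power in
  direction \<open>V\<close> maps the kernel of \<open>x\<^sup>k\<close> to its image. Commutators with \<open>x\<close> satisfy these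
  conditions, and only \<open>0\<close> does so in \<open>C\<close>. This proves both that the tangent space of the orbit
  is \<open>[\<gg>, x]\<close> and that it meets \<open>C\<close> only in \<open>0\<close>.

  The contraction is \<open>t\<^sup>2 Ad(t\<^sup>-\<^sup>h)\<close>. It preserves the Lusztig strata because a nilpotent operator
  is conjugate to its nonzero multiples by an operator that commutes with a given semisimple
  operator commuting with it.\<close>

section \<open>Linear maps on finite-dimensional complex vector spaces\<close>

text \<open>Complete reducibility is not presupposed. The strings are built from the kernel of
  \<open>x\<close>, filtered by its intersections with the images of the powers of \<open>x\<close>.
  Vectors in position \<open>q\<close> of strings of highest weight \<open>j\<close> are separated
  by two operators at once, the Casimir operator and \<open>h\<close>, since equal weights occur in
  strings of different lengths. There \<open>x y\<close> and \<open>y x\<close> are explicit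
  scalars, zero only at the ends of a string; dividing by them is what allows a block to be shifted
  along its strings modulo commutators.

  The orbit is known only through the arcs in it, so an upper bound for its tangent space has to be
  read off from arcs. The rank conditions are strong enough because operators in \<open>C\<close>
  take values at the lower ends of strings: the image of the power \<open>k\<close> of
  \<open>x\<close> could reach position \<open>i - k + 1\<close> only from position
  \<open>i + 1\<close>, which does not exist.

  The factor \<open>t^2\<close> makes the rescaled conjugation fix \<open>x\<close>, but it also
  scales the nilpotent part \<nu> by which a stratum is defined. Undoing this needs a conjugation
  that fixes the regular center, hence the operator commuting with the semisimple part.\<close>

abbreviation clinear :: "('a::complex_vector \<Rightarrow> 'b::complex_vector) \<Rightarrow> bool" where
  "clinear \<equiv> Vector_Spaces.linear scaleC scaleC"

global_interpretation clin: vector_space_pair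
  "scaleC :: complex \<Rightarrow> 'a \<Rightarrow> 'a::complex_vector" "scaleC :: complex \<Rightarrow> 'b \<Rightarrow> 'b::complex_vector"
  rewrites "module.subspace (scaleC :: complex \<Rightarrow> 'a \<Rightarrow> 'a) = csubspace"
    and "module.subspace (scaleC :: complex \<Rightarrow> 'b \<Rightarrow> 'b) = csubspace"
    and "module.span (scaleC :: complex \<Rightarrow> 'a \<Rightarrow> 'a) = cspan"
    and "module.span (scaleC :: complex \<Rightarrow> 'b \<Rightarrow> 'b) = cspan"
  by unfold_locales (simp_all add: csubspace_def cspan_def)

lemmas clinear_add = clin.linear_add
  and clinear_scale = clin.linear_scale
  and clinear_0 = clin.linear_0
  and clinear_diff = clin.linear_diff
  and clinear_sum = clin.linear_sum

lemma clinearI: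
  assumes "\<And>u v. f (u + v) = f u + f v" "\<And>a u. f (a *\<^sub>C u) = a *\<^sub>C f u"
  shows "clinear f"
  unfolding Vector_Spaces.linear_iff using assms by (auto intro: complex_vector.vector_space_axioms)

lemma clinear_on_UNIV: "clinear_on UNIV f \<longleftrightarrow> clinear f"
  by (auto simp: clinear_on_def clinear_add clinear_scale intro: clinearI)

section \<open>Norms, coordinates and bases in finite dimension\<close>

lemma bounded_bilinear_scaleC:
  "bounded_bilinear (scaleC :: complex \<Rightarrow> 'a \<Rightarrow> 'a::complex_normed_vector)"
proof
  show "\<exists>K. \<forall>a (b::'a). norm (a *\<^sub>C b) \<le> norm a * norm b * K"
    by (rule exI[of _ 1]) (simp add: norm_scaleC)
qed (simp_all add: scaleC_add_left scaleC_add_right scaleR_scaleC[where 'a='a] scaleC_scaleC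
    mult.commute scaleR_conv_of_real)

lemmas tendsto_scaleC = bounded_bilinear.tendsto[OF bounded_bilinear_scaleC]

text \<open>Bounded coordinates turn a convergent sequence of the span into Cauchy sequences of
  coefficients, and their limits are coefficients of the limit vector.\<close>

lemma coordinates_bounded_imp_closed_cspan:
  fixes B :: "'a::complex_normed_vector set"
  assumes "finite B" and K: "\<And>c b. b \<in> B \<Longrightarrow> cmod (c b) \<le> K * norm (\<Sum>b\<in>B. c b *\<^sub>C b)"
  shows "closed (cspan B)"
  unfolding closed_sequential_limits
proof (intro allI impI, elim conjE)
  fix X l assume X: "\<forall>n. X n \<in> cspan B" and l: "X \<longlonglongrightarrow> l"
  have "\<exists>c. X n = (\<Sum>b\<in>B. c b *\<^sub>C b)" for n
    using X complex_vector.span_finite[OF \<open>finite B\<close>] by auto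
  then obtain c where c: "X n = (\<Sum>b\<in>B. c n b *\<^sub>C b)" for n by metis
  have "Cauchy (\<lambda>n. c n b)" if b: "b \<in> B" for b
  proof (rule metric_CauchyI)
    fix e :: real assume e: "e > 0"
    have "Cauchy X" using l by (auto intro: LIMSEQ_imp_Cauchy)
    \<comment> \<open>The sign of \<open>K\<close> is unknown, so \<open>\<bar>K\<bar> + 1\<close>
      serves as a positive bound.\<close>
    then obtain M where M: "\<And>m n. m \<ge> M \<Longrightarrow> n \<ge> M \<Longrightarrow> dist (X m) (X n) < e / (\<bar>K\<bar> + 1)"
      using e by (meson Cauchy_def abs_ge_zero add_nonneg_pos divide_pos_pos zero_less_one)
    have "dist (c m b) (c n b) < e" if "m \<ge> M" "n \<ge> M" for m n
    proof -
      have "dist (c m b) (c n b) \<le> K * norm (\<Sum>b\<in>B. (c m b - c n b) *\<^sub>C b)"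
        using K[of b "\<lambda>b. c m b - c n b"] b by (simp add: dist_norm)
      also have "(\<Sum>b\<in>B. (c m b - c n b) *\<^sub>C b) = X m - X n"
        by (simp add: c complex_vector.scale_left_diff_distrib sum_subtractf)
      also have "K * norm (X m - X n) \<le> (\<bar>K\<bar> + 1) * norm (X m - X n)"
        by (rule mult_right_mono) auto
      also have "\<dots> < (\<bar>K\<bar> + 1) * (e / (\<bar>K\<bar> + 1))"
        by (rule mult_strict_left_mono) (use M[OF that] in \<open>auto simp: dist_norm\<close>)
      also have "\<dots> = e" by simp
      finally show ?thesis .
    qed
    then show "\<exists>M. \<forall>m\<ge>M. \<forall>n\<ge>M. dist (c m b) (c n b) < e" by blast
  qed
  then have "\<exists>d. (\<lambda>n. c n b) \<longlonglongrightarrow> d" if "b \<in> B" for b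
    using that by (auto simp: Cauchy_convergent_iff convergent_def)
  then obtain d where d: "\<And>b. b \<in> B \<Longrightarrow> (\<lambda>n. c n b) \<longlonglongrightarrow> d b" by metis
  have "X \<longlonglongrightarrow> (\<Sum>b\<in>B. d b *\<^sub>C b)"
    unfolding c by (intro tendsto_sum tendsto_scaleC d) auto
  then have "l = (\<Sum>b\<in>B. d b *\<^sub>C b)" using l LIMSEQ_unique by blast
  then show "l \<in> cspan B" using complex_vector.span_finite[OF \<open>finite B\<close>] by auto
qed

text \<open>Induction on the basis. The span of the old vectors is closed by the bound already known
  for them, so the new vector has positive distance from it. This distance controls the new
  coefficient; subtracting its term reduces the others to the old bound.\<close>

lemma coordinates_bounded:
  fixes B :: "'a::complex_normed_vector set"
  assumes "finite B" "complex_vector.independent B"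
  shows "\<exists>K. \<forall>c. \<forall>b\<in>B. cmod (c b) \<le> K * norm (\<Sum>b\<in>B. c b *\<^sub>C b)"
  using assms
proof (induction B)
  case (insert a B)
  have ind: "complex_vector.independent B" and a: "a \<notin> cspan B"
    using insert by (auto simp: complex_vector.independent_insert)
  obtain K where K: "\<And>c b. b \<in> B \<Longrightarrow> cmod (c b) \<le> K * norm (\<Sum>b\<in>B. c b *\<^sub>C b)"
    using insert.IH[OF ind] by blast
  have "closed (cspan B)" using coordinates_bounded_imp_closed_cspan[OF insert(1) K] .
  then have r: "infdist a (cspan B) > 0" (is "?r > 0")
    using a complex_vector.span_zero[of B] by (metis empty_iff infdist_pos_not_in_closed)
  \<comment> \<open>Dividing by \<open>c a\<close> turns the combination into the difference of
    \<open>a\<close> and a vector of \<open>cspan B\<close>.\<close>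
  have head: "cmod (c a) * ?r \<le> norm (\<Sum>b\<in>insert a B. c b *\<^sub>C b)" for c
  proof (cases "c a = 0")
    case False
    define w where "w = (\<Sum>b\<in>B. c b *\<^sub>C b)"
    have "w \<in> cspan B"
      unfolding w_def by (intro complex_vector.span_sum complex_vector.span_scale complex_vector.span_base)
    then have "(- inverse (c a)) *\<^sub>C w \<in> cspan B" by (rule complex_vector.span_scale)
    then have "?r \<le> dist a ((- inverse (c a)) *\<^sub>C w)" by (rule infdist_le)
    then have "cmod (c a) * ?r \<le> cmod (c a) * norm (a - (- inverse (c a)) *\<^sub>C w)"
      by (simp add: dist_norm mult_left_mono)
    also have "\<dots> = norm (c a *\<^sub>C a + w)"
      using False by (simp add: norm_scaleC[symmetric] scaleC_add_right scaleC_scaleC scaleC_one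
          del: norm_scaleC)
    finally show ?thesis using insert by (simp add: w_def)
  qed simp
  show ?case
  proof (intro exI allI ballI)
    fix c b assume b: "b \<in> insert a B"
    define v where "v = (\<Sum>b\<in>insert a B. c b *\<^sub>C b)"
    have ca: "cmod (c a) \<le> norm v / ?r" using head[of c] r by (simp add: v_def field_simps)
    have pos: "norm v / ?r \<ge> 0" "\<bar>K\<bar> * (norm v + norm v / ?r * norm a) \<ge> 0" using r by simp_all
    have "cmod (c b) \<le> norm v / ?r + \<bar>K\<bar> * (norm v + norm v / ?r * norm a)"
    proof (cases "b = a")
      case False
      then have "b \<in> B" using b by simp
      then have "cmod (c b) \<le> K * norm (\<Sum>b\<in>B. c b *\<^sub>C b)" using K by blast
      also have "(\<Sum>b\<in>B. c b *\<^sub>C b) = v - c a *\<^sub>C a" using insert by (simp add: v_def)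
      also have "K * norm (v - c a *\<^sub>C a) \<le> \<bar>K\<bar> * norm (v - c a *\<^sub>C a)"
        by (rule mult_right_mono) auto
      also have "\<dots> \<le> \<bar>K\<bar> * (norm v + norm v / ?r * norm a)"
      proof (rule mult_left_mono)
        have "norm (v - c a *\<^sub>C a) \<le> norm v + cmod (c a) * norm a"
          using norm_triangle_ineq4[of v "c a *\<^sub>C a"] by (simp add: norm_scaleC)
        also have "\<dots> \<le> norm v + norm v / ?r * norm a"
          using ca by (intro add_left_mono mult_right_mono) auto
        finally show "norm (v - c a *\<^sub>C a) \<le> norm v + norm v / ?r * norm a" .
      qed simp
      finally show ?thesis using pos by linarith
    next
      case True
      then have "cmod (c b) = cmod (c a)" by simp
      then show ?thesis using ca pos by linarith
    qed
    then show "cmod (c b) \<le> (1 / ?r + \<bar>K\<bar> * (1 + norm a / ?r)) * norm v"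
      by (simp add: algebra_simps)
  qed
qed auto

lemma ex_findim_basis:
  "\<exists>B::'d::findim_complex_vector set. finite B \<and> complex_vector.independent B \<and> cspan B = UNIV"
proof -
  obtain B :: "'d set" where B: "finite B" "\<forall>v. \<exists>c. v = (\<Sum>b\<in>B. c b *\<^sub>C b)"
    using finite_spanning_set by blast
  have "cspan B = UNIV" using B by (auto simp: complex_vector.span_finite)
  then show ?thesis
    using complex_vector.maximal_independent_subset[of B] B(1)
    by (metis complex_vector.span_mono complex_vector.span_span finite_subset top.extremum_uniqueI)
qed

text \<open>The locale of finite-dimensional spaces has a basis as a parameter, so one is fixed for
  each type.\<close>

definition cbasis :: "'d::findim_complex_vector set" where
  "cbasis = (SOME B. finite B \<and> complex_vector.independent B \<and> cspan B = UNIV)"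

global_interpretation findim: finite_dimensional_vector_space
  "scaleC :: complex \<Rightarrow> 'd \<Rightarrow> 'd::findim_complex_vector" cbasis
  rewrites "module.subspace (scaleC :: complex \<Rightarrow> 'd \<Rightarrow> 'd) = csubspace"
    and "module.span (scaleC :: complex \<Rightarrow> 'd \<Rightarrow> 'd) = cspan"
proof -
  have "finite cbasis" "complex_vector.independent cbasis" "cspan cbasis = (UNIV :: 'd set)"
    using someI_ex[OF ex_findim_basis] unfolding cbasis_def by blast+
  then show "finite_dimensional_vector_space (scaleC :: complex \<Rightarrow> 'd \<Rightarrow> 'd) cbasis"
    by unfold_locales (simp_all add: cspan_def)
qed (simp_all add: csubspace_def cspan_def)

text \<open>This makes algebraically constructed maps available as elements of the type of bounded
  operators.\<close>

lemma bounded_linear_clinear: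
  fixes f :: "'d::findim_complex_vector \<Rightarrow> 'b::complex_normed_vector"
  assumes f: "clinear f"
  shows "bounded_linear f"
proof -
  obtain K where K: "\<And>c b. b \<in> cbasis \<Longrightarrow>
      cmod (c b) \<le> K * norm (\<Sum>b\<in>cbasis. c b *\<^sub>C (b::'d))"
    using coordinates_bounded[OF findim.finite_Basis findim.independent_Basis] by blast
  show ?thesis
  proof (rule bounded_linear_intro)
    fix v :: 'd
    have "v \<in> cspan cbasis" by (simp add: findim.span_Basis)
    then obtain c where v: "v = (\<Sum>b\<in>cbasis. c b *\<^sub>C b)"
      by (auto simp: complex_vector.span_finite[OF findim.finite_Basis])
    have "norm (f v) = norm (\<Sum>b\<in>cbasis. c b *\<^sub>C f b)"
      by (simp add: v clinear_sum[OF f] clinear_scale[OF f])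
    also have "\<dots> \<le> (\<Sum>b\<in>cbasis. cmod (c b) * norm (f b))"
      using norm_sum by (simp add: norm_scaleC[symmetric])
    also have "\<dots> \<le> (\<Sum>b\<in>cbasis. (K * norm v) * norm (f b))"
      by (intro sum_mono mult_right_mono) (use K v in auto)
    also have "\<dots> = norm v * (K * (\<Sum>b\<in>cbasis. norm (f b)))"
      by (simp add: sum_distrib_left mult_ac)
    finally show "norm (f v) \<le> norm v * (K * (\<Sum>b\<in>cbasis. norm (f b)))" .
  qed (simp_all add: clinear_add[OF f] clinear_scale[OF f] scaleR_scaleC)
qed

lemma clinear_inj_on_imp_onto:
  fixes f :: "'d::findim_complex_vector \<Rightarrow> 'd"
  assumes f: "clinear f" and S: "csubspace S" and "f ` S \<subseteq> S" "inj_on f S"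
  shows "f ` S = S"
proof -
  interpret finite_dimensional_vector_space_pair_1
    "scaleC :: complex \<Rightarrow> 'd \<Rightarrow> 'd" cbasis "scaleC :: complex \<Rightarrow> 'd \<Rightarrow> 'd" ..
  have "cspan S = S" using S by (simp add: complex_vector.span_eq_iff)
  then have "complex_vector.dim (f ` S) = complex_vector.dim S"
    using dim_image_eq[OF f, of S] assms by (simp only: cspan_def)
  then show ?thesis
    using findim.subspace_dim_equal[of "f ` S" S] assms clin.linear_subspace_image by auto
qed

lemma clinear_inj_imp_inverse:
  fixes f :: "'d::findim_complex_vector \<Rightarrow> 'd"
  assumes f: "clinear f" and "\<And>v. f v = 0 \<Longrightarrow> v = 0"
  shows "\<exists>g. clinear g \<and> (\<forall>v. g (f v) = v) \<and> (\<forall>v. f (g v) = v)"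
proof -
  have inj: "inj f" using clin.linear_inj_iff_eq_0[OF f] assms by blast
  moreover have "surj f"
    using clinear_inj_on_imp_onto[OF f complex_vector.subspace_UNIV] inj by simp
  moreover obtain g where "clinear g" "g \<circ> f = id"
    using clin.linear_injective_left_inverse[OF f inj] by blast
  ultimately show ?thesis by (metis comp_apply id_apply surj_def)
qed

subsection \<open>The algebra of endomorphisms\<close>

lemma End_D_iff: "A \<in> End_D \<longleftrightarrow> clinear (blinfun_apply A)"
  by (simp add: End_D_def clinear_on_UNIV)

lemma End_D_scaleC: "A \<in> End_D \<Longrightarrow> blinfun_apply A (c *\<^sub>C v) = c *\<^sub>C blinfun_apply A v"
  by (simp add: End_D_iff clinear_scale)

lemma End_D_I: "(\<And>c v. blinfun_apply A (c *\<^sub>C v) = c *\<^sub>C blinfun_apply A v) \<Longrightarrow> A \<in> End_D"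
  by (simp add: End_D_iff clinearI blinfun.add_right)

lemma End_D_ops:
  "0 \<in> End_D" "id_blinfun \<in> End_D"
  "A \<in> End_D \<Longrightarrow> B \<in> End_D \<Longrightarrow> A + B \<in> End_D"
  "A \<in> End_D \<Longrightarrow> B \<in> End_D \<Longrightarrow> A - B \<in> End_D"
  "A \<in> End_D \<Longrightarrow> c *\<^sub>C A \<in> End_D"
  "A \<in> End_D \<Longrightarrow> B \<in> End_D \<Longrightarrow> A o\<^sub>L B \<in> End_D"
  "A \<in> End_D \<Longrightarrow> B \<in> End_D \<Longrightarrow> lie_bracket A B \<in> End_D"
  unfolding lie_bracket_def
  by (auto intro!: End_D_I simp: End_D_scaleC blinfun.bilinear_simps blinfun_apply_scaleC
      scaleC_add_right complex_vector.scale_right_diff_distrib scaleC_scaleC mult.commute)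

lemma End_D_sum: "(\<And>a. a \<in> I \<Longrightarrow> f a \<in> End_D) \<Longrightarrow> (\<Sum>a\<in>I. f a) \<in> End_D"
  by (induction I rule: infinite_finite_induct) (auto intro: End_D_ops)

lemma csubspace_End_D: "csubspace End_D"
  by (auto simp: complex_vector.subspace_def intro: End_D_ops)

lemma
  fixes f :: "'d::findim_complex_vector \<Rightarrow> 'd"
  assumes "clinear f"
  shows Blinfun_clinear_apply: "blinfun_apply (Blinfun f) = f"
    and Blinfun_clinear_End: "Blinfun f \<in> End_D"
  using assms by (simp_all add: bounded_linear_Blinfun_apply bounded_linear_clinear End_D_iff)

lemma blinfun_compose_assoc: "(A o\<^sub>L B) o\<^sub>L C = A o\<^sub>L (B o\<^sub>L C)"
  by (rule blinfun_eqI) simp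

lemma
  shows blinfun_compose_scaleC_left: "(c *\<^sub>C A) o\<^sub>L B = c *\<^sub>C (A o\<^sub>L B)"
    and blinfun_compose_scaleC_right: "A \<in> End_D \<Longrightarrow> A o\<^sub>L (c *\<^sub>C B) = c *\<^sub>C (A o\<^sub>L B)"
  by (rule blinfun_eqI; simp add: blinfun_apply_scaleC End_D_scaleC)+

text \<open>The ambient type consists of real-linear operators. Closedness of complex linearity
  keeps limits of difference quotients inside \<open>End_D\<close>.\<close>

lemma closed_End_D: "closed (End_D :: ('d::findim_complex_vector \<Rightarrow>\<^sub>L 'd) set)"
proof -
  have "End_D = (\<Inter>c. \<Inter>v. {A :: 'd \<Rightarrow>\<^sub>L 'd. blinfun_apply A (c *\<^sub>C v) = c *\<^sub>C blinfun_apply A v})"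
    by (auto simp: End_D_scaleC intro: End_D_I)
  also have "closed \<dots>"
  proof (intro closed_INT ballI closed_Collect_eq)
    fix c v
    show "continuous_on UNIV (\<lambda>A :: 'd \<Rightarrow>\<^sub>L 'd. c *\<^sub>C blinfun_apply A v)"
      by (intro bounded_bilinear.continuous_on[OF bounded_bilinear_scaleC] continuous_intros)
  qed (intro continuous_intros)
  finally show ?thesis .
qed

section \<open>Simultaneous eigenspaces\<close>

text \<open>Two operators are allowed because neither family of eigenvalues has to separate the
  indices by itself; only the pairs do.\<close>

lemma sum_simultaneous_eigenvectors_eq_0:
  fixes u :: "'i \<Rightarrow> 'a::complex_vector"
  assumes "finite I" and S: "clinear S" and T: "clinear T"
    and "\<And>a. a \<in> I \<Longrightarrow> S (u a) = \<alpha> a *\<^sub>C u a" "\<And>a. a \<in> I \<Longrightarrow> T (u a) = \<beta> a *\<^sub>C u a"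
    and "\<And>a b. a \<in> I \<Longrightarrow> b \<in> I \<Longrightarrow> \<alpha> a = \<alpha> b \<Longrightarrow> \<beta> a = \<beta> b \<Longrightarrow> a = b"
    and "(\<Sum>a\<in>I. u a) = 0" and "a \<in> I"
  shows "u a = 0"
  using assms(1,4-)
proof (induction I arbitrary: u a)
  case (insert m I)
  \<comment> \<open>Applying \<open>R - f m\<close> to the vanishing sum removes the term of index
    \<open>m\<close> and multiplies the others by \<open>f a - f m\<close>, so the induction
    hypothesis applies to the rescaled vectors. With \<open>S\<close> and \<open>T\<close> for
    \<open>R\<close>, one of the two factors is nonzero.\<close>
  have *: "(f m :: complex) = f a \<or> u a = 0"
    if a: "a \<in> I" and R: "clinear R" and Ru: "\<And>a. a \<in> insert m I \<Longrightarrow> R (u a) = f a *\<^sub>C u a" for f R a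
  proof -
    have "0 = R (\<Sum>a\<in>insert m I. u a) - f m *\<^sub>C (\<Sum>a\<in>insert m I. u a)"
      using insert.prems(4) by (simp add: clinear_0[OF R])
    also have "\<dots> = (\<Sum>a\<in>insert m I. (f a - f m) *\<^sub>C u a)"
      by (simp only: clinear_sum[OF R] complex_vector.scale_sum_right Ru
          complex_vector.scale_left_diff_distrib sum_subtractf cong: sum.cong)
    also have "\<dots> = (\<Sum>a\<in>I. (f a - f m) *\<^sub>C u a)" using insert.hyps by simp
    finally have s: "(\<Sum>a\<in>I. (f a - f m) *\<^sub>C u a) = 0" by simp
    have "(f a - f m) *\<^sub>C u a = 0"
    proof (rule insert.IH[of "\<lambda>a. (f a - f m) *\<^sub>C u a", OF _ _ _ s a])
      fix b assume "b \<in> I"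
      then show "S ((f b - f m) *\<^sub>C u b) = \<alpha> b *\<^sub>C (f b - f m) *\<^sub>C u b"
        and "T ((f b - f m) *\<^sub>C u b) = \<beta> b *\<^sub>C (f b - f m) *\<^sub>C u b"
        using insert.prems(1,2)[of b]
        by (simp_all add: clinear_scale[OF S] clinear_scale[OF T] scaleC_scaleC mult.commute)
    qed (use insert.prems(3) in auto)
    then show ?thesis by auto
  qed
  have zero: "u b = 0" if b: "b \<in> I" for b
    using *[OF b S insert.prems(1)] *[OF b T insert.prems(2)] insert.prems(3)[of m b] b insert.hyps
    by auto
  then have "u m = 0" using insert.prems(4) insert.hyps by simp
  then show ?case using zero insert.prems(5) by auto
qed simp

text \<open>Directness makes the chosen components unique, and uniqueness makes them linear.\<close>

lemma ex_projections:
  fixes V :: "'i \<Rightarrow> 'a::complex_vector set"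
  assumes sub: "\<And>a. a \<in> I \<Longrightarrow> csubspace (V a)"
    and ex: "\<And>v. \<exists>u. (\<forall>a\<in>I. u a \<in> V a) \<and> v = (\<Sum>a\<in>I. u a)"
    and zero: "\<And>u a. (\<And>a. a \<in> I \<Longrightarrow> u a \<in> V a) \<Longrightarrow> (\<Sum>a\<in>I. u a) = 0 \<Longrightarrow> a \<in> I \<Longrightarrow> u a = 0"
  obtains p where "\<And>a. a \<in> I \<Longrightarrow> clinear (p a)" "\<And>a v. a \<in> I \<Longrightarrow> p a v \<in> V a"
    "\<And>v. (\<Sum>a\<in>I. p a v) = v"
    "\<And>u v a. \<forall>a\<in>I. u a \<in> V a \<Longrightarrow> (\<Sum>a\<in>I. u a) = v \<Longrightarrow> a \<in> I \<Longrightarrow> p a v = u a"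
proof -
  obtain c where c: "\<And>v a. a \<in> I \<Longrightarrow> c v a \<in> V a" "\<And>v. v = (\<Sum>a\<in>I. c v a)"
    using ex by metis
  have uniq: "c v a = u a"
    if "\<And>a. a \<in> I \<Longrightarrow> u a \<in> V a" "(\<Sum>a\<in>I. u a) = v" "a \<in> I" for u v a
  proof -
    have "c v a - u a = 0"
      by (rule zero) (use that c sub in \<open>auto simp: sum_subtractf complex_vector.subspace_diff\<close>)
    then show ?thesis by simp
  qed
  show ?thesis
  proof (rule that[of "\<lambda>a v. c v a"])
    fix a assume a: "a \<in> I"
    show "clinear (\<lambda>v. c v a)"
    proof (rule clinearI)
      show "c (u + v) a = c u a + c v a" for u v
        by (rule uniq[of "\<lambda>a. c u a + c v a"])
          (use a c sub in \<open>auto simp: sum.distrib complex_vector.subspace_add\<close>)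
      show "c (b *\<^sub>C u) a = b *\<^sub>C c u a" for b u
        by (rule uniq[of "\<lambda>a. b *\<^sub>C c u a"])
          (use a c sub in \<open>auto simp: complex_vector.scale_sum_right[symmetric]
             complex_vector.subspace_scale\<close>)
    qed
  qed (use c uniq in auto)
qed

section \<open>A nilpotent endomorphism is conjugate to its nonzero multiples\<close>

text \<open>\<open>W\<close> and \<open>K\<close> are independent but need not span the space. If
  \<open>R\<close> projects onto \<open>K\<close>, then \<open>1 - R\<close> kills \<open>K\<close>
  and is injective on \<open>W\<close>, because its kernel lies in \<open>K\<close>. Following it by
  a left inverse on \<open>W\<close> gives the projection.\<close>

lemma ex_projection_killing:
  fixes W K :: "'a::complex_vector set"
  assumes W: "csubspace W" and K: "csubspace K" and WK: "W \<inter> K \<subseteq> {0}"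
  obtains P where "clinear P" "range P \<subseteq> W" "\<And>w. w \<in> W \<Longrightarrow> P w = w" "\<And>k. k \<in> K \<Longrightarrow> P k = 0"
proof -
  have id: "clinear (\<lambda>v::'a. v)" by (rule clinearI) auto
  obtain R where R: "clinear R" "range R \<subseteq> K" "\<And>k. k \<in> K \<Longrightarrow> R k = k"
    using clin.linear_exists_left_inverse_on[OF id K] by auto
  have d: "clinear (\<lambda>v. v - R v)"
    by (intro clinearI)
      (auto simp: clinear_add[OF R(1)] clinear_scale[OF R(1)] complex_vector.scale_right_diff_distrib)
  have "inj_on (\<lambda>v. v - R v) W"
  proof (rule inj_onI)
    fix u v assume uv: "u \<in> W" "v \<in> W" and "u - R u = v - R v"
    then have "u - v = R (u - v)" by (simp add: clinear_diff[OF R(1)] algebra_simps)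
    then have "u - v \<in> K" using R(2) by (metis rangeI subsetD)
    then have "u - v \<in> W \<inter> K" using uv complex_vector.subspace_diff[OF W] by blast
    then show "u = v" using WK by auto
  qed
  then obtain g where g: "range g \<subseteq> W" "clinear g" "\<And>w. w \<in> W \<Longrightarrow> g (w - R w) = w"
    using clin.linear_exists_left_inverse_on[OF d W] by auto
  show ?thesis
  proof (rule that[of "\<lambda>v. g (v - R v)"])
    show "clinear (\<lambda>v. g (v - R v))"
      using Vector_Spaces.linear_compose[OF d g(2)] by (simp add: o_def)
  qed (use g R clinear_0[OF g(2)] in auto)
qed

text \<open>The map on \<open>V\<close> is extended from \<open>N(V)\<close>, where it is given by induction. It may be chosen to be
  the identity on a complement of \<open>ker N \<inter> N(V)\<close> in \<open>ker N\<close>, which keeps it injective.\<close>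

lemma nilpotent_scaling_on:
  fixes N :: "'a::complex_vector \<Rightarrow> 'a" and a :: complex
  assumes N: "clinear N" and a: "a \<noteq> 0" and "csubspace V" "N ` V \<subseteq> V"
    and "\<And>v. v \<in> V \<Longrightarrow> (N ^^ n) v = 0"
  shows "\<exists>g. clinear g \<and> g ` V \<subseteq> V \<and> (\<forall>v\<in>V. g v = 0 \<longrightarrow> v = 0) \<and> (\<forall>v\<in>V. g (N v) = a *\<^sub>C N (g v))"
  using assms(3-)
proof (induction n arbitrary: V)
  case 0
  have "N v = a *\<^sub>C N v" if "v \<in> V" for v
  proof -
    have "v = 0" using 0(3)[OF that] by simp
    then show ?thesis by (simp add: clinear_0[OF N])
  qed
  then show ?case by (intro exI[of _ "\<lambda>v. v"]) (auto intro: clinearI)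
next
  case (Suc n)
  define W where "W = N ` V"
  have W: "csubspace W" "W \<subseteq> V" "N ` W \<subseteq> W"
    using Suc.prems clin.linear_subspace_image[OF N] by (auto simp: W_def)
  have "(N ^^ n) v = 0" if "v \<in> W" for v
    using that Suc.prems(3) by (auto simp: W_def funpow_swap1)
  then have "\<exists>g. clinear g \<and> g ` W \<subseteq> W \<and> (\<forall>v\<in>W. g v = 0 \<longrightarrow> v = 0) \<and>
      (\<forall>v\<in>W. g (N v) = a *\<^sub>C N (g v))"
    by (rule Suc.IH[OF W(1,3)])
  then obtain gW where "clinear gW \<and> gW ` W \<subseteq> W \<and> (\<forall>v\<in>W. gW v = 0 \<longrightarrow> v = 0) \<and>
      (\<forall>v\<in>W. gW (N v) = a *\<^sub>C N (gW v))" ..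
  then have gW: "clinear gW" "gW ` W \<subseteq> W" "\<And>v. v \<in> W \<Longrightarrow> gW v = 0 \<Longrightarrow> v = 0"
      "\<And>v. v \<in> W \<Longrightarrow> gW (N v) = a *\<^sub>C N (gW v)"
    by auto
  obtain \<rho> where \<rho>: "range \<rho> \<subseteq> V" "clinear \<rho>" "\<And>w. w \<in> W \<Longrightarrow> N (\<rho> w) = w"
    using clin.linear_exists_right_inverse_on[OF N Suc.prems(1)] by (auto simp: W_def)
  define Z where "Z = {v \<in> V. N v = 0}"
  have Z: "csubspace Z"
    using Suc.prems(1) unfolding Z_def complex_vector.subspace_def
    by (auto simp: clinear_0[OF N] clinear_add[OF N] clinear_scale[OF N])
  then have ZW: "csubspace (Z \<inter> W)" using W complex_vector.subspace_inter by blast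
  \<comment> \<open>The kernel of this projection within \<open>Z\<close> is the complement
    \<open>K\<close> of \<open>Z \<inter> W\<close> in \<open>Z\<close>.\<close>
  obtain Q where Q: "clinear Q" "range Q \<subseteq> Z \<inter> W" "\<And>w. w \<in> Z \<inter> W \<Longrightarrow> Q w = w"
    by (rule ex_projection_killing[OF ZW complex_vector.subspace_single_0]) auto
  define K where "K = {z \<in> Z. Q z = 0}"
  have K: "csubspace K"
    using Z unfolding K_def complex_vector.subspace_def
    by (auto simp: clinear_0[OF Q(1)] clinear_add[OF Q(1)] clinear_scale[OF Q(1)])
  have KW: "K \<inter> W \<subseteq> {0}" "W \<inter> K \<subseteq> {0}" using Q by (auto simp: K_def)
  obtain P where P: "clinear P" "range P \<subseteq> W" "\<And>w. w \<in> W \<Longrightarrow> P w = w" "\<And>k. k \<in> K \<Longrightarrow> P k = 0"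
    by (rule ex_projection_killing[OF W(1) K KW(2)]) blast
  obtain R where R: "clinear R" "range R \<subseteq> K" "\<And>k. k \<in> K \<Longrightarrow> R k = k" "\<And>w. w \<in> W \<Longrightarrow> R w = 0"
    by (rule ex_projection_killing[OF K W(1) KW(1)]) blast
  have KV: "k \<in> V" "N k = 0" if "k \<in> K" for k using that by (auto simp: K_def Z_def)
  have NR: "N (R v) = 0" for v using R(2) KV by blast
  \<comment> \<open>On \<open>W\<close> this is \<open>gW\<close> and on \<open>K\<close> the
    identity. The last summand is forced by the requirement \<open>a N (g v) = gW (N v)\<close>: it
    lifts, through the section \<open>\<rho>\<close> of \<open>N\<close>, what the first two
    summands leave over.\<close>
  define g where "g v = gW (P v) + R v + inverse a *\<^sub>C \<rho> (gW (N (v - P v - R v)))" for v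
  have comp: "clinear (\<lambda>v. f (f' v))" if "clinear f" "clinear f'" for f f' :: "'a \<Rightarrow> 'a"
    using Vector_Spaces.linear_compose[OF that(2,1)] by (simp add: o_def)
  have id: "clinear (\<lambda>v::'a. v)" by (rule clinearI) auto
  have g: "clinear g"
    unfolding g_def
    by (intro clin.linear_compose_add clin.linear_compose_scale_right comp[OF \<rho>(2)] comp[OF gW(1)]
        comp[OF N] clin.linear_compose_sub id P(1) R(1))
  have gV: "g v \<in> V" if v: "v \<in> V" for v
  proof -
    have "gW (P v) \<in> V" "R v \<in> V" "\<rho> (gW (N (v - P v - R v))) \<in> V"
      using P(2) gW(2) W(2) R(2) KV \<rho>(1) by blast+
    then show ?thesis
      unfolding g_def
      using Suc.prems(1) by (intro complex_vector.subspace_add complex_vector.subspace_scale)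
  qed
  have g_N: "g (N v) = gW (N v)" if "v \<in> V" for v
    using that P(3)[of "N v"] R(4)[of "N v"]
    by (simp add: g_def W_def clinear_0[OF N] clinear_0[OF gW(1)] clinear_0[OF \<rho>(2)])
  have N_g: "a *\<^sub>C N (g v) = gW (N v)" if v: "v \<in> V" for v
  proof -
    have PW: "P v \<in> W" using P(2) by auto
    have "R v \<in> V" using R(2) KV by blast
    then have "v - P v - R v \<in> V"
      using v PW W(2) Suc.prems(1) by (meson complex_vector.subspace_diff subsetD)
    then have "gW (N (v - P v - R v)) \<in> W" using gW(2) by (auto simp: W_def)
    then have "N (\<rho> (gW (N (v - P v - R v)))) = gW (N (v - P v - R v))" by (rule \<rho>(3))
    then have "a *\<^sub>C N (g v) = a *\<^sub>C N (gW (P v)) + gW (N (v - P v))"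
      using a by (simp add: g_def clinear_add[OF N] clinear_scale[OF N] NR scaleC_add_right
          scaleC_scaleC scaleC_one clinear_diff[OF N])
    also have "\<dots> = gW (N v)"
      using gW(4)[OF PW] by (simp add: clinear_diff[OF N] clinear_diff[OF gW(1)])
    finally show ?thesis .
  qed
  \<comment> \<open>The intertwining relation puts \<open>v\<close> into \<open>Z\<close>. Split as
    \<open>v = k + Q v\<close> with \<open>k\<close> in \<open>K\<close>, it satisfies
    \<open>g v = k + gW (Q v)\<close>, and \<open>K\<close> and \<open>W\<close> meet only in
    0.\<close>
  have inj: "v = 0" if v: "v \<in> V" and gv: "g v = 0" for v
  proof -
    have "gW (N v) = 0" using N_g[OF v] by (simp add: gv clinear_0[OF N])
    then have "N v = 0" using gW(3)[of "N v"] v by (auto simp: W_def)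
    then have vZ: "v \<in> Z" using v by (simp add: Z_def)
    have Qv: "Q v \<in> Z \<inter> W" using Q(2) by auto
    define k where "k = v - Q v"
    have k: "k \<in> K"
      using vZ Qv Z Q(3)[OF Qv]
      by (auto simp: K_def k_def clinear_diff[OF Q(1)] complex_vector.subspace_diff)
    have v_eq: "v = k + Q v" by (simp add: k_def)
    have "P v = P k + P (Q v)" "R v = R k + R (Q v)"
      by (metis v_eq clinear_add[OF P(1)], metis v_eq clinear_add[OF R(1)])
    then have Pv: "P v = Q v" and Rv: "R v = k"
      using P(3)[of "Q v"] P(4)[OF k] R(3)[OF k] R(4)[of "Q v"] Qv by auto
    have "gW (Q v) + k = 0"
      using gv unfolding g_def Pv Rv
      by (simp add: k_def clinear_0[OF N] clinear_0[OF gW(1)] clinear_0[OF \<rho>(2)])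
    then have "k = - gW (Q v)" by (simp add: add_eq_0_iff)
    then have "k \<in> W" using Qv gW(2) W(1) by (auto intro: complex_vector.subspace_neg)
    then have "k = 0" using k KW by auto
    then have "gW (Q v) = 0" using \<open>k = - gW (Q v)\<close> by simp
    then have "Q v = 0" using gW(3) Qv by auto
    then show "v = 0" using \<open>k = 0\<close> by (simp add: k_def)
  qed
  show ?case
    using g gV inj N_g g_N by (intro exI[of _ g]) auto
qed

text \<open>A basis of eigenvectors is grouped by eigenvalue; the uniqueness clause later shows that
  the projections commute with operators preserving the eigenspaces.\<close>

lemma ex_eigenspace_projections:
  fixes s :: "'d::findim_complex_vector \<Rightarrow>\<^sub>L 'd"
  assumes s: "s \<in> End_D" and "semisimple_op s"
  obtains \<Lambda> p where "finite \<Lambda>" "\<And>c. c \<in> \<Lambda> \<Longrightarrow> clinear (p c)"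
    "\<And>c v. c \<in> \<Lambda> \<Longrightarrow> blinfun_apply s (p c v) = c *\<^sub>C p c v" "\<And>v. (\<Sum>c\<in>\<Lambda>. p c v) = v"
    "\<And>u v c. \<forall>c\<in>\<Lambda>. blinfun_apply s (u c) = c *\<^sub>C u c \<Longrightarrow> (\<Sum>c\<in>\<Lambda>. u c) = v \<Longrightarrow>
       c \<in> \<Lambda> \<Longrightarrow> p c v = u c"
proof -
  define E where "E = {v. \<exists>c. blinfun_apply s v = c *\<^sub>C v}"
  obtain B where B: "B \<subseteq> E" "complex_vector.independent B" "E \<subseteq> cspan B"
    using complex_vector.maximal_independent_subset by blast
  have fin: "finite B" using B(2) findim.finiteI_independent by blast
  have "cspan E = UNIV" using assms by (simp add: semisimple_op_def E_def)
  then have span: "cspan B = UNIV"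
    using complex_vector.span_minimal[OF B(3) complex_vector.subspace_span] by auto
  have "\<forall>b\<in>B. \<exists>c. blinfun_apply s b = c *\<^sub>C b" using B(1) by (auto simp: E_def)
  then obtain ev where ev: "\<And>b. b \<in> B \<Longrightarrow> blinfun_apply s b = ev b *\<^sub>C b"
    using bchoice[of B "\<lambda>b c. blinfun_apply s b = c *\<^sub>C b"] by auto
  define V where "V c = {v. blinfun_apply s v = c *\<^sub>C v}" for c
  have lin: "clinear (blinfun_apply s)" using s by (simp add: End_D_iff)
  have sub: "csubspace (V c)" for c
    by (auto simp: V_def complex_vector.subspace_def blinfun.add_right End_D_scaleC[OF s]
        scaleC_add_right scaleC_scaleC mult.commute)
  have "\<exists>u. (\<forall>c\<in>ev ` B. u c \<in> V c) \<and> v = (\<Sum>c\<in>ev ` B. u c)" for v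
  proof -
    obtain r where r: "v = (\<Sum>b\<in>B. r b *\<^sub>C b)"
      using UNIV_I[of v] unfolding span[symmetric] complex_vector.span_finite[OF fin] by auto
    have "(\<Sum>b\<in>{b \<in> B. ev b = c}. r b *\<^sub>C b) \<in> V c" for c
      using sub ev by (intro complex_vector.subspace_sum complex_vector.subspace_scale)
        (auto simp: V_def)
    then show ?thesis
      using sum.image_gen[OF fin, of "\<lambda>b. r b *\<^sub>C b" ev] r
      by (intro exI[of _ "\<lambda>c. \<Sum>b\<in>{b \<in> B. ev b = c}. r b *\<^sub>C b"]) auto
  qed
  note dec = this
  show ?thesis
  proof (rule ex_projections[of "ev ` B" V, OF sub dec])
    fix u c assume u: "\<And>c. c \<in> ev ` B \<Longrightarrow> u c \<in> V c" "(\<Sum>c\<in>ev ` B. u c) = 0" "c \<in> ev ` B"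
    \<comment> \<open>The criterion for two operators is applied with \<open>s\<close> in both
      roles.\<close>
    show "u c = 0"
      by (rule sum_simultaneous_eigenvectors_eq_0[of "ev ` B" _ _ u "\<lambda>c. c" "\<lambda>c. c",
          OF _ lin lin _ _ _ u(2,3)]) (use fin u(1) in \<open>auto simp: V_def\<close>)
  next
    fix p
    assume p: "\<And>c. c \<in> ev ` B \<Longrightarrow> clinear (p c)" "\<And>c v. c \<in> ev ` B \<Longrightarrow> p c v \<in> V c"
      "\<And>v. (\<Sum>c\<in>ev ` B. p c v) = v"
      and p_eq: "\<And>u v c. \<forall>c\<in>ev ` B. u c \<in> V c \<Longrightarrow> (\<Sum>c\<in>ev ` B. u c) = v \<Longrightarrow>
        c \<in> ev ` B \<Longrightarrow> p c v = u c"
    show thesis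
    proof (rule that[of "ev ` B" p])
      fix c v assume "c \<in> ev ` B"
      then show "blinfun_apply s (p c v) = c *\<^sub>C p c v" using p(2) by (simp add: V_def)
    next
      fix u v c
      assume "\<forall>c\<in>ev ` B. blinfun_apply s (u c) = c *\<^sub>C u c"
        and s: "(\<Sum>c\<in>ev ` B. u c) = v" "c \<in> ev ` B"
      then have "\<forall>c\<in>ev ` B. u c \<in> V c" by (simp add: V_def)
      then show "p c v = u c" using s by (rule p_eq)
    qed (use fin in simp, fact p(1), fact p(3))
  qed
qed

text \<open>The operator \<nu> preserves the eigenspaces of \<open>s\<close>. Solutions on the
  single eigenspaces are glued along the projections, and the result commutes with \<open>s\<close>
  because it preserves each eigenspace.\<close>

lemma nilpotent_scaling_commuting:
  fixes s \<nu> :: "'d::findim_complex_vector \<Rightarrow>\<^sub>L 'd"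
  assumes s: "s \<in> End_D" "semisimple_op s" and \<nu>: "\<nu> \<in> End_D" "nilpotent_op \<nu>"
    and comm: "lie_bracket s \<nu> = 0" and a: "a \<noteq> 0"
  obtains g g' where "g \<in> End_D" "g' \<in> End_D" "g o\<^sub>L g' = id_blinfun" "g' o\<^sub>L g = id_blinfun"
    "lie_bracket s g = 0" "g o\<^sub>L \<nu> o\<^sub>L g' = a *\<^sub>C \<nu>"
proof -
  obtain \<Lambda> p where fin: "finite \<Lambda>" and p: "\<And>c. c \<in> \<Lambda> \<Longrightarrow> clinear (p c)"
    "\<And>c v. c \<in> \<Lambda> \<Longrightarrow> blinfun_apply s (p c v) = c *\<^sub>C p c v" "\<And>v. (\<Sum>c\<in>\<Lambda>. p c v) = v"
    and p_eq: "\<And>u v c. \<forall>c\<in>\<Lambda>. blinfun_apply s (u c) = c *\<^sub>C u c \<Longrightarrow>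
       (\<Sum>c\<in>\<Lambda>. u c) = v \<Longrightarrow> c \<in> \<Lambda> \<Longrightarrow> p c v = u c"
    by (rule ex_eigenspace_projections[OF s]) blast
  obtain n where n: "\<And>v. (blinfun_apply \<nu> ^^ n) v = 0" using \<nu> by (auto simp: nilpotent_op_def)
  have s\<nu>: "blinfun_apply s (blinfun_apply \<nu> v) = blinfun_apply \<nu> (blinfun_apply s v)" for v
    using arg_cong[OF comm, of "\<lambda>A. blinfun_apply A v"]
    by (simp add: lie_bracket_def blinfun.diff_left)
  define V where "V c = {v. blinfun_apply s v = c *\<^sub>C v}" for c
  have V: "csubspace (V c)" for c
    by (auto simp: V_def complex_vector.subspace_def blinfun.add_right End_D_scaleC[OF s(1)]
        scaleC_add_right scaleC_scaleC mult.commute)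
  have \<nu>V: "blinfun_apply \<nu> ` V c \<subseteq> V c" for c
    by (auto simp: V_def s\<nu> End_D_scaleC[OF \<nu>(1)])
  have "clinear (blinfun_apply \<nu>)" using \<nu>(1) by (simp add: End_D_iff)
  then have "\<forall>c. \<exists>g. clinear g \<and> g ` V c \<subseteq> V c \<and> (\<forall>v\<in>V c. g v = 0 \<longrightarrow> v = 0) \<and>
      (\<forall>v\<in>V c. g (blinfun_apply \<nu> v) = a *\<^sub>C blinfun_apply \<nu> (g v))"
    by (intro allI nilpotent_scaling_on[OF _ a V \<nu>V, where n = n] n)
  from choice[OF this] obtain \<gamma> where "\<forall>c. clinear (\<gamma> c) \<and> \<gamma> c ` V c \<subseteq> V c \<and>
      (\<forall>v\<in>V c. \<gamma> c v = 0 \<longrightarrow> v = 0) \<and>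
      (\<forall>v\<in>V c. \<gamma> c (blinfun_apply \<nu> v) = a *\<^sub>C blinfun_apply \<nu> (\<gamma> c v))" ..
  then have \<gamma>: "\<And>c. clinear (\<gamma> c)" "\<And>c v. v \<in> V c \<Longrightarrow> \<gamma> c v \<in> V c"
      "\<And>c v. v \<in> V c \<Longrightarrow> \<gamma> c v = 0 \<Longrightarrow> v = 0"
      "\<And>c v. v \<in> V c \<Longrightarrow> \<gamma> c (blinfun_apply \<nu> v) = a *\<^sub>C blinfun_apply \<nu> (\<gamma> c v)"
    by (auto simp: image_subset_iff)
  have pV: "p c v \<in> V c" if "c \<in> \<Lambda>" for c v using p(2)[OF that] by (simp add: V_def)
  define f where "f v = (\<Sum>c\<in>\<Lambda>. \<gamma> c (p c v))" for v
  have lin: "clinear f"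
    unfolding f_def
    by (intro clinearI) (simp_all add: clinear_add[OF p(1)] clinear_scale[OF p(1)]
        clinear_add[OF \<gamma>(1)] clinear_scale[OF \<gamma>(1)] sum.distrib complex_vector.scale_sum_right)
  have "v = 0" if "f v = 0" for v
  proof -
    have "p c v = 0" if c: "c \<in> \<Lambda>" for c
    proof -
      \<comment> \<open>The vectors \<open>\<gamma> c (p c v)\<close> are eigenspace components of
        \<open>f v = 0\<close>, so uniqueness of components makes each of them zero.\<close>
      have "p c 0 = \<gamma> c (p c v)"
        by (rule p_eq) (use c \<open>f v = 0\<close> \<gamma>(2)[OF pV] in \<open>auto simp: f_def V_def\<close>)
      then show ?thesis using \<gamma>(3) pV[OF c] clinear_0[OF p(1)[OF c]] by metis
    qed
    then show ?thesis using p(3)[of v] by simp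
  qed
  then obtain f' where f': "clinear f'" "\<And>v. f' (f v) = v" "\<And>v. f (f' v) = v"
    using clinear_inj_imp_inverse[OF lin] by blast
  have f\<nu>: "f (blinfun_apply \<nu> v) = a *\<^sub>C blinfun_apply \<nu> (f v)" for v
  proof -
    have "p c (blinfun_apply \<nu> v) = blinfun_apply \<nu> (p c v)" if "c \<in> \<Lambda>" for c
      by (rule p_eq) (use that p in \<open>auto simp: s\<nu> End_D_scaleC[OF \<nu>(1)] blinfun.sum_right[symmetric]\<close>)
    then show ?thesis
      by (simp add: f_def \<gamma>(4) pV blinfun.sum_right complex_vector.scale_sum_right)
  qed
  have fs: "f (blinfun_apply s v) = blinfun_apply s (f v)" for v
  proof -
    have "blinfun_apply s v = (\<Sum>c\<in>\<Lambda>. blinfun_apply s (p c v))"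
      using p(3)[of v] by (metis blinfun.sum_right)
    then have "(\<Sum>c\<in>\<Lambda>. c *\<^sub>C p c v) = blinfun_apply s v" by (simp add: p(2))
    then have "p c (blinfun_apply s v) = c *\<^sub>C p c v" if "c \<in> \<Lambda>" for c
      using that by (intro p_eq) (auto simp: p(2) End_D_scaleC[OF s(1)])
    then show ?thesis
      using \<gamma>(2)[OF pV] by (simp add: f_def V_def blinfun.sum_right clinear_scale[OF \<gamma>(1)])
  qed
  show ?thesis
  proof (rule that[of "Blinfun f" "Blinfun f'"])
    show "Blinfun f o\<^sub>L \<nu> o\<^sub>L Blinfun f' = a *\<^sub>C \<nu>"
      by (rule blinfun_eqI)
        (simp add: Blinfun_clinear_apply lin f' f\<nu> blinfun_apply_scaleC)
    show "lie_bracket s (Blinfun f) = 0"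
      by (rule blinfun_eqI)
        (simp add: lie_bracket_def blinfun.diff_left Blinfun_clinear_apply lin fs)
  qed (auto intro!: blinfun_eqI simp: Blinfun_clinear_End Blinfun_clinear_apply lin f')
qed

section \<open>Lusztig strata are stable under conjugation and scaling\<close>

lemma GL_D_I:
  "g \<in> End_D \<Longrightarrow> g' \<in> End_D \<Longrightarrow> g o\<^sub>L g' = id_blinfun \<Longrightarrow> g' o\<^sub>L g = id_blinfun \<Longrightarrow> g \<in> GL_D"
  by (auto simp: GL_D_def)

lemma conj_saturationI:
  assumes "g \<in> End_D" "g' \<in> End_D" "g o\<^sub>L g' = id_blinfun" "g' o\<^sub>L g = id_blinfun" "u \<in> X"
  shows "g o\<^sub>L u o\<^sub>L g' \<in> conj_saturation X"
  using assms GL_D_I[of g g'] GL_D_I[of g' g] unfolding conj_saturation_def by blast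

lemma conj_saturationE:
  assumes "A \<in> conj_saturation X"
  obtains g g' u where "g \<in> End_D" "g' \<in> End_D" "g o\<^sub>L g' = id_blinfun" "g' o\<^sub>L g = id_blinfun"
    "u \<in> X" "A = g o\<^sub>L u o\<^sub>L g'"
  using assms unfolding conj_saturation_def GL_D_def by blast

lemma conj_saturation_conj:
  assumes "A \<in> conj_saturation X"
    and "f \<in> End_D" "f' \<in> End_D" "f o\<^sub>L f' = id_blinfun" "f' o\<^sub>L f = id_blinfun"
  shows "f o\<^sub>L A o\<^sub>L f' \<in> conj_saturation X"
proof -
  obtain g g' u where g: "g \<in> End_D" "g' \<in> End_D" "g o\<^sub>L g' = id_blinfun" "g' o\<^sub>L g = id_blinfun"
    "u \<in> X" "A = g o\<^sub>L u o\<^sub>L g'" using assms(1) by (rule conj_saturationE)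
  have *: "blinfun_apply f (blinfun_apply f' v) = v" "blinfun_apply f' (blinfun_apply f v) = v"
    "blinfun_apply g (blinfun_apply g' v) = v" "blinfun_apply g' (blinfun_apply g v) = v" for v
    using g assms by (metis blinfun_apply_blinfun_compose blinfun_apply_id_blinfun id_apply)+
  have "(f o\<^sub>L g) o\<^sub>L u o\<^sub>L (g' o\<^sub>L f') \<in> conj_saturation X"
    by (rule conj_saturationI) (use g assms in \<open>auto intro!: End_D_ops blinfun_eqI simp: *\<close>)
  moreover have "(f o\<^sub>L g) o\<^sub>L u o\<^sub>L (g' o\<^sub>L f') = f o\<^sub>L A o\<^sub>L f'"
    by (simp add: g(6) blinfun_compose_assoc)
  ultimately show ?thesis by simp
qed

lemma lusztig_strata_conj:
  assumes "\<Sigma> \<in> lusztig_strata" "A \<in> \<Sigma>"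
    and "f \<in> End_D" "f' \<in> End_D" "f o\<^sub>L f' = id_blinfun" "f' o\<^sub>L f = id_blinfun"
  shows "f o\<^sub>L A o\<^sub>L f' \<in> \<Sigma>"
  using assms conj_saturation_conj unfolding lusztig_strata_def by blast

lemma lie_bracket_scaleC:
  assumes "A \<in> End_D" "B \<in> End_D"
  shows "lie_bracket (a *\<^sub>C A) B = a *\<^sub>C lie_bracket A B" "lie_bracket A (a *\<^sub>C B) = a *\<^sub>C lie_bracket A B"
  using assms by (simp_all add: lie_bracket_def blinfun_compose_scaleC_left
      blinfun_compose_scaleC_right complex_vector.scale_right_diff_distrib)

text \<open>An operator and its nonzero multiples have the same centralizer.\<close>

lemma regular_center_scale:
  assumes s: "s \<in> End_D" and "u \<in> regular_center (centralizer s)" "a \<noteq> 0"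
  shows "a *\<^sub>C u \<in> regular_center (centralizer s)"
proof -
  have u: "u \<in> End_D" "lie_bracket s u = 0" using assms
    by (auto simp: regular_center_def lie_center_def centralizer_def)
  have "lie_bracket (a *\<^sub>C u) v = 0 \<longleftrightarrow> lie_bracket u v = 0" if "v \<in> End_D" for v
    using u that assms(3) by (simp add: lie_bracket_scaleC)
  moreover have "lie_bracket s (a *\<^sub>C u) = 0" using u s by (simp add: lie_bracket_scaleC)
  ultimately show ?thesis
    using assms u unfolding regular_center_def lie_center_def centralizer_def
    by (auto intro: End_D_ops)
qed

text \<open>A stratum is defined with a fixed \<nu>, so \<open>a *\<^sub>C (u + \<nu>)\<close> is
  not visibly of the required form. With \<open>f\<close> commuting with \<open>s\<close> and
  conjugating \<nu> to its multiple by \<open>a\<close>, it equals the conjugate by \<open>f\<close>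
  of \<open>a *\<^sub>C u + \<nu>\<close>.\<close>

lemma lusztig_strata_scale:
  assumes "\<Sigma> \<in> lusztig_strata" "A \<in> \<Sigma>" and a: "a \<noteq> 0"
  shows "a *\<^sub>C A \<in> \<Sigma>"
proof -
  obtain s \<nu> w where J: "jordan_decomposition w s \<nu>"
    and \<Sigma>: "\<Sigma> = conj_saturation {u + \<nu> |u. u \<in> regular_center (centralizer s)}"
    using assms(1) unfolding lusztig_strata_def by blast
  have s: "s \<in> End_D" "semisimple_op s" and \<nu>: "\<nu> \<in> End_D" "nilpotent_op \<nu>"
    and comm: "lie_bracket s \<nu> = 0"
    using J by (auto simp: jordan_decomposition_def)
  obtain g g' u where g: "g \<in> End_D" "g' \<in> End_D" "g o\<^sub>L g' = id_blinfun" "g' o\<^sub>L g = id_blinfun"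
    and u: "u \<in> regular_center (centralizer s)" and A: "A = g o\<^sub>L (u + \<nu>) o\<^sub>L g'"
    using assms(2) unfolding \<Sigma> by (rule conj_saturationE) auto
  obtain f f' where f: "f \<in> End_D" "f' \<in> End_D" "f o\<^sub>L f' = id_blinfun" "f' o\<^sub>L f = id_blinfun"
    "lie_bracket s f = 0" "f o\<^sub>L \<nu> o\<^sub>L f' = a *\<^sub>C \<nu>"
    using nilpotent_scaling_commuting[OF s \<nu> comm a] .
  \<comment> \<open>\<open>f\<close> lies in the centralizer of \<open>s\<close>, and
    \<open>u\<close> in the center of that algebra.\<close>
  have u_End: "u \<in> End_D" and "lie_bracket u f = 0"
    using u f by (auto simp: regular_center_def lie_center_def centralizer_def)
  then have "f o\<^sub>L u o\<^sub>L f' = u o\<^sub>L (f o\<^sub>L f')"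
    by (simp add: lie_bracket_def blinfun_compose_assoc[symmetric])
  then have fu: "f o\<^sub>L (a *\<^sub>C u) o\<^sub>L f' = a *\<^sub>C u"
    using f by (simp add: blinfun_compose_scaleC_left blinfun_compose_scaleC_right
        blinfun_compose_assoc) (simp add: blinfun_eqI)
  define X where "X = {u + \<nu> |u. u \<in> regular_center (centralizer s)}"
  have "a *\<^sub>C u + \<nu> \<in> X"
    using regular_center_scale[OF s(1) u a] by (auto simp: X_def)
  then have "f o\<^sub>L (a *\<^sub>C u + \<nu>) o\<^sub>L f' \<in> conj_saturation X"
    using f by (intro conj_saturationI)
  moreover have "f o\<^sub>L (a *\<^sub>C u + \<nu>) o\<^sub>L f' = a *\<^sub>C (u + \<nu>)"
    using fu f(6) by (simp add: bounded_bilinear.add_left[OF bounded_bilinear_blinfun_compose]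
        bounded_bilinear.add_right[OF bounded_bilinear_blinfun_compose] scaleC_add_right)
  ultimately have "g o\<^sub>L (a *\<^sub>C (u + \<nu>)) o\<^sub>L g' \<in> conj_saturation X"
    using g conj_saturation_conj by metis
  then show ?thesis
    using g by (simp add: A \<Sigma> X_def blinfun_compose_scaleC_left blinfun_compose_scaleC_right)
qed

section \<open>Tangent spaces\<close>

lemma has_derivative_scaleC_imp_tendsto:
  fixes f :: "complex \<Rightarrow> 'a::complex_normed_vector"
  assumes "(f has_derivative (\<lambda>s. s *\<^sub>C v)) (at 0)"
  shows "((\<lambda>t. inverse t *\<^sub>C (f t - f 0)) \<longlongrightarrow> v) (at 0)"
proof (rule Lim_transform)
  have lim: "((\<lambda>t. norm (f t - f 0 - t *\<^sub>C v) / norm t) \<longlongrightarrow> 0) (at 0)"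
    using assms by (simp add: has_derivative_at)
  show "((\<lambda>t. inverse t *\<^sub>C (f t - f 0) - v) \<longlongrightarrow> 0) (at 0)"
  proof (rule Lim_null_comparison[OF _ lim])
    have "norm (inverse t *\<^sub>C (f t - f 0) - v) \<le> norm (f t - f 0 - t *\<^sub>C v) / norm t" if "t \<noteq> 0" for t
    proof -
      have "inverse t *\<^sub>C (f t - f 0) - v = inverse t *\<^sub>C (f t - f 0 - t *\<^sub>C v)"
        using that by (simp add: complex_vector.scale_right_diff_distrib scaleC_scaleC scaleC_one)
      then show ?thesis by (simp add: norm_scaleC norm_inverse divide_inverse mult.commute)
    qed
    then show "\<forall>\<^sub>F t in at 0. norm (inverse t *\<^sub>C (f t - f 0) - v) \<le> norm (f t - f 0 - t *\<^sub>C v) / norm t"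
      by (simp add: eventually_at_filter)
  qed
qed simp

lemma has_derivative_scaleC_left:
  "((\<lambda>t. t *\<^sub>C v) has_derivative (\<lambda>s. s *\<^sub>C v)) F" for v :: "'a::complex_normed_vector"
  by (rule bounded_linear_imp_has_derivative)
    (rule bounded_bilinear.bounded_linear_left[OF bounded_bilinear_scaleC])

text \<open>The difference quotients of an arc at \<open>x\<close> lie in the closed subspace
  \<open>C\<close>, hence so does their limit; conversely straight lines realize every
  direction.\<close>

lemma tangent_space_affine:
  fixes C :: "'a::complex_normed_vector set"
  assumes C: "csubspace C" "closed C"
  shows "tangent_space {x + c |c. c \<in> C} x = C"
proof (intro set_eqI iffI)
  fix v assume "v \<in> tangent_space {x + c |c. c \<in> C} x"
  then obtain \<gamma> \<epsilon> where \<gamma>: "\<epsilon> > 0" "\<gamma> 0 = x" "\<gamma> ` ball 0 \<epsilon> \<subseteq> {x + c |c. c \<in> C}"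
    "(\<gamma> has_derivative (\<lambda>s. s *\<^sub>C v)) (at 0)" unfolding tangent_space_def by blast
  show "v \<in> C"
  proof (rule Lim_in_closed_set[OF C(2) _ _ has_derivative_scaleC_imp_tendsto[OF \<gamma>(4)]])
    show "\<forall>\<^sub>F t in at 0. inverse t *\<^sub>C (\<gamma> t - \<gamma> 0) \<in> C"
      unfolding eventually_at
    proof (intro exI[of _ \<epsilon>] conjI ballI impI)
      fix t :: complex assume "t \<noteq> 0 \<and> dist t 0 < \<epsilon>"
      then have "t \<in> ball 0 \<epsilon>" by (simp add: dist_commute)
      then have "\<gamma> t \<in> {x + c |c. c \<in> C}" using \<gamma>(3) by blast
      then show "inverse t *\<^sub>C (\<gamma> t - \<gamma> 0) \<in> C"
        using \<gamma>(2) complex_vector.subspace_scale[OF C(1)] by auto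
    qed (rule \<gamma>(1))
  qed simp
next
  fix v assume v: "v \<in> C"
  have der: "((\<lambda>t. x + t *\<^sub>C v) has_derivative (\<lambda>s. s *\<^sub>C v)) (at t)" for t
    using has_derivative_add[OF has_derivative_const has_derivative_scaleC_left[of v]] by simp
  show "v \<in> tangent_space {x + c |c. c \<in> C} x"
    unfolding tangent_space_def
    using v complex_vector.subspace_scale[OF C(1)] der
    by (intro CollectI exI[of _ "\<lambda>t. x + t *\<^sub>C v"] exI[of _ 1]) auto
qed

text \<open>A single chart, the translation by \<open>- x\<close>, straightens the whole affine
  space.\<close>

lemma csubmanifold_affine:
  fixes C :: "'a::complex_normed_vector set"
  assumes V: "csubspace V" and C: "csubspace C" "C \<subseteq> V" and x: "x \<in> V"
  shows "csubmanifold V {x + c |c. c \<in> C}"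
  unfolding csubmanifold_def
proof (intro conjI ballI)
  show "{x + c |c. c \<in> C} \<subseteq> V"
    using V C x by (auto intro: complex_vector.subspace_add)
  have hol: "holomorphic_in V V (\<lambda>z. z + d)" for d
    unfolding holomorphic_in_def
  proof (intro ballI exI conjI)
    show "((\<lambda>z. z + d) has_derivative (\<lambda>z. z)) (at u within V)" for u
      using has_derivative_add[OF has_derivative_ident has_derivative_const[of d]] by simp
  qed (simp add: clinear_on_def)
  have hom: "homeomorphism V V (\<lambda>z. z + - x) (\<lambda>z. z + x)"
  proof (rule homeomorphismI)
    show "(\<lambda>z. z + - x) ` V \<subseteq> V" "(\<lambda>z. z + x) ` V \<subseteq> V"
      using complex_vector.subspace_add[OF V] complex_vector.subspace_diff[OF V] x by auto
  qed (auto intro!: continuous_intros)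
  fix p assume "p \<in> {x + c |c. c \<in> C}"
  then have p: "p \<in> V" using \<open>{x + c |c. c \<in> C} \<subseteq> V\<close> by blast
  have "(\<lambda>z. z + - x) ` ({x + c |c. c \<in> C} \<inter> V) = C \<inter> V"
    using V C x by (force simp: complex_vector.subspace_add)
  then show "\<exists>U W \<phi> \<psi> E. openin (top_of_set V) U \<and> p \<in> U \<and> openin (top_of_set V) W \<and>
        homeomorphism U W \<phi> \<psi> \<and> holomorphic_in V U \<phi> \<and> holomorphic_in V W \<psi> \<and>
        csubspace E \<and> E \<subseteq> V \<and> \<phi> ` ({x + c |c. c \<in> C} \<inter> U) = E \<inter> W"
    using p hom hol[of x] hol[of "- x"] C
    by (intro exI[of _ V] exI[of _ "\<lambda>z. z + - x"] exI[of _ "\<lambda>z. z + x"] exI[of _ C]) auto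
qed

subsection \<open>Commutators are tangent to conjugation orbits\<close>

text \<open>The estimate \<open>low\<close> gives injectivity, which in finite dimension is
  invertibility, and also the norm bound on the inverse.\<close>

lemma ex_inverse_near_id:
  fixes A :: "'d::findim_complex_vector \<Rightarrow>\<^sub>L 'd"
  assumes A: "A \<in> End_D" "norm A \<le> 1 / 2"
  shows "\<exists>G\<in>End_D. (id_blinfun + A) o\<^sub>L G = id_blinfun \<and> G o\<^sub>L (id_blinfun + A) = id_blinfun \<and> norm G \<le> 2"
proof -
  have "clinear (blinfun_apply (id_blinfun + A))" using A by (simp add: End_D_iff[symmetric] End_D_ops)
  then have lin: "clinear (\<lambda>v. v + blinfun_apply A v)" by (simp add: plus_blinfun.rep_eq)
  have low: "norm v \<le> 2 * norm (v + blinfun_apply A v)" for v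
  proof -
    have "norm (blinfun_apply A v) \<le> 1 / 2 * norm v"
      using norm_blinfun[of A v] mult_right_mono[OF A(2) norm_ge_zero[of v]] by linarith
    then show ?thesis using norm_triangle_ineq4[of "v + blinfun_apply A v" "blinfun_apply A v"] by simp
  qed
  obtain g where g: "clinear g" "\<forall>v. g (v + blinfun_apply A v) = v" "\<forall>v. g v + blinfun_apply A (g v) = v"
    using clinear_inj_imp_inverse[OF lin] low by (metis mult_zero_right norm_le_zero_iff norm_zero)
  have "norm (Blinfun g) \<le> 2"
  proof (rule norm_blinfun_bound)
    show "norm (blinfun_apply (Blinfun g) v) \<le> 2 * norm v" for v
      using low[of "g v"] g by (simp add: Blinfun_clinear_apply)
  qed simp
  then show ?thesis
    using g by (intro bexI[of _ "Blinfun g"] conjI)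
      (auto intro!: blinfun_eqI simp: Blinfun_clinear_apply Blinfun_clinear_End blinfun.add_left)
qed

text \<open>The arc conjugates \<open>x\<close> by \<open>1 + t B\<close> for small
  \<open>t\<close>. Its velocity at 0 is the commutator, because the derivative of the inverse at 0
  is \<open>- B\<close>.\<close>

lemma commutator_in_tangent_space_orbit:
  fixes x B :: "'d::findim_complex_vector \<Rightarrow>\<^sub>L 'd"
  assumes x: "x \<in> End_D" and B: "B \<in> End_D"
  shows "lie_bracket B x \<in> tangent_space (conj_orbit x) x"
proof -
  \<comment> \<open>Chosen so that \<open>t B\<close> has norm at most 1/2; the summand 1 avoids
    division by zero when \<open>B = 0\<close>.\<close>
  define \<epsilon> where "\<epsilon> = 1 / (2 * (norm B + 1))"
  have \<epsilon>: "\<epsilon> > 0" by (simp add: \<epsilon>_def add_nonneg_pos)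
  define a where "a t = id_blinfun + t *\<^sub>C B" for t
  have "\<exists>G\<in>End_D. a t o\<^sub>L G = id_blinfun \<and> G o\<^sub>L a t = id_blinfun \<and> norm G \<le> 2" if t: "norm t < \<epsilon>" for t
    unfolding a_def
  proof (rule ex_inverse_near_id)
    have "norm (t *\<^sub>C B) \<le> \<epsilon> * (norm B + 1)"
      unfolding norm_scaleC using t \<epsilon> by (intro mult_mono) auto
    also have "\<dots> = 1 / 2"
    proof -
      have "norm B + 1 \<noteq> 0" using norm_ge_zero[of B] by linarith
      then show ?thesis by (simp add: \<epsilon>_def)
    qed
    finally show "norm (t *\<^sub>C B) \<le> 1 / 2" .
  qed (use B in \<open>simp add: End_D_ops\<close>)
  then obtain G where G: "\<And>t. norm t < \<epsilon> \<Longrightarrow> G t \<in> End_D" "\<And>t. norm t < \<epsilon> \<Longrightarrow> a t o\<^sub>L G t = id_blinfun"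
    "\<And>t. norm t < \<epsilon> \<Longrightarrow> G t o\<^sub>L a t = id_blinfun" "\<And>t. norm t < \<epsilon> \<Longrightarrow> norm (G t) \<le> 2"
    by metis
  have aG: "blinfun_apply (G t) v + t *\<^sub>C blinfun_apply B (blinfun_apply (G t) v) = v"
    "blinfun_apply (G t) (v + t *\<^sub>C blinfun_apply B v) = v" if "norm t < \<epsilon>" for t v
    using arg_cong[OF G(2)[OF that], of "\<lambda>A. blinfun_apply A v"]
      arg_cong[OF G(3)[OF that], of "\<lambda>A. blinfun_apply A v"]
    by (simp_all add: a_def blinfun.add_left blinfun_apply_scaleC)
  have resolvent: "G s = G t - (s - t) *\<^sub>C (G s o\<^sub>L B o\<^sub>L G t)" if s: "norm s < \<epsilon>" and t: "norm t < \<epsilon>" for s t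
  proof (rule blinfun_eqI)
    fix v
    define w where "w = blinfun_apply (G t) v"
    have "v = (w + s *\<^sub>C blinfun_apply B w) - (s - t) *\<^sub>C blinfun_apply B w"
      using aG(1)[OF t, of v] by (simp add: w_def complex_vector.scale_left_diff_distrib)
    then have "blinfun_apply (G s) v = w - (s - t) *\<^sub>C blinfun_apply (G s) (blinfun_apply B w)"
      using aG(2)[OF s, of w] by (metis End_D_scaleC G(1) blinfun.diff_right s)
    then show "blinfun_apply (G s) v = blinfun_apply (G t - (s - t) *\<^sub>C (G s o\<^sub>L B o\<^sub>L G t)) v"
      by (simp add: w_def blinfun.diff_left blinfun_apply_scaleC)
  qed
  have der_G: "(G has_derivative (\<lambda>s. s *\<^sub>C (- (G t o\<^sub>L B o\<^sub>L G t)))) (at t)" if t: "norm t < \<epsilon>" for t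
  proof (rule has_derivativeI_sandwich[where H = "\<lambda>s. 8 * norm B * norm B * norm (s - t)"])
    show "0 < \<epsilon> - norm t" using t by simp
    show "bounded_linear (\<lambda>s. s *\<^sub>C (- (G t o\<^sub>L B o\<^sub>L G t)))"
      by (rule bounded_bilinear.bounded_linear_left[OF bounded_bilinear_scaleC])
    show "((\<lambda>s. 8 * norm B * norm B * norm (s - t)) \<longlongrightarrow> 0) (at t)"
      by (rule tendsto_eq_intros refl | simp)+
    fix s assume "s \<noteq> t" "dist s t < \<epsilon> - norm t"
    then have s: "norm s < \<epsilon>" using norm_triangle_ineq2[of s t] by (simp add: dist_norm)
    define E where "E = G t o\<^sub>L B o\<^sub>L G t"
    define F where "F = G s o\<^sub>L B o\<^sub>L G t o\<^sub>L B o\<^sub>L G t"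
    \<comment> \<open>A second use of the resolvent identity, inside the first, exhibits the
      remainder as quadratic in \<open>s - t\<close>.\<close>
    have "G s o\<^sub>L B o\<^sub>L G t = E - (s - t) *\<^sub>C F"
      by (subst resolvent[OF s t])
        (simp add: E_def F_def bounded_bilinear.diff_left[OF bounded_bilinear_blinfun_compose]
          blinfun_compose_scaleC_left)
    then have "G s = G t - (s - t) *\<^sub>C (E - (s - t) *\<^sub>C F)"
      using resolvent[OF s t] by metis
    then have "G s - G t - (s - t) *\<^sub>C (- E) = ((s - t) * (s - t)) *\<^sub>C F"
      by (simp add: complex_vector.scale_right_diff_distrib scaleC_scaleC)
    then have eq: "norm (G s - G t - (s - t) *\<^sub>C (- E)) / norm (s - t) = norm (s - t) * norm F"
      using \<open>s \<noteq> t\<close> by (simp add: norm_scaleC norm_mult)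
    have "norm F \<le> norm (G s) * norm B * norm (G t) * norm B * norm (G t)"
      unfolding F_def
      by (intro order_trans[OF norm_blinfun_compose] mult_right_mono) auto
    \<comment> \<open>Three factors \<open>G\<close>, each of norm at most 2, produce the constant
      8.\<close>
    also have "\<dots> \<le> 2 * norm B * 2 * norm B * 2"
      using G(4)[OF s] G(4)[OF t] by (intro mult_mono) auto
    finally have "norm (s - t) * norm F \<le> norm (s - t) * (8 * norm B * norm B)"
      by (intro mult_left_mono) (auto simp: mult_ac)
    then show "norm (G s - G t - (s - t) *\<^sub>C (- (G t o\<^sub>L B o\<^sub>L G t))) / norm (s - t)
        \<le> 8 * norm B * norm B * norm (s - t)"
      unfolding E_def[symmetric] eq by (simp add: mult_ac)
  qed
  define \<gamma> where "\<gamma> t = a t o\<^sub>L x o\<^sub>L G t" for t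
  define w where "w t = (B o\<^sub>L x o\<^sub>L G t) - (a t o\<^sub>L x o\<^sub>L G t o\<^sub>L B o\<^sub>L G t)" for t
  have a_End: "a t \<in> End_D" for t using B by (simp add: a_def End_D_ops)
  \<comment> \<open>Tangent vectors are defined by arcs with a complex derivative at every
    parameter, so the derivative at 0 alone would not suffice.\<close>
  have der: "(\<gamma> has_derivative (\<lambda>s. s *\<^sub>C w t)) (at t)" if t: "norm t < \<epsilon>" for t
  proof -
    have "(a has_derivative (\<lambda>s. s *\<^sub>C B)) (at t)"
      using has_derivative_add[OF has_derivative_const has_derivative_scaleC_left[of B]]
      by (simp add: a_def[abs_def])
    from bounded_linear.has_derivative[OF bounded_bilinear.bounded_linear_left[OF
        bounded_bilinear_blinfun_compose, of x] this]
    have "((\<lambda>t. a t o\<^sub>L x) has_derivative (\<lambda>s. s *\<^sub>C (B o\<^sub>L x))) (at t)"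
      by (simp add: blinfun_compose_scaleC_left)
    from bounded_bilinear.FDERIV[OF bounded_bilinear_blinfun_compose this der_G[OF t]]
    have "(\<gamma> has_derivative (\<lambda>s. (a t o\<^sub>L x o\<^sub>L (s *\<^sub>C - (G t o\<^sub>L B o\<^sub>L G t))) +
        ((s *\<^sub>C (B o\<^sub>L x)) o\<^sub>L G t))) (at t)"
      by (simp add: \<gamma>_def[abs_def])
    moreover have "(a t o\<^sub>L x o\<^sub>L (s *\<^sub>C - (G t o\<^sub>L B o\<^sub>L G t))) + ((s *\<^sub>C (B o\<^sub>L x)) o\<^sub>L G t) = s *\<^sub>C w t" for s
      using a_End x
      by (simp add: w_def blinfun_compose_scaleC_left blinfun_compose_scaleC_right End_D_ops
          blinfun_compose_assoc complex_vector.scale_right_diff_distrib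
          bounded_bilinear.minus_right[OF bounded_bilinear_blinfun_compose])
    ultimately show ?thesis by simp
  qed
  have a0: "a 0 = id_blinfun" by (simp add: a_def)
  then have "G 0 = id_blinfun"
    using G(2)[of 0] \<epsilon> by (metis blinfun_eqI blinfun_apply_blinfun_compose blinfun_apply_id_blinfun id_apply norm_zero)
  then have 0: "\<gamma> 0 = x" "w 0 = lie_bracket B x"
    by (auto intro!: blinfun_eqI simp: \<gamma>_def w_def a0 lie_bracket_def blinfun.diff_left)
  have "\<gamma> t \<in> conj_orbit x" if "norm t < \<epsilon>" for t
    unfolding \<gamma>_def conj_orbit_def using G that a_End by (intro conj_saturationI) auto
  moreover have "\<exists>w'. (\<gamma> has_derivative (\<lambda>s. s *\<^sub>C w')) (at t)" if "t \<in> ball 0 \<epsilon>" for t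
    using der[of t] that by (intro exI[of _ "w t"]) simp
  ultimately show ?thesis
    unfolding tangent_space_def using \<epsilon> 0(1) der[of 0, unfolded 0(2)]
    by (intro CollectI exI[of _ \<gamma>] exI[of _ \<epsilon>] conjI ballI) auto
qed

subsection \<open>A rank condition on tangent vectors of conjugation orbits\<close>

text \<open>Along an arc of conjugates of \<open>X\<close>, the kernel has constant dimension. Hence \<open>1 + Y (T t - X)\<close>,
  where \<open>X Y X = X\<close>, maps \<open>ker (T t)\<close> isomorphically onto \<open>ker X\<close> for small \<open>t\<close>.\<close>

lemma derivative_of_conjugates_maps_kernel_to_range:
  fixes X W :: "'d::findim_complex_vector \<Rightarrow>\<^sub>L 'd" and T :: "complex \<Rightarrow> 'd \<Rightarrow>\<^sub>L 'd"
  assumes X: "X \<in> End_D" "T 0 = X" and der: "(T has_derivative (\<lambda>s. s *\<^sub>C W)) (at 0)"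
    and \<epsilon>: "\<epsilon> > 0" and conj: "\<And>t. norm t < \<epsilon> \<Longrightarrow> T t \<in> conj_orbit X"
    and u: "blinfun_apply X u = 0"
  shows "\<exists>z. blinfun_apply W u = blinfun_apply X z"
proof -
  have linX: "clinear (blinfun_apply X)" using X by (simp add: End_D_iff)
  \<comment> \<open>A generalized inverse of \<open>X\<close>, obtained from a linear section of
    \<open>X\<close> over its range.\<close>
  obtain \<rho> where \<rho>: "clinear \<rho>" "\<And>v. blinfun_apply X (\<rho> (blinfun_apply X v)) = blinfun_apply X v"
    using clin.linear_exists_right_inverse_on[OF linX complex_vector.subspace_UNIV] by auto
  define Y where "Y = Blinfun \<rho>"
  have Y: "Y \<in> End_D" "\<And>v. blinfun_apply X (blinfun_apply Y (blinfun_apply X v)) = blinfun_apply X v"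
    using \<rho> by (simp_all add: Y_def Blinfun_clinear_End Blinfun_clinear_apply)
  define K where "K = {v. blinfun_apply X v = 0}"
  have K: "csubspace K"
    by (auto simp: K_def complex_vector.subspace_def blinfun.add_right End_D_scaleC[OF X(1)])
  define R where "R t = Y o\<^sub>L (T t - X)" for t
  have small: "norm v \<le> 2 * norm (v + blinfun_apply (R t) v)" if "norm (R t) \<le> 1 / 2" for t v
  proof -
    have "norm (blinfun_apply (R t) v) \<le> 1 / 2 * norm v"
      using norm_blinfun[of "R t" v] mult_right_mono[OF that norm_ge_zero[of v]] by linarith
    then show ?thesis
      using norm_triangle_ineq4[of "v + blinfun_apply (R t) v" "blinfun_apply (R t) v"] by simp
  qed
  have ex: "\<exists>n. blinfun_apply (T t) n = 0 \<and> n + blinfun_apply (R t) n = u"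
    if t: "norm t < \<epsilon>" "norm (R t) \<le> 1 / 2" for t
  proof -
    obtain g g' where g: "g \<in> End_D" "g' \<in> End_D" "g o\<^sub>L g' = id_blinfun" "g' o\<^sub>L g = id_blinfun"
      "T t = g o\<^sub>L X o\<^sub>L g'"
      using conj[OF t(1)] unfolding conj_orbit_def by (auto elim: conj_saturationE)
    have g'g: "blinfun_apply g' (blinfun_apply g v) = v" for v
      using g(4) by (metis blinfun_apply_blinfun_compose blinfun_apply_id_blinfun id_apply)
    define f where "f = g + (R t o\<^sub>L g)"
    have f_End: "f \<in> End_D" using g X Y by (simp add: f_def R_def End_D_ops)
    have Tg: "blinfun_apply (T t) (blinfun_apply g w) = 0" if "w \<in> K" for w
      using that by (simp add: g(5) g'g K_def)
    have f_eq: "blinfun_apply f w = blinfun_apply g w + blinfun_apply (R t) (blinfun_apply g w)" for w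
      by (simp add: f_def blinfun.add_left)
    \<comment> \<open>For \<open>w\<close> in \<open>K\<close> the vector \<open>g w\<close> is
      killed by \<open>T t\<close>, so \<open>f w = g w - Y (X (g w))\<close>, which
      \<open>X\<close> kills. Thus \<open>f\<close> maps \<open>K\<close> to itself; being
      injective, it is onto.\<close>
    have "blinfun_apply f ` K = K"
    proof (rule clinear_inj_on_imp_onto[OF _ K])
      show "clinear (blinfun_apply f)" using f_End by (simp add: End_D_iff)
      show "blinfun_apply f ` K \<subseteq> K"
        using Tg Y(2) by (auto simp: f_eq R_def K_def blinfun.add_left blinfun.diff_left blinfun.add_right
            blinfun.diff_right blinfun.minus_right)
      show "inj_on (blinfun_apply f) K"
      proof (rule inj_onI)
        fix v w assume "blinfun_apply f v = blinfun_apply f w"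
        then have "blinfun_apply f (v - w) = 0" by (simp add: blinfun.diff_right)
        then have "blinfun_apply g (v - w) = 0"
          using small[OF t(2), of "blinfun_apply g (v - w)"] by (simp add: f_eq)
        then have "v - w = 0" using g'g[of "v - w"] by simp
        then show "v = w" by simp
      qed
    qed
    then obtain w where "w \<in> K" "u = blinfun_apply f w" using u by (auto simp: K_def)
    then show ?thesis using Tg by (intro exI[of _ "blinfun_apply g w"]) (simp add: f_eq)
  qed
  have lim_T: "(T \<longlongrightarrow> X) (at 0)"
    using has_derivative_continuous[OF der] by (simp add: continuous_within X)
  have lim_R: "((\<lambda>t. norm (R t)) \<longlongrightarrow> 0) (at 0)"
  proof -
    have "((\<lambda>t. norm (Y o\<^sub>L (T t - X))) \<longlongrightarrow> norm (Y o\<^sub>L (X - X))) (at 0)"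
      by (intro tendsto_norm bounded_bilinear.tendsto[OF bounded_bilinear_blinfun_compose]
          tendsto_diff tendsto_const lim_T)
    then show ?thesis by (simp add: R_def)
  qed
  \<comment> \<open>Kernel vectors of \<open>T t\<close> that tend to \<open>u\<close>. On
    \<open>n t\<close> the difference quotient of \<open>T\<close> takes the value
    \<open>- X (n t) / t\<close>, which lies in the range of \<open>X\<close>.\<close>
  define n where "n t = (SOME n. blinfun_apply (T t) n = 0 \<and> n + blinfun_apply (R t) n = u)" for t
  have ev: "\<forall>\<^sub>F t in at 0. t \<noteq> 0 \<and> norm (R t) \<le> 1 / 2 \<and> blinfun_apply (T t) (n t) = 0 \<and>
      n t + blinfun_apply (R t) (n t) = u"
  proof -
    have "\<forall>\<^sub>F t in at 0. norm (R t) < 1 / 2" using order_tendstoD(2)[OF lim_R, of "1 / 2"] by simp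
    moreover have "\<forall>\<^sub>F t in at 0. t \<noteq> 0 \<and> norm t < \<epsilon>"
      using \<epsilon> by (auto simp: eventually_at intro!: exI[of _ \<epsilon>])
    ultimately show ?thesis
    proof eventually_elim
      case (elim t)
      then have "norm t < \<epsilon>" "norm (R t) \<le> 1 / 2" by auto
      from someI_ex[OF ex[OF this]] elim show ?case by (simp add: n_def)
    qed
  qed
  have lim_n: "(n \<longlongrightarrow> u) (at 0)"
  proof (rule Lim_transform)
    have "((\<lambda>t. norm (R t) * (2 * norm u)) \<longlongrightarrow> 0 * (2 * norm u)) (at 0)"
      by (intro tendsto_mult lim_R tendsto_const)
    then have lim: "((\<lambda>t. norm (R t) * (2 * norm u)) \<longlongrightarrow> 0) (at 0)" by simp
    show "((\<lambda>t. n t - u) \<longlongrightarrow> 0) (at 0)"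
    proof (rule Lim_null_comparison[OF _ lim])
      show "\<forall>\<^sub>F t in at 0. norm (n t - u) \<le> norm (R t) * (2 * norm u)"
        using ev
      proof eventually_elim
        case (elim t)
        then have "n t - u = - blinfun_apply (R t) (n t)" by (simp add: algebra_simps)
        then have "norm (n t - u) \<le> norm (R t) * norm (n t)"
          by (simp add: norm_blinfun)
        also have "\<dots> \<le> norm (R t) * (2 * norm u)"
          using small[of t "n t"] elim by (intro mult_left_mono) auto
        finally show ?case .
      qed
    qed
  qed simp
  \<comment> \<open>\<open>P\<close> vanishes exactly on the range of \<open>X\<close>, so
    membership in the range passes to the limit by applying \<open>P\<close>.\<close>
  define P where "P = id_blinfun - (X o\<^sub>L Y)"
  define Q where "Q t = inverse t *\<^sub>C (T t - T 0)" for t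
  have PX: "blinfun_apply P (blinfun_apply X v) = 0" for v
    using Y(2) by (simp add: P_def blinfun.diff_left)
  have lim: "((\<lambda>t. blinfun_apply P (blinfun_apply (Q t) (n t))) \<longlongrightarrow> blinfun_apply P (blinfun_apply W u)) (at 0)"
    unfolding Q_def
    by (intro blinfun.tendsto tendsto_const has_derivative_scaleC_imp_tendsto[OF der] lim_n)
  have "\<forall>\<^sub>F t in at 0. blinfun_apply P (blinfun_apply (Q t) (n t)) = 0"
    using ev
  proof eventually_elim
    case (elim t)
    have "blinfun_apply (Q t) (n t) = blinfun_apply X ((- inverse t) *\<^sub>C n t)"
      using elim by (simp add: Q_def blinfun_apply_scaleC blinfun.diff_left X End_D_scaleC
          blinfun.minus_right)
    then show ?case using PX by simp
  qed
  then have "((\<lambda>t. blinfun_apply P (blinfun_apply (Q t) (n t))) \<longlongrightarrow> 0) (at 0)"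
    by (simp add: tendsto_eventually)
  then have "blinfun_apply P (blinfun_apply W u) = 0"
    using tendsto_unique[OF _ lim] by (metis at_neq_bot)
  then have "blinfun_apply W u = blinfun_apply X (blinfun_apply Y (blinfun_apply W u))"
    by (simp add: P_def blinfun.diff_left)
  then show ?thesis by blast
qed

section \<open>Powers of operators along an arc\<close>

primrec op_power :: "('d::findim_complex_vector \<Rightarrow>\<^sub>L 'd) \<Rightarrow> nat \<Rightarrow> ('d \<Rightarrow>\<^sub>L 'd)" where
  "op_power A 0 = id_blinfun"
| "op_power A (Suc k) = A o\<^sub>L op_power A k"

text \<open>The derivative of the power map at \<open>A\<close> in direction \<open>V\<close>: the
  sum of all products of \<open>k - 1\<close> factors \<open>A\<close> and one factor
  \<open>V\<close>, since the two need not commute.\<close>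

primrec op_power_deriv ::
    "('d::findim_complex_vector \<Rightarrow>\<^sub>L 'd) \<Rightarrow> ('d \<Rightarrow>\<^sub>L 'd) \<Rightarrow> nat \<Rightarrow> ('d \<Rightarrow>\<^sub>L 'd)" where
  "op_power_deriv A V 0 = 0"
| "op_power_deriv A V (Suc k) = (V o\<^sub>L op_power A k) + (A o\<^sub>L op_power_deriv A V k)"

lemma op_power_apply: "blinfun_apply (op_power A k) v = (blinfun_apply A ^^ k) v"
  by (induction k) auto

lemma op_power_End_D: "A \<in> End_D \<Longrightarrow> op_power A k \<in> End_D"
  by (induction k) (auto intro: End_D_ops)

lemma has_derivative_op_power:
  assumes "(\<gamma> has_derivative (\<lambda>s. s *\<^sub>C V)) (at 0)" "\<gamma> 0 \<in> End_D"
  shows "((\<lambda>t. op_power (\<gamma> t) k) has_derivative (\<lambda>s. s *\<^sub>C op_power_deriv (\<gamma> 0) V k)) (at 0)"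
proof (induction k)
  case (Suc k)
  have "(\<lambda>s. (\<gamma> 0 o\<^sub>L (s *\<^sub>C op_power_deriv (\<gamma> 0) V k)) + ((s *\<^sub>C V) o\<^sub>L op_power (\<gamma> 0) k)) =
      (\<lambda>s. s *\<^sub>C op_power_deriv (\<gamma> 0) V (Suc k))"
    using assms(2) by (simp add: blinfun_compose_scaleC_left blinfun_compose_scaleC_right
        scaleC_add_right add.commute)
  then show ?case
    using bounded_bilinear.FDERIV[OF bounded_bilinear_blinfun_compose assms(1) Suc] by simp
qed simp

lemma op_power_conj_orbit:
  assumes "A \<in> conj_orbit X"
  shows "op_power A k \<in> conj_orbit (op_power X k)"
proof -
  obtain g g' where g: "g \<in> End_D" "g' \<in> End_D" "g o\<^sub>L g' = id_blinfun" "g' o\<^sub>L g = id_blinfun"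
    "A = g o\<^sub>L X o\<^sub>L g'"
    using assms unfolding conj_orbit_def by (auto elim: conj_saturationE)
  have *: "blinfun_apply g (blinfun_apply g' v) = v" "blinfun_apply g' (blinfun_apply g v) = v" for v
    using g(3,4) by (metis blinfun_apply_blinfun_compose blinfun_apply_id_blinfun id_apply)+
  have "op_power A k = g o\<^sub>L op_power X k o\<^sub>L g'"
    by (induction k) (auto intro!: blinfun_eqI simp: g(5) *)
  then show ?thesis
    unfolding conj_orbit_def using g by (auto intro: conj_saturationI)
qed

text \<open>Powers of conjugates of \<open>x\<close> are conjugates of powers of \<open>x\<close>,
  so the statement on kernels and ranges applies to each power of the arc.\<close>

lemma tangent_space_orbit_rank_condition:
  assumes x: "x \<in> End_D" and "V \<in> tangent_space (conj_orbit x) x"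
    and u: "(blinfun_apply x ^^ k) u = 0"
  shows "\<exists>z. blinfun_apply (op_power_deriv x V k) u = (blinfun_apply x ^^ k) z"
proof -
  obtain \<gamma> \<epsilon> where \<gamma>: "\<epsilon> > 0" "\<gamma> 0 = x" "\<gamma> ` ball 0 \<epsilon> \<subseteq> conj_orbit x"
    "(\<gamma> has_derivative (\<lambda>s. s *\<^sub>C V)) (at 0)"
    using assms(2) unfolding tangent_space_def by blast
  have "\<exists>z. blinfun_apply (op_power_deriv (\<gamma> 0) V k) u = blinfun_apply (op_power x k) z"
  proof (rule derivative_of_conjugates_maps_kernel_to_range[OF _ _ has_derivative_op_power[OF \<gamma>(4)] \<gamma>(1)])
    show "op_power (\<gamma> t) k \<in> conj_orbit (op_power x k)" if "norm t < \<epsilon>" for t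
    proof (rule op_power_conj_orbit)
      have "t \<in> ball 0 \<epsilon>" using that by simp
      then show "\<gamma> t \<in> conj_orbit x" using \<gamma>(3) by blast
    qed
  qed (use x \<gamma>(2) u in \<open>auto simp: op_power_End_D op_power_apply\<close>)
  then show ?thesis by (simp add: \<gamma>(2) op_power_apply)
qed

text \<open>Bracketing with \<open>B\<close> is a derivation, so the sum of Leibniz terms
  telescopes.\<close>

lemma op_power_deriv_commutator:
  "op_power_deriv x (lie_bracket B x) k = (B o\<^sub>L op_power x k) - (op_power x k o\<^sub>L B)"
  by (induction k) (auto intro!: blinfun_eqI simp: lie_bracket_def blinfun.bilinear_simps)

lemma op_power_deriv_add:
  "op_power_deriv x (V + W) k = op_power_deriv x V k + op_power_deriv x W k"
  by (induction k) (auto intro!: blinfun_eqI simp: blinfun.bilinear_simps)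

section \<open>Representations of sl(2) in which the raising operator is nilpotent\<close>

locale sl2_nilpotent =
  fixes x h y :: "'d::findim_complex_vector \<Rightarrow>\<^sub>L 'd"
  assumes sl2: "sl2_triple x h y" and nilpotent: "nilpotent_op x"
begin

lemma xhy_End_D: "x \<in> End_D" "h \<in> End_D" "y \<in> End_D"
  using sl2 by (simp_all add: sl2_triple_def)

lemmas xhy_scaleC = xhy_End_D[THEN End_D_scaleC]

lemma hx: "h (x v) = x (h v) + 2 *\<^sub>C x v"
  and hy: "h (y v) = y (h v) - 2 *\<^sub>C y v"
  and xy: "x (y v) = y (x v) + h v"
proof -
  have "lie_bracket h x v = (2 *\<^sub>C x) v" "lie_bracket h y v = ((-2) *\<^sub>C y) v" "lie_bracket x y v = h v"
    using sl2 by (simp_all add: sl2_triple_def)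
  then show "h (x v) = x (h v) + 2 *\<^sub>C x v" "h (y v) = y (h v) - 2 *\<^sub>C y v" "x (y v) = y (x v) + h v"
    by (simp_all add: lie_bracket_def blinfun.diff_left blinfun.minus_left blinfun_apply_scaleC
        algebra_simps)
qed

lemma x_pow: "(blinfun_apply x ^^ n) (u + v) = (blinfun_apply x ^^ n) u + (blinfun_apply x ^^ n) v"
  "(blinfun_apply x ^^ n) (u - v) = (blinfun_apply x ^^ n) u - (blinfun_apply x ^^ n) v"
  "(blinfun_apply x ^^ n) (c *\<^sub>C v) = c *\<^sub>C (blinfun_apply x ^^ n) v"
  "(blinfun_apply x ^^ n) 0 = 0"
  by (induction n) (simp_all add: blinfun.bilinear_simps xhy_scaleC)

lemma y_pow: "(blinfun_apply y ^^ n) (u + v) = (blinfun_apply y ^^ n) u + (blinfun_apply y ^^ n) v"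
  "(blinfun_apply y ^^ n) (c *\<^sub>C v) = c *\<^sub>C (blinfun_apply y ^^ n) v"
  "(blinfun_apply y ^^ n) 0 = 0"
  by (induction n) (simp_all add: blinfun.bilinear_simps xhy_scaleC)

lemma x_pow_sum: "(blinfun_apply x ^^ n) (\<Sum>a\<in>I. f a) = (\<Sum>a\<in>I. (blinfun_apply x ^^ n) (f a))"
  by (induction I rule: infinite_finite_induct) (simp_all add: x_pow)

lemma h_y_pow:
  assumes "h v = c *\<^sub>C v"
  shows "h ((blinfun_apply y ^^ k) v) = (c - 2 * of_nat k) *\<^sub>C (blinfun_apply y ^^ k) v"
proof (induction k)
  case (Suc k)
  have "h ((blinfun_apply y ^^ Suc k) v) = (c - 2 * of_nat k) *\<^sub>C (blinfun_apply y ^^ Suc k) v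
      - 2 *\<^sub>C (blinfun_apply y ^^ Suc k) v"
    by (simp add: hy Suc xhy_scaleC)
  also have "\<dots> = (c - 2 * of_nat (Suc k)) *\<^sub>C (blinfun_apply y ^^ Suc k) v"
    unfolding complex_vector.scale_left_diff_distrib[symmetric] by (simp add: algebra_simps)
  finally show ?case .
qed (simp add: assms)

lemma x_y_pow:
  assumes "x v = 0" "h v = c *\<^sub>C v"
  shows "x ((blinfun_apply y ^^ Suc k) v) = (of_nat (Suc k) * (c - of_nat k)) *\<^sub>C (blinfun_apply y ^^ k) v"
proof (induction k)
  case 0
  show ?case using assms by (simp add: xy)
next
  case (Suc k)
  have "x ((blinfun_apply y ^^ Suc (Suc k)) v) =
      (of_nat (Suc k) * (c - of_nat k)) *\<^sub>C (blinfun_apply y ^^ Suc k) v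
      + (c - 2 * of_nat (Suc k)) *\<^sub>C (blinfun_apply y ^^ Suc k) v"
    using xy[of "(blinfun_apply y ^^ Suc k) v"] Suc h_y_pow[OF assms(2), of "Suc k"]
    by (simp add: xhy_scaleC)
  also have "\<dots> = (of_nat (Suc (Suc k)) * (c - of_nat (Suc k))) *\<^sub>C (blinfun_apply y ^^ Suc k) v"
    unfolding scaleC_add_left[symmetric] by (simp add: algebra_simps)
  finally show ?case .
qed

text \<open>If \<open>x\<close> kills \<open>u = x^n w\<close>, the left side vanishes, and the
  identity shows that \<open>h - n\<close> sends \<open>u\<close> into the image of
  \<open>x^(n+1)\<close>. This drives the decomposition of the kernel of \<open>x\<close>.\<close>

lemma y_x_pow:
  "y ((blinfun_apply x ^^ Suc n) w) = (blinfun_apply x ^^ Suc n) (y w)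
     - of_nat (Suc n) *\<^sub>C (h ((blinfun_apply x ^^ n) w) - of_nat n *\<^sub>C (blinfun_apply x ^^ n) w)"
proof (induction n)
  case 0
  show ?case by (simp add: xy scaleC_one)
next
  case (Suc n)
  define u where "u = (blinfun_apply x ^^ n) w"
  have "y ((blinfun_apply x ^^ Suc (Suc n)) w) = x (y ((blinfun_apply x ^^ Suc n) w)) - h (x u)"
    by (simp add: xy u_def)
  also have "x (y ((blinfun_apply x ^^ Suc n) w)) = (blinfun_apply x ^^ Suc (Suc n)) (y w)
      - of_nat (Suc n) *\<^sub>C (x (h u) - of_nat n *\<^sub>C x u)"
    unfolding Suc by (simp add: blinfun.diff_right xhy_scaleC u_def)
  also have "x (h u) = h (x u) - 2 *\<^sub>C x u" by (simp add: hx)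
  also have "h (x u) - 2 *\<^sub>C x u - of_nat n *\<^sub>C x u = h (x u) - of_nat (Suc (Suc n)) *\<^sub>C x u"
  proof -
    have "of_nat (Suc (Suc n)) *\<^sub>C x u = 2 *\<^sub>C x u + of_nat n *\<^sub>C x u"
      unfolding scaleC_add_left[symmetric] by simp
    then show ?thesis by simp
  qed
  also have "of_nat (Suc n) *\<^sub>C (h (x u) - of_nat (Suc (Suc n)) *\<^sub>C x u) + h (x u) =
      of_nat (Suc (Suc n)) *\<^sub>C (h (x u) - of_nat (Suc n) *\<^sub>C x u)" (is "?l = ?r")
  proof -
    have "?l = of_nat (Suc n) *\<^sub>C h (x u) + 1 *\<^sub>C h (x u) - (of_nat (Suc n) * of_nat (Suc (Suc n))) *\<^sub>C x u"
      by (simp only: complex_vector.scale_right_diff_distrib scaleC_scaleC scaleC_one) simp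
    also have "of_nat (Suc n) *\<^sub>C h (x u) + 1 *\<^sub>C h (x u) = of_nat (Suc (Suc n)) *\<^sub>C h (x u)"
      unfolding scaleC_add_left[symmetric] by (simp add: add.commute)
    also have "\<dots> - (of_nat (Suc n) * of_nat (Suc (Suc n))) *\<^sub>C x u = ?r"
      by (simp only: complex_vector.scale_right_diff_distrib scaleC_scaleC mult.commute)
    finally show ?thesis .
  qed
  then have "(blinfun_apply x ^^ Suc (Suc n)) (y w) - of_nat (Suc n) *\<^sub>C (h (x u) - of_nat (Suc (Suc n)) *\<^sub>C x u)
      - h (x u) = (blinfun_apply x ^^ Suc (Suc n)) (y w)
      - of_nat (Suc (Suc n)) *\<^sub>C (h (x u) - of_nat (Suc n) *\<^sub>C x u)"
    by (metis diff_diff_eq)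
  finally show ?case by (simp add: u_def)
qed

section \<open>Highest weight vectors in the kernel of \<open>x\<close>\<close>

definition nil_index :: nat where
  "nil_index = (SOME n. \<forall>v. (blinfun_apply x ^^ n) v = 0)"

lemma x_pow_nil_index: "(blinfun_apply x ^^ nil_index) v = 0"
  using nilpotent someI_ex[of "\<lambda>n. \<forall>v. (blinfun_apply x ^^ n) v = 0"]
  unfolding nilpotent_op_def nil_index_def by blast

definition highest :: "nat \<Rightarrow> 'd set" where
  "highest j = {v. x v = 0 \<and> h v = of_nat j *\<^sub>C v}"

lemma csubspace_highest: "csubspace (highest j)"
  by (auto simp: highest_def complex_vector.subspace_def blinfun.add_right xhy_scaleC
      scaleC_add_right scaleC_scaleC mult.commute)

text \<open>Modulo \<open>ker x \<inter> im x\<^sup>n\<^sup>+\<^sup>1\<close>, the operator \<open>h\<close> acts as \<open>n\<close> on \<open>ker x \<inter> im x\<^sup>n\<close>.\<close>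

lemma kernel_range_decomposition:
  assumes "n \<le> nil_index" "x u = 0" "u = (blinfun_apply x ^^ n) w"
  shows "\<exists>f. (\<forall>k. f k \<in> highest k) \<and> u = (\<Sum>k\<in>{n..<nil_index}. f k)"
  using assms
proof (induction n arbitrary: u w rule: inc_induct)
  case base
  then show ?case
    using complex_vector.subspace_0[OF csubspace_highest]
    by (intro exI[of _ "\<lambda>_. 0"]) (auto simp: x_pow_nil_index)
next
  case (step n)
  define z where "z = h u - of_nat n *\<^sub>C u"
  have "(blinfun_apply x ^^ Suc n) w = 0" using step.prems by simp
  then have "0 = (blinfun_apply x ^^ Suc n) (y w) - of_nat (Suc n) *\<^sub>C z"
    using y_x_pow[of n w] step.prems by (simp add: z_def)
  then have "of_nat (Suc n) *\<^sub>C z = (blinfun_apply x ^^ Suc n) (y w)" by simp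
  then have "z = inverse (of_nat (Suc n)) *\<^sub>C (blinfun_apply x ^^ Suc n) (y w)"
    by (metis complex_vector.scale_one complex_vector.scale_scale left_inverse nat.distinct(1) of_nat_eq_0_iff)
  then have z: "z = (blinfun_apply x ^^ Suc n) (inverse (of_nat (Suc n)) *\<^sub>C y w)"
    by (simp only: x_pow)
  have "x (h u) = 0" using hx[of u] step.prems(1) by simp
  then have "x z = 0" using step.prems(1) by (simp add: z_def blinfun.diff_right xhy_scaleC)
  then obtain f where f: "\<forall>k. f k \<in> highest k" "z = (\<Sum>k\<in>{Suc n..<nil_index}. f k)"
    using step.IH[OF _ z] by blast
  \<comment> \<open>On \<open>highest k\<close> the operator \<open>h - n\<close> is multiplication
    by \<open>k - n\<close>, which is nonzero for \<open>k > n\<close>. So the sum of the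
    \<open>f' k\<close> is a preimage of \<open>z\<close>, and subtracting it from \<open>u\<close>
    leaves an eigenvector of eigenvalue \<open>n\<close>.\<close>
  define f' where "f' k = inverse (of_nat k - of_nat n) *\<^sub>C f k" for k
  have f': "f' k \<in> highest k" for k
    using f(1) csubspace_highest by (auto simp: f'_def complex_vector.subspace_scale)
  define r where "r = u - (\<Sum>k\<in>{Suc n..<nil_index}. f' k)"
  have "x (f' k) = 0" "h (f' k) - of_nat n *\<^sub>C f' k = (of_nat k - of_nat n) *\<^sub>C f' k" for k
    using f'[of k] by (auto simp: highest_def complex_vector.scale_left_diff_distrib)
  moreover have "(of_nat k - of_nat n) *\<^sub>C f' k = f k" if "k \<in> {Suc n..<nil_index}" for k
    using that by (simp add: f'_def scaleC_scaleC scaleC_one)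
  ultimately have xf: "x (f' k) = 0" "k \<in> {Suc n..<nil_index} \<Longrightarrow> h (f' k) - of_nat n *\<^sub>C f' k = f k" for k
    by auto
  have "x r = 0" using step.prems(1) xf by (simp add: r_def blinfun.diff_right blinfun.sum_right)
  moreover have "h r - of_nat n *\<^sub>C r = 0"
  proof -
    have "h r - of_nat n *\<^sub>C r = z - (\<Sum>k\<in>{Suc n..<nil_index}. h (f' k) - of_nat n *\<^sub>C f' k)"
      by (simp add: r_def z_def blinfun.diff_right blinfun.sum_right sum_subtractf
          complex_vector.scale_right_diff_distrib complex_vector.scale_sum_right)
    also have "\<dots> = 0" using xf f(2) by simp
    finally show ?thesis .
  qed
  ultimately have r: "r \<in> highest n" by (simp add: highest_def)
  have "{n..<nil_index} = insert n {Suc n..<nil_index}" using step.hyps by auto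
  then have "(\<Sum>k\<in>{n..<nil_index}. if k = n then r else f' k) = r + (\<Sum>k\<in>{Suc n..<nil_index}. f' k)"
    by (simp cong: sum.cong_simp)
  then show ?case
    using r f' by (intro exI[of _ "\<lambda>k. if k = n then r else f' k"]) (auto simp: r_def)
qed

text \<open>The kernel of \<open>x\<close> is the sum of the \<open>highest k\<close> with
  \<open>k < nil_index\<close>, so no other eigenvalue of \<open>h\<close> occurs on it.\<close>

lemma kernel_eigenvector_eq_0:
  assumes v: "x v = 0" "h v = c *\<^sub>C v" and c: "c \<notin> of_nat ` {..<nil_index}"
  shows "v = 0"
proof -
  obtain f where f: "\<forall>k. f k \<in> highest k" "v = (\<Sum>k\<in>{0..<nil_index}. f k)"
    using kernel_range_decomposition[of 0 v v] v by auto
  have lin: "clinear (blinfun_apply h)" using xhy_End_D by (simp add: End_D_iff)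
  have hf: "h (f k) = of_nat k *\<^sub>C f k" for k using f(1) by (simp add: highest_def)
  have "(of_nat k - c) *\<^sub>C f k = 0" if k: "k \<in> {0..<nil_index}" for k
  proof (rule sum_simultaneous_eigenvectors_eq_0[of "{0..<nil_index}" _ _ "\<lambda>k. (of_nat k - c) *\<^sub>C f k"
        of_nat of_nat, OF _ lin lin _ _ _ _ k])
    have "0 = h v - c *\<^sub>C v" using v by simp
    also have "\<dots> = (\<Sum>k\<in>{0..<nil_index}. (of_nat k - c) *\<^sub>C f k)"
      by (simp add: f(2) blinfun.sum_right hf complex_vector.scale_left_diff_distrib sum_subtractf
          complex_vector.scale_sum_right)
    finally show "(\<Sum>k\<in>{0..<nil_index}. (of_nat k - c) *\<^sub>C f k) = 0" by simp
  qed (auto simp: xhy_scaleC hf scaleC_scaleC mult.commute)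
  then have "f k = 0" if "k \<in> {0..<nil_index}" for k using that c by fastforce
  then show ?thesis using f(2) by simp
qed

lemma highest_eq_0: "v \<in> highest j \<Longrightarrow> nil_index \<le> j \<Longrightarrow> v = 0"
  by (rule kernel_eigenvector_eq_0[of v "of_nat j"]) (auto simp: highest_def)

text \<open>The vector \<open>y^(j+1) v\<close> is again killed by \<open>x\<close>, because the
  factor \<open>j - j\<close> appears, but its weight \<open>- j - 2\<close> is negative.\<close>

lemma y_pow_highest_eq_0:
  assumes v: "v \<in> highest j" and "j < q"
  shows "(blinfun_apply y ^^ q) v = 0"
proof -
  have v': "x v = 0" "h v = of_nat j *\<^sub>C v" using v by (auto simp: highest_def)
  have "(blinfun_apply y ^^ Suc j) v = 0"
  proof (rule kernel_eigenvector_eq_0)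
    show "x ((blinfun_apply y ^^ Suc j) v) = 0" using x_y_pow[OF v', of j] by simp
    show "h ((blinfun_apply y ^^ Suc j) v) = (of_nat j - 2 * of_nat (Suc j)) *\<^sub>C (blinfun_apply y ^^ Suc j) v"
      by (rule h_y_pow[OF v'(2)])
    show "of_nat j - 2 * of_nat (Suc j) \<notin> (of_nat ` {..<nil_index} :: complex set)"
    proof
      assume "of_nat j - 2 * of_nat (Suc j) \<in> (of_nat ` {..<nil_index} :: complex set)"
      then obtain k where "(of_nat j :: complex) - 2 * of_nat (Suc j) = of_nat k" by auto
      then have "complex_of_nat k + 2 = - of_nat j" by (simp add: algebra_simps)
      then have "complex_of_nat k + 2 + of_nat j = 0" by (simp only: add.left_inverse)
      then have "complex_of_nat (k + 2 + j) = 0" by (simp only: of_nat_add of_nat_numeral)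
      then have "k + 2 + j = 0" by (simp only: of_nat_eq_0_iff)
      then show False by simp
    qed
  qed
  moreover obtain m where "q = m + Suc j" using \<open>j < q\<close> by (metis Suc_leI le_Suc_ex add.commute)
  ultimately show ?thesis by (simp only: funpow_add o_apply y_pow)
qed

section \<open>Strings and the decomposition of the whole space\<close>

definition string_space :: "nat \<Rightarrow> nat \<Rightarrow> 'd set" where
  "string_space j q = (blinfun_apply y ^^ q) ` highest j"

definition strings :: "(nat \<times> nat) set" where
  "strings = {(j, q). j < nil_index \<and> q \<le> j}"

lemma finite_strings: "finite strings"
  by (rule finite_subset[of _ "{..<nil_index} \<times> {..nil_index}"]) (auto simp: strings_def)

lemma csubspace_string_space: "csubspace (string_space j q)"
proof -
  have "clinear (blinfun_apply y ^^ q)" by (rule clinearI) (simp_all add: y_pow)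
  then show ?thesis
    unfolding string_space_def by (rule clin.linear_subspace_image[OF _ csubspace_highest])
qed

lemma string_space_eq_0: "v \<in> string_space j q \<Longrightarrow> (j, q) \<notin> strings \<Longrightarrow> v = 0"
  using highest_eq_0 y_pow_highest_eq_0 by (force simp: string_space_def strings_def y_pow)

lemma string_space_subspace:
  "0 \<in> string_space j q"
  "u \<in> string_space j q \<Longrightarrow> v \<in> string_space j q \<Longrightarrow> u + v \<in> string_space j q"
  "v \<in> string_space j q \<Longrightarrow> c *\<^sub>C v \<in> string_space j q"
  using csubspace_string_space
  by (auto intro: complex_vector.subspace_0 complex_vector.subspace_add complex_vector.subspace_scale)

lemma string_spaceE:
  assumes "v \<in> string_space j q"
  obtains p where "x p = 0" "h p = of_nat j *\<^sub>C p" "p \<in> highest j" "v = (blinfun_apply y ^^ q) p"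
  using assms by (auto simp: string_space_def highest_def)

lemma h_string: "v \<in> string_space j q \<Longrightarrow> h v = (of_nat j - 2 * of_nat q) *\<^sub>C v"
  by (elim string_spaceE) (simp add: h_y_pow)

lemma y_string: "v \<in> string_space j q \<Longrightarrow> y v \<in> string_space j (Suc q)"
  by (auto simp: string_space_def)

lemma x_string:
  assumes "v \<in> string_space j (Suc q)"
  shows "x v \<in> string_space j q"
proof -
  obtain p where p: "x p = 0" "h p = of_nat j *\<^sub>C p" "p \<in> highest j" "v = (blinfun_apply y ^^ Suc q) p"
    using assms by (rule string_spaceE)
  have "(blinfun_apply y ^^ q) p \<in> string_space j q" using p(3) by (auto simp: string_space_def)
  then show ?thesis unfolding p(4) x_y_pow[OF p(1,2)] by (rule string_space_subspace)
qed

lemma x_string_0: "v \<in> string_space j 0 \<Longrightarrow> x v = 0"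
  by (auto simp: string_space_def highest_def)

lemma xy_string: "v \<in> string_space j q \<Longrightarrow> x (y v) = (of_nat (Suc q) * (of_nat j - of_nat q)) *\<^sub>C v"
  by (elim string_spaceE) (use x_y_pow in simp)

lemma yx_string:
  assumes "v \<in> string_space j q"
  shows "y (x v) = (of_nat q * (of_nat j - of_nat q + 1)) *\<^sub>C v"
proof -
  have "y (x v) = x (y v) - h v" by (simp add: xy)
  also have "\<dots> = (of_nat (Suc q) * (of_nat j - of_nat q) - (of_nat j - 2 * of_nat q)) *\<^sub>C v"
    using assms by (simp only: xy_string h_string complex_vector.scale_left_diff_distrib)
  also have "\<dots> = (of_nat q * (of_nat j - of_nat q + 1)) *\<^sub>C v" by (simp add: algebra_simps)
  finally show ?thesis .
qed

text \<open>The constant is the product of the factors \<open>m * (k - m + 1)\<close> for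
  \<open>1 \<le> m \<le> n\<close>, none of which is zero. Its independence of \<open>v\<close>
  later gives a linear inverse of a power of \<open>y\<close>.\<close>

lemma x_pow_y_pow_highest:
  "n \<le> k \<Longrightarrow> \<exists>c. c \<noteq> 0 \<and> (\<forall>v\<in>highest k. (blinfun_apply x ^^ n) ((blinfun_apply y ^^ n) v) = c *\<^sub>C v)"
proof (induction n)
  case 0
  show ?case by (intro exI[of _ 1]) (simp add: scaleC_one)
next
  case (Suc n)
  then obtain c where c: "c \<noteq> 0"
    "\<And>v. v \<in> highest k \<Longrightarrow> (blinfun_apply x ^^ n) ((blinfun_apply y ^^ n) v) = c *\<^sub>C v" by auto
  let ?d = "of_nat (Suc n) * (of_nat k - of_nat n) :: complex"
  have "(blinfun_apply x ^^ Suc n) ((blinfun_apply y ^^ Suc n) v) = (?d * c) *\<^sub>C v" if "v \<in> highest k" for v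
  proof -
    have "x v = 0" "h v = of_nat k *\<^sub>C v" using that by (auto simp: highest_def)
    then have "(blinfun_apply x ^^ n) (x ((blinfun_apply y ^^ Suc n) v)) = (?d * c) *\<^sub>C v"
      by (simp only: x_y_pow x_pow c(2)[OF that] scaleC_scaleC)
    then show ?thesis by (simp add: funpow_swap1)
  qed
  moreover have "complex_of_nat k \<noteq> of_nat n" using Suc.prems by (simp only: of_nat_eq_iff)
  then have "?d * c \<noteq> 0" using c(1) by (simp del: of_nat_Suc)
  ultimately show ?case by blast
qed

definition string_sum :: "'d \<Rightarrow> bool" where
  "string_sum w \<longleftrightarrow> (\<exists>u. (\<forall>(j, q)\<in>strings. u (j, q) \<in> string_space j q) \<and> w = (\<Sum>a\<in>strings. u a))"

lemma string_sum_add: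
  assumes "string_sum v" "string_sum w"
  shows "string_sum (v + w)"
proof -
  obtain a where a: "\<forall>(j, q)\<in>strings. a (j, q) \<in> string_space j q" "v = (\<Sum>i\<in>strings. a i)"
    using assms(1) unfolding string_sum_def by blast
  obtain b where b: "\<forall>(j, q)\<in>strings. b (j, q) \<in> string_space j q" "w = (\<Sum>i\<in>strings. b i)"
    using assms(2) unfolding string_sum_def by blast
  show ?thesis
    unfolding string_sum_def using a b
    by (intro exI[of _ "\<lambda>i. a i + b i"]) (auto simp: sum.distrib intro: string_space_subspace)
qed

lemma string_sum_string:
  assumes "v \<in> string_space j q"
  shows "string_sum v"
proof (cases "(j, q) \<in> strings")
  case True
  then show ?thesis
    unfolding string_sum_def using assms string_space_subspace(1) finite_strings
    by (intro exI[of _ "\<lambda>a. if a = (j, q) then v else 0"]) auto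
next
  case False
  then have "v = 0" using assms string_space_eq_0 by blast
  then show ?thesis
    unfolding string_sum_def using string_space_subspace(1) by (intro exI[of _ "\<lambda>_. 0"]) auto
qed

lemma string_sum_sum: "(\<And>k. k \<in> K \<Longrightarrow> string_sum (f k)) \<Longrightarrow> string_sum (\<Sum>k\<in>K. f k)"
  using string_sum_string[OF string_space_subspace(1)]
  by (induction K rule: infinite_finite_induct) (auto intro: string_sum_add)

text \<open>Induction on an exponent that kills \<open>w\<close>. If \<open>x^(n+1) w = 0\<close>,
  then \<open>x^n w\<close> is a sum of highest weight vectors of weights at least \<open>n\<close>.
  Each of these is \<open>x^n\<close> applied to a multiple of its own \<open>y^n\<close>, so
  subtracting string vectors leaves a vector killed by \<open>x^n\<close>.\<close>

lemma string_sum_UNIV: "string_sum w"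
proof -
  have "(blinfun_apply x ^^ n) w = 0 \<Longrightarrow> string_sum w" if "n \<le> nil_index" for n
    using that
  proof (induction n arbitrary: w)
    case 0
    then show ?case using string_sum_string[OF string_space_subspace(1)] by simp
  next
    case (Suc n)
    define u where "u = (blinfun_apply x ^^ n) w"
    have "x u = 0" using Suc.prems by (simp add: u_def)
    then obtain f where f: "\<forall>k. f k \<in> highest k" "u = (\<Sum>k\<in>{n..<nil_index}. f k)"
      using kernel_range_decomposition[of n u w] Suc.prems u_def by auto
    have "\<forall>k. \<exists>c. n \<le> k \<longrightarrow> c \<noteq> 0 \<and>
        (\<forall>v\<in>highest k. (blinfun_apply x ^^ n) ((blinfun_apply y ^^ n) v) = c *\<^sub>C v)"
      using x_pow_y_pow_highest by blast
    from choice[OF this] obtain c where c: "\<And>k. n \<le> k \<Longrightarrow> c k \<noteq> 0"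
      "\<And>k v. n \<le> k \<Longrightarrow> v \<in> highest k \<Longrightarrow> (blinfun_apply x ^^ n) ((blinfun_apply y ^^ n) v) = c k *\<^sub>C v"
      by auto
    define w' where "w' = (\<Sum>k\<in>{n..<nil_index}. inverse (c k) *\<^sub>C (blinfun_apply y ^^ n) (f k))"
    have "string_sum w'"
      unfolding w'_def using f(1)
      by (intro string_sum_sum string_sum_string string_space_subspace(3)) (auto simp: string_space_def)
    moreover have "(blinfun_apply x ^^ n) w' = u"
      unfolding w'_def f(2) x_pow_sum
      by (rule sum.cong) (use c f(1) in \<open>auto simp: x_pow scaleC_scaleC scaleC_one\<close>)
    then have "(blinfun_apply x ^^ n) (w - w') = 0" by (simp add: x_pow u_def)
    then have "string_sum (w - w')" using Suc by simp
    ultimately show ?case using string_sum_add[of w' "w - w'"] by simp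
  qed
  then show ?thesis using x_pow_nil_index by blast
qed

text \<open>The operator is the Casimir element up to normalization. It detects the highest weight
  \<open>j\<close>, after which the weight detects the position \<open>q\<close>.\<close>

lemma casimir_string:
  assumes "v \<in> string_space j q"
  shows "h (h v) + 2 *\<^sub>C h v + 4 *\<^sub>C y (x v) = (of_nat j * (of_nat j + 2)) *\<^sub>C v"
proof -
  have "h (h v) + 2 *\<^sub>C h v + 4 *\<^sub>C y (x v) = ((of_nat j - 2 * of_nat q) * (of_nat j - 2 * of_nat q)
      + 2 * (of_nat j - 2 * of_nat q) + 4 * (of_nat q * (of_nat j - of_nat q + 1))) *\<^sub>C v"
    using assms by (simp only: h_string yx_string xhy_scaleC scaleC_scaleC scaleC_add_left)
  then show ?thesis by (simp add: algebra_simps)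
qed

section \<open>Projections onto the string spaces\<close>

lemma ex_string_projections:
  "\<exists>\<pi>. (\<forall>j q. \<pi> j q \<in> End_D) \<and> (\<forall>j q v. blinfun_apply (\<pi> j q) v \<in> string_space j q) \<and>
     (\<forall>v. (\<Sum>(j, q)\<in>strings. blinfun_apply (\<pi> j q) v) = v) \<and>
     (\<forall>j q i r v. v \<in> string_space j q \<longrightarrow> blinfun_apply (\<pi> i r) v = (if i = j \<and> r = q then v else 0))"
proof -
  define V where "V a = string_space (fst a) (snd a)" for a
  have ex: "\<exists>u. (\<forall>a\<in>strings. u a \<in> V a) \<and> v = (\<Sum>a\<in>strings. u a)" for v
    using string_sum_UNIV[of v] unfolding string_sum_def V_def by fastforce
  show ?thesis
  proof (rule ex_projections[of strings V, OF _ ex])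
    show "csubspace (V a)" for a using csubspace_string_space by (simp add: V_def)
    fix u a assume u: "\<And>a. a \<in> strings \<Longrightarrow> u a \<in> V a" "(\<Sum>a\<in>strings. u a) = 0" "a \<in> strings"
    have S: "clinear (\<lambda>v. h (h v) + 2 *\<^sub>C h v + 4 *\<^sub>C y (x v))"
      by (rule clinearI) (simp_all add: blinfun.add_right xhy_scaleC scaleC_add_right scaleC_scaleC
          mult.commute)
    have T: "clinear (blinfun_apply h)" using xhy_End_D by (simp add: End_D_iff)
    show "u a = 0"
    proof (rule sum_simultaneous_eigenvectors_eq_0[OF finite_strings S T _ _ _ u(2,3)])
      fix a assume "a \<in> strings"
      then have "u a \<in> string_space (fst a) (snd a)" using u(1) by (auto simp: V_def)
      then show "h (h (u a)) + 2 *\<^sub>C h (u a) + 4 *\<^sub>C y (x (u a)) = (of_nat (fst a) * (of_nat (fst a) + 2)) *\<^sub>C u a"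
        and "h (u a) = (of_nat (fst a) - 2 * of_nat (snd a)) *\<^sub>C u a"
        by (rule casimir_string, rule h_string)
    next
      fix a b :: "nat \<times> nat"
      assume "(of_nat (fst a) * (of_nat (fst a) + 2) :: complex) = of_nat (fst b) * (of_nat (fst b) + 2)"
      then have "complex_of_nat (fst a * (fst a + 2)) = of_nat (fst b * (fst b + 2))"
        by (simp only: of_nat_mult of_nat_add of_nat_numeral)
      then have eq: "fst a * (fst a + 2) = fst b * (fst b + 2)" by (simp only: of_nat_eq_iff)
      \<comment> \<open>Strict monotonicity on the naturals: the Casimir eigenvalue determines the
        highest weight.\<close>
      have "m * (m + 2) < n * (n + 2)" if "m < n" for m n :: nat
        using mult_strict_mono[of m n "m + 2" "n + 2"] that by simp
      from this[of "fst a" "fst b"] this[of "fst b" "fst a"] eq have 1: "fst a = fst b"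
        by (metis less_irrefl linorder_neqE_nat)
      assume "(of_nat (fst a) - 2 * of_nat (snd a) :: complex) = of_nat (fst b) - 2 * of_nat (snd b)"
      then show "a = b" using 1 by (simp add: prod_eq_iff)
    qed
  next
    fix p
    assume p: "\<And>a. a \<in> strings \<Longrightarrow> clinear (p a)" "\<And>a v. a \<in> strings \<Longrightarrow> p a v \<in> V a"
      "\<And>v. (\<Sum>a\<in>strings. p a v) = v"
      and p_eq: "\<And>u v a. \<forall>a\<in>strings. u a \<in> V a \<Longrightarrow> (\<Sum>a\<in>strings. u a) = v \<Longrightarrow> a \<in> strings \<Longrightarrow> p a v = u a"
    define \<pi> where "\<pi> j q = (if (j, q) \<in> strings then Blinfun (p (j, q)) else 0)" for j q
    have \<pi>: "blinfun_apply (\<pi> j q) v = (if (j, q) \<in> strings then p (j, q) v else 0)" for j q v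
      using p(1) by (simp add: \<pi>_def Blinfun_clinear_apply)
    have "\<pi> j q \<in> End_D" for j q
      using p(1) by (simp add: \<pi>_def Blinfun_clinear_End End_D_ops)
    moreover have "blinfun_apply (\<pi> j q) v \<in> string_space j q" for j q v
      using p(2)[of "(j, q)" v] by (auto simp: \<pi> V_def string_space_subspace)
    moreover have "(\<Sum>(j, q)\<in>strings. blinfun_apply (\<pi> j q) v) = v" for v
      using p(3)[of v] by (simp add: \<pi> split_beta cong: sum.cong)
    moreover have "blinfun_apply (\<pi> i r) v = (if i = j \<and> r = q then v else 0)"
      if v: "v \<in> string_space j q" for i r j q v
    proof (cases "(j, q) \<in> strings")
      case True
      have "p a v = (if a = (j, q) then v else 0)" if "a \<in> strings" for a
        by (rule p_eq[of "\<lambda>a. if a = (j, q) then v else 0"])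
          (use v True that finite_strings in \<open>auto simp: V_def string_space_subspace\<close>)
      then show ?thesis using True by (auto simp: \<pi>)
    next
      case False
      then have "v = 0" using v string_space_eq_0 by blast
      then show ?thesis by simp
    qed
    ultimately show ?thesis by (intro exI[of _ \<pi>]) blast
  qed
qed

definition proj :: "nat \<Rightarrow> nat \<Rightarrow> 'd \<Rightarrow>\<^sub>L 'd" where
  "proj = (SOME \<pi>. (\<forall>j q. \<pi> j q \<in> End_D) \<and> (\<forall>j q v. blinfun_apply (\<pi> j q) v \<in> string_space j q) \<and>
     (\<forall>v. (\<Sum>(j, q)\<in>strings. blinfun_apply (\<pi> j q) v) = v) \<and>
     (\<forall>j q i r v. v \<in> string_space j q \<longrightarrow> blinfun_apply (\<pi> i r) v = (if i = j \<and> r = q then v else 0)))"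

lemma
  shows proj_End_D: "proj j q \<in> End_D"
    and proj_string: "proj j q v \<in> string_space j q"
    and sum_proj: "(\<Sum>(j, q)\<in>strings. proj j q v) = v"
    and proj_eq: "w \<in> string_space j q \<Longrightarrow> proj i r w = (if i = j \<and> r = q then w else 0)"
proof -
  note * = someI_ex[OF ex_string_projections, folded proj_def]
  show "proj j q \<in> End_D" "proj j q v \<in> string_space j q" "(\<Sum>(j, q)\<in>strings. proj j q v) = v"
    using * by auto
  show "w \<in> string_space j q \<Longrightarrow> proj i r w = (if i = j \<and> r = q then w else 0)"
    using *[THEN conjunct2, THEN conjunct2, THEN conjunct2] by metis
qed

lemma proj_eq_0: "(j, q) \<notin> strings \<Longrightarrow> proj j q = 0"
  using proj_string string_space_eq_0 by (intro blinfun_eqI) fastforce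

lemma proj_sum: "A v = (\<Sum>(j, q)\<in>strings. A (proj j q v))" for A :: "'d \<Rightarrow>\<^sub>L 'd"
proof -
  have "A v = A (\<Sum>(j, q)\<in>strings. proj j q v)" by (simp only: sum_proj)
  then show ?thesis by (simp add: blinfun.sum_right split_beta)
qed

lemma proj_proj: "proj i r (proj j q v) = (if i = j \<and> r = q then proj j q v else 0)"
  by (rule proj_eq[OF proj_string])

lemma blocks_eqI:
  fixes A B :: "'d \<Rightarrow>\<^sub>L 'd"
  assumes "\<And>i r j q v. proj i r (A (proj j q v)) = proj i r (B (proj j q v))"
  shows "A = B"
proof (rule blinfun_eqI)
  fix v
  have "A (proj j q v) = B (proj j q v)" for j q
    by (subst (1 2) sum_proj[symmetric]) (simp only: assms)
  then show "A v = B v" by (subst (1 2) proj_sum) (simp only:)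
qed

text \<open>For operators that shift positions by a fixed amount: one string space is sent to the
  target, and nothing else contributes there.\<close>

lemma proj_comm:
  fixes A :: "'d \<Rightarrow>\<^sub>L 'd"
  assumes "\<And>v. v \<in> string_space j q \<Longrightarrow> A v \<in> string_space i r"
    and "\<And>k s v. v \<in> string_space k s \<Longrightarrow> (k, s) \<noteq> (j, q) \<Longrightarrow> proj i r (A v) = 0"
  shows "proj i r (A v) = A (proj j q v)"
proof -
  have eq: "proj i r (A (proj k s v)) = (if (k, s) = (j, q) then A (proj j q v) else 0)" for k s
    using assms(2)[OF proj_string, of k s v] proj_eq[OF assms(1)[OF proj_string, of v], of i r] by auto
  have "proj i r (A v) = (\<Sum>a\<in>strings. proj i r (A (proj (fst a) (snd a) v)))"
    by (simp add: proj_sum[of A v] blinfun.sum_right split_beta)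
  also have "\<dots> = (\<Sum>a\<in>strings. if a = (j, q) then A (proj j q v) else 0)"
    by (rule sum.cong) (auto simp: eq)
  also have "\<dots> = A (proj j q v)"
    using finite_strings proj_eq_0[of j q] by (auto simp: sum.delta)
  finally show ?thesis .
qed

lemma proj_x: "proj j q (x v) = x (proj j (Suc q) v)"
proof (rule proj_comm)
  fix k s v assume v: "v \<in> string_space k s" "(k, s) \<noteq> (j, Suc q)"
  show "proj j q (x v) = 0"
  proof (cases s)
    case 0
    then show ?thesis using v x_string_0 by simp
  next
    case (Suc s')
    then show ?thesis using v proj_eq[OF x_string, of v k s' j q] by auto
  qed
qed (rule x_string)

lemma proj_y: "proj j (Suc q) (y v) = y (proj j q v)"
proof (rule proj_comm)
  fix k s v assume v: "v \<in> string_space k s" "(k, s) \<noteq> (j, q)"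
  then show "proj j (Suc q) (y v) = 0" using proj_eq[OF y_string, of v k s j "Suc q"] by auto
qed (rule y_string)

lemma x_proj_0: "x (proj j 0 v) = 0"
  by (rule x_string_0[OF proj_string])

lemmas xy_proj = xy_string[OF proj_string]
  and yx_proj = yx_string[OF proj_string]

end

section \<open>The slice in terms of blocks\<close>

definition basis_vector :: "nat \<Rightarrow> nat \<Rightarrow> complex" where
  "basis_vector k = (\<lambda>n. if n = k then 1 else 0)"

lemma basis_vector_simple_module: "k \<le> i \<Longrightarrow> basis_vector k \<in> simple_module i"
  by (auto simp: basis_vector_def simple_module_def)

lemma simple_y_basis_vector: "k < i \<Longrightarrow> simple_y i (basis_vector k) = basis_vector (Suc k)"
  by (auto simp: fun_eq_iff simple_y_def basis_vector_def)

lemma simple_y_pow_basis_vector: "k + n \<le> i \<Longrightarrow> (simple_y i ^^ n) (basis_vector k) = basis_vector (k + n)"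
  by (induction n) (auto simp: simple_y_basis_vector)

lemma simple_y_pow_eq_0: "k < n \<Longrightarrow> (simple_y i ^^ n) l k = 0"
  by (induction n arbitrary: k) (auto simp: simple_y_def)

lemma dual_y_pow: "(dual_y j ^^ n) \<xi> l = (- 1) ^ n * \<xi> ((simple_y j ^^ n) l)"
  by (induction n arbitrary: l) (simp_all add: dual_y_def funpow_swap1[of "simple_y j"])

lemma csubspace_simple_module: "csubspace (simple_module i)"
  by (auto simp: complex_vector.subspace_def simple_module_def scaleC_fun_def scaleC_complex_def)

lemma simple_module_sum_basis_vectors:
  assumes "l \<in> simple_module i"
  shows "l = (\<Sum>k\<le>i. l k *\<^sub>C basis_vector k)"
proof
  fix n
  have sum_app: "(\<Sum>k\<in>K. f k) n = (\<Sum>k\<in>K. f k n)" if "finite K" for K and f :: "nat \<Rightarrow> nat \<Rightarrow> complex"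
    using that by (induction K) auto
  have "(\<Sum>k\<le>i. l k *\<^sub>C basis_vector k) n = (\<Sum>k\<le>i. if k = n then l k else 0)"
    by (simp add: sum_app scaleC_fun_def basis_vector_def scaleC_complex_def if_distrib
        cong: if_cong)
  then show "l n = (\<Sum>k\<le>i. l k *\<^sub>C basis_vector k) n"
    using assms by (simp add: simple_module_def)
qed

lemma clinear_on_sum:
  assumes f: "clinear_on V f" and V: "csubspace V" and g: "\<And>k. k \<in> K \<Longrightarrow> g k \<in> V"
  shows "f (\<Sum>k\<in>K. g k) = (\<Sum>k\<in>K. f (g k))"
proof -
  have f0: "f 0 = 0"
    using f complex_vector.subspace_0[OF V] unfolding clinear_on_def
    by (metis complex_vector.scale_zero_left)
  show ?thesis using g
  proof (induction K rule: infinite_finite_induct)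
    case (insert a K)
    then have "(\<Sum>k\<in>K. g k) \<in> V" by (intro complex_vector.subspace_sum[OF V]) auto
    then show ?case using insert f by (simp add: clinear_on_def)
  qed (simp_all add: f0)
qed

lemma ker_y_apply:
  assumes "l \<in> ker_y i" "k < i"
  shows "l k = 0"
proof -
  have "simple_y i l (Suc k) = 0" using assms(1) by (simp add: ker_y_def)
  then show ?thesis using assms(2) by (simp add: simple_y_def)
qed

context sl2_nilpotent
begin

text \<open>The homomorphism from the simple module that sends the highest weight vector to
  \<open>p\<close>; the value 0 elsewhere matches the convention of
  \<open>multiplicity_space\<close>.\<close>

definition string_hom :: "nat \<Rightarrow> 'd \<Rightarrow> (nat \<Rightarrow> complex) \<Rightarrow> 'd" where
  "string_hom i p l = (if l \<in> simple_module i then \<Sum>k\<le>i. l k *\<^sub>C (blinfun_apply y ^^ k) p else 0)"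

lemma string_hom_multiplicity_space:
  assumes p: "p \<in> highest i"
  shows "string_hom i p \<in> multiplicity_space x h y i"
proof -
  have p': "x p = 0" "h p = of_nat i *\<^sub>C p" using p by (auto simp: highest_def)
  have y0: "(blinfun_apply y ^^ Suc i) p = 0" by (rule y_pow_highest_eq_0[OF p]) simp
  have lin: "clinear_on (simple_module i) (string_hom i p)"
    using complex_vector.subspace_add[OF csubspace_simple_module, of _ i]
      complex_vector.subspace_scale[OF csubspace_simple_module, of _ i]
    by (auto simp: clinear_on_def string_hom_def scaleC_fun_def scaleC_complex_def scaleC_add_left
        sum.distrib complex_vector.scale_sum_right scaleC_scaleC)
  have "string_hom i p (simple_x i l) = x (string_hom i p l)"
    "string_hom i p (simple_h i l) = h (string_hom i p l)"
    "string_hom i p (simple_y i l) = y (string_hom i p l)" if l: "l \<in> simple_module i" for l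
  proof -
    have mem: "simple_x i l \<in> simple_module i" "simple_h i l \<in> simple_module i" "simple_y i l \<in> simple_module i"
      using l by (auto simp: simple_module_def simple_x_def simple_h_def simple_y_def)
    show "string_hom i p (simple_h i l) = h (string_hom i p l)"
      using l mem by (simp add: string_hom_def blinfun.sum_right xhy_scaleC h_y_pow[OF p'(2)]
          scaleC_scaleC simple_h_def mult.commute)
    \<comment> \<open>The shift of the index loses nothing: the factor \<open>i - k\<close> vanishes
      at \<open>k = i\<close>, and \<open>x p = 0\<close> supplies the term at 0.\<close>
    have "string_hom i p (simple_x i l) = (\<Sum>k<i. simple_x i l k *\<^sub>C (blinfun_apply y ^^ k) p)"
      using mem by (simp add: string_hom_def lessThan_Suc_atMost[symmetric] simple_x_def)
    also have "\<dots> = (\<Sum>k<i. l (Suc k) *\<^sub>C x ((blinfun_apply y ^^ Suc k) p))"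
      by (rule sum.cong) (simp_all only: x_y_pow[OF p'] scaleC_scaleC simple_x_def
          Suc_eq_plus1[symmetric] mult_ac)
    also have "\<dots> = (\<Sum>k\<le>i. l k *\<^sub>C x ((blinfun_apply y ^^ k) p))"
      using p'(1) by (simp add: lessThan_Suc_atMost[symmetric] sum.lessThan_Suc_shift
          del: sum.lessThan_Suc)
    also have "\<dots> = x (string_hom i p l)"
      using l by (simp add: string_hom_def blinfun.sum_right xhy_scaleC)
    finally show "string_hom i p (simple_x i l) = x (string_hom i p l)" .
    \<comment> \<open>Here \<open>simple_y\<close> has no coefficient at 0, and the extra term at
      the top is \<open>y^(i+1) p = 0\<close>.\<close>
    have "string_hom i p (simple_y i l) = (\<Sum>k<i. l k *\<^sub>C (blinfun_apply y ^^ Suc k) p)"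
      using mem by (simp add: string_hom_def lessThan_Suc_atMost[symmetric] sum.lessThan_Suc_shift
          simple_y_def del: sum.lessThan_Suc)
    also have "\<dots> = (\<Sum>k\<le>i. l k *\<^sub>C (blinfun_apply y ^^ Suc k) p)"
      using y0 by (simp add: lessThan_Suc_atMost[symmetric])
    also have "\<dots> = y (string_hom i p l)"
      using l by (simp add: string_hom_def blinfun.sum_right xhy_scaleC)
    finally show "string_hom i p (simple_y i l) = y (string_hom i p l)" .
  qed
  then show ?thesis using lin by (simp add: multiplicity_space_def string_hom_def)
qed

lemma string_hom_basis_vector: "k \<le> i \<Longrightarrow> string_hom i p (basis_vector k) = (blinfun_apply y ^^ k) p"
  unfolding string_hom_def using basis_vector_simple_module[of k i]
  by (simp add: basis_vector_def if_distrib[of "\<lambda>c. c *\<^sub>C _"] scaleC_one cong: if_cong)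

lemma multiplicity_space_highest:
  assumes m: "m \<in> multiplicity_space x h y i"
  shows "m (basis_vector 0) \<in> highest i"
proof -
  have e: "basis_vector 0 \<in> simple_module i" by (simp add: basis_vector_simple_module)
  have lin: "clinear_on (simple_module i) m" using m by (simp add: multiplicity_space_def)
  have scale: "m (a *\<^sub>C basis_vector 0) = a *\<^sub>C m (basis_vector 0)" for a
    using lin e by (simp add: clinear_on_def)
  have "m (simple_x i (basis_vector 0)) = x (m (basis_vector 0))"
    "m (simple_h i (basis_vector 0)) = h (m (basis_vector 0))"
    using m e by (simp_all add: multiplicity_space_def)
  moreover have "simple_x i (basis_vector 0) = 0 *\<^sub>C basis_vector 0"
    by (simp add: fun_eq_iff simple_x_def basis_vector_def)
  moreover have "simple_h i (basis_vector 0) = of_nat i *\<^sub>C basis_vector 0"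
    by (auto simp: fun_eq_iff simple_h_def basis_vector_def scaleC_fun_def scaleC_complex_def)
  ultimately show ?thesis unfolding highest_def
    using scale[of 0] scale[of "of_nat i"] by simp
qed

lemma multiplicity_space_basis_vector:
  assumes m: "m \<in> multiplicity_space x h y i"
  shows "k \<le> i \<Longrightarrow> m (basis_vector k) = (blinfun_apply y ^^ k) (m (basis_vector 0))"
proof (induction k)
  case (Suc k)
  have "m (basis_vector (Suc k)) = m (simple_y i (basis_vector k))"
    using Suc.prems by (simp add: simple_y_basis_vector)
  also have "\<dots> = y (m (basis_vector k))"
    using m Suc.prems basis_vector_simple_module[of k i] by (simp add: multiplicity_space_def)
  finally show ?case using Suc by simp
qed simp

lemma multiplicity_space_apply:
  assumes m: "m \<in> multiplicity_space x h y i" and l: "l \<in> simple_module i"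
  shows "m l = (\<Sum>k\<le>i. l k *\<^sub>C m (basis_vector k))"
proof -
  have lin: "clinear_on (simple_module i) m" using m by (simp add: multiplicity_space_def)
  have b: "basis_vector k \<in> simple_module i" if "k \<in> {..i}" for k
    using that by (simp add: basis_vector_simple_module)
  have "m l = m (\<Sum>k\<le>i. l k *\<^sub>C basis_vector k)"
    using simple_module_sum_basis_vectors[OF l] by simp
  also have "\<dots> = (\<Sum>k\<le>i. m (l k *\<^sub>C basis_vector k))"
    using b by (intro clinear_on_sum[OF lin csubspace_simple_module]
        complex_vector.subspace_scale[OF csubspace_simple_module])
  also have "\<dots> = (\<Sum>k\<le>i. l k *\<^sub>C m (basis_vector k))"
    using lin b by (intro sum.cong) (auto simp: clinear_on_def)
  finally show ?thesis .
qed

lemma multiplicity_space_string: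
  assumes m: "m \<in> multiplicity_space x h y i" and "k \<le> i"
  shows "m (basis_vector k) \<in> string_space i k"
  using multiplicity_space_basis_vector[OF assms] multiplicity_space_highest[OF m]
  by (auto simp: string_space_def)

text \<open>With \<open>V j q\<close> for the span of the \<open>q\<close>-th vectors of the strings of highest weight \<open>j\<close>, the
  subspace \<open>C\<close> consists of the operators that map each \<open>V j q\<close> into the sum of the \<open>V i i\<close> with
  \<open>i \<ge> q\<close>.\<close>

definition slice :: "('d \<Rightarrow>\<^sub>L 'd) set" where
  "slice = {c \<in> End_D. \<forall>i r j q v. \<not> (r = i \<and> q \<le> i) \<longrightarrow> proj i r (c (proj j q v)) = 0}"

lemma slice_block: "c \<in> slice \<Longrightarrow> \<not> (r = i \<and> q \<le> i) \<Longrightarrow> proj i r (c (proj j q v)) = 0"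
  by (simp add: slice_def)

lemma csubspace_slice: "csubspace slice"
  by (auto simp: slice_def complex_vector.subspace_def End_D_ops blinfun.bilinear_simps
      blinfun_apply_scaleC End_D_scaleC[OF proj_End_D])

lemma closed_slice: "closed slice"
proof -
  have "slice = End_D \<inter> (\<Inter>(i, r, j, q, v)\<in>{(i, r, j, q, v). \<not> (r = i \<and> q \<le> i)}.
      {c. proj i r (blinfun_apply c (proj j q v)) = 0})"
    by (auto simp: slice_def)
  also have "closed \<dots>"
    by (intro closed_Int closed_End_D closed_INT ballI)
      (auto intro!: closed_Collect_eq continuous_intros)
  finally show ?thesis .
qed

lemma block_sum: "A = (\<Sum>a\<in>strings. \<Sum>b\<in>strings. proj (fst a) (snd a) o\<^sub>L A o\<^sub>L proj (fst b) (snd b))"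
  for A :: "'d \<Rightarrow>\<^sub>L 'd"
proof (rule blinfun_eqI)
  fix v
  have "A v = (\<Sum>a\<in>strings. proj (fst a) (snd a) (A v))"
    using sum_proj[of "A v"] by (simp add: split_beta)
  also have "\<dots> = (\<Sum>a\<in>strings. \<Sum>b\<in>strings. proj (fst a) (snd a) (A (proj (fst b) (snd b) v)))"
    by (simp add: proj_sum[of A v] blinfun.sum_right split_beta)
  finally show "A v = (\<Sum>a\<in>strings. \<Sum>b\<in>strings. proj (fst a) (snd a) o\<^sub>L A o\<^sub>L proj (fst b) (snd b)) v"
    by (simp add: blinfun.sum_left)
qed

text \<open>On the vector in position \<open>q\<close> of a string of weight \<open>j\<close> the
  tensor is \<xi>(\<open>e_q\<close>) times the value of a homomorphism at \<open>l\<close>. The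
  kernel of \<open>y\<close> is spanned by the lowest vector, so this value lies in
  \<open>V i i\<close>. For \<open>q > i\<close>, the vector \<open>e_q\<close> is in the image of
  \<open>y^(i+1)\<close>, where \<xi> vanishes.\<close>

lemma pure_tensor_in_slice:
  assumes \<phi>: "\<phi> ` multiplicity_space x h y j \<subseteq> multiplicity_space x h y i"
    and l: "l \<in> ker_y i" and \<xi>: "\<xi> \<in> ker_y_pow_dual (i + 1) j" and A: "is_pure_tensor x h y j \<phi> l \<xi> A"
  shows "A \<in> slice"
  unfolding slice_def
proof (intro CollectI conjI allI impI)
  show "A \<in> End_D" using A by (simp add: is_pure_tensor_def)
  fix i' r j' q :: nat and v assume bad: "\<not> (r = i' \<and> q \<le> i')"
  show "proj i' r (A (proj j' q v)) = 0"
  proof (cases "(j', q) \<in> strings")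
    case True
    then have q: "q \<le> j'" by (simp add: strings_def)
    obtain p where p: "p \<in> highest j'" "proj j' q v = (blinfun_apply y ^^ q) p"
      using proj_string by (rule string_spaceE)
    define m where "m = string_hom j' p"
    have m: "m \<in> multiplicity_space x h y j'" using string_hom_multiplicity_space[OF p(1)] by (simp add: m_def)
    have "proj j' q v = m (basis_vector q)" using q by (simp add: p(2) m_def string_hom_basis_vector)
    then have Av: "A (proj j' q v) = (if j' = j then \<xi> (basis_vector q) *\<^sub>C \<phi> m l else 0)"
      using A m q basis_vector_simple_module[of q j'] by (simp add: is_pure_tensor_def)
    show ?thesis
    proof (cases "j' = j")
      case True
      have \<phi>m: "\<phi> m \<in> multiplicity_space x h y i" using \<phi> m True by auto
      have ls: "l \<in> simple_module i" using l by (simp add: ker_y_def)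
      have "\<phi> m l = (\<Sum>k\<le>i. if k = i then l i *\<^sub>C \<phi> m (basis_vector i) else 0)"
        unfolding multiplicity_space_apply[OF \<phi>m ls]
        by (rule sum.cong) (use ker_y_apply[OF l] in auto)
      then have "\<phi> m l = l i *\<^sub>C \<phi> m (basis_vector i)" by simp
      then have string: "\<phi> m l \<in> string_space i i"
        using multiplicity_space_string[OF \<phi>m] string_space_subspace(3) by auto
      show ?thesis
      proof (cases "q \<le> i")
        case True
        then have "proj i' r (\<phi> m l) = 0" using proj_eq[OF string] bad by auto
        then show ?thesis using Av by (simp add: End_D_scaleC[OF proj_End_D])
      next
        case False
        then have k: "q - Suc i + Suc i = q" by simp
        have "(dual_y j ^^ (i + 1)) \<xi> (basis_vector (q - Suc i)) = 0"
          using \<xi> basis_vector_simple_module[of "q - Suc i" j] q \<open>j' = j\<close> by (simp add: ker_y_pow_dual_def)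
        then have "\<xi> (basis_vector q) = 0"
          using simple_y_pow_basis_vector[of "q - Suc i" "Suc i" j] q \<open>j' = j\<close> k
          by (simp add: dual_y_pow del: funpow.simps)
        then show ?thesis using Av by simp
      qed
    qed (simp add: Av)
  qed (simp add: proj_eq_0)
qed

text \<open>An admissible block is a single pure tensor: the functional reads off the coordinate
  \<open>q\<close>, the vector is the lowest one, and \<phi> sends \<open>m\<close> to the
  homomorphism whose lowest vector is the prescribed image.\<close>

lemma block_pure_tensor:
  assumes c: "c \<in> End_D" and q: "q \<le> i" "q \<le> j"
  obtains \<phi> where "clinear_on (multiplicity_space x h y j) \<phi>"
    "\<phi> ` multiplicity_space x h y j \<subseteq> multiplicity_space x h y i"
    "is_pure_tensor x h y j \<phi> (basis_vector i) (\<lambda>l. l q) (proj i i o\<^sub>L c o\<^sub>L proj j q)"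
proof -
  obtain b where b: "b \<noteq> 0"
    "\<And>v. v \<in> highest i \<Longrightarrow> (blinfun_apply x ^^ i) ((blinfun_apply y ^^ i) v) = b *\<^sub>C v"
    using x_pow_y_pow_highest[of i i] by auto
  \<comment> \<open>The inverse of \<open>y^i\<close> from \<open>highest i\<close> to
    \<open>V i i\<close>.\<close>
  define top where "top w = inverse b *\<^sub>C (blinfun_apply x ^^ i) w" for w
  have top: "top w \<in> highest i" "(blinfun_apply y ^^ i) (top w) = w" if w: "w \<in> string_space i i" for w
  proof -
    obtain p where p: "p \<in> highest i" "w = (blinfun_apply y ^^ i) p" using w by (rule string_spaceE)
    then have "top w = p" by (simp add: top_def b scaleC_scaleC scaleC_one)
    then show "top w \<in> highest i" "(blinfun_apply y ^^ i) (top w) = w" using p by auto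
  qed
  define g where "g m = proj i i (c (m (basis_vector q)))" for m :: "(nat \<Rightarrow> complex) \<Rightarrow> 'd"
  have g: "g m \<in> string_space i i" for m by (simp add: g_def proj_string)
  define \<phi> where "\<phi> m = string_hom i (top (g m))" for m
  show ?thesis
  proof (rule that[of \<phi>])
    show "clinear_on (multiplicity_space x h y j) \<phi>"
      unfolding clinear_on_def
    proof (intro conjI ballI allI)
      show "\<phi> (u + v) = \<phi> u + \<phi> v" for u v
        by (simp add: fun_eq_iff \<phi>_def string_hom_def g_def top_def blinfun.add_right x_pow y_pow
            scaleC_add_right sum.distrib)
      show "\<phi> (a *\<^sub>C u) = a *\<^sub>C \<phi> u" for a u
        by (simp add: fun_eq_iff \<phi>_def string_hom_def g_def top_def scaleC_fun_def End_D_scaleC[OF c]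
            End_D_scaleC[OF proj_End_D] x_pow y_pow scaleC_scaleC complex_vector.scale_sum_right mult_ac)
    qed
    show "\<phi> ` multiplicity_space x h y j \<subseteq> multiplicity_space x h y i"
      using string_hom_multiplicity_space top(1)[OF g] by (auto simp: \<phi>_def)
    show "is_pure_tensor x h y j \<phi> (basis_vector i) (\<lambda>l. l q) (proj i i o\<^sub>L c o\<^sub>L proj j q)"
      unfolding is_pure_tensor_def
    proof (intro conjI allI ballI)
      fix k m l assume m: "m \<in> multiplicity_space x h y k" and l: "l \<in> simple_module k"
      have "proj j q (m l) = (\<Sum>s\<le>k. l s *\<^sub>C proj j q (m (basis_vector s)))"
        by (simp add: multiplicity_space_apply[OF m l] blinfun.sum_right End_D_scaleC[OF proj_End_D])
      also have "\<dots> = (\<Sum>s\<le>k. if s = q then (if k = j then l q *\<^sub>C m (basis_vector q) else 0) else 0)"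
        by (rule sum.cong) (use proj_eq[OF multiplicity_space_string[OF m]] in auto)
      also have "\<dots> = (if k = j then l q *\<^sub>C m (basis_vector q) else 0)" using q by simp
      finally show "(proj i i o\<^sub>L c o\<^sub>L proj j q) (m l) = (if k = j then l q *\<^sub>C \<phi> m (basis_vector i) else 0)"
        using top(2)[OF g[of m]]
        by (simp add: \<phi>_def string_hom_basis_vector g_def End_D_scaleC[OF c]
            End_D_scaleC[OF proj_End_D])
    qed (simp add: c proj_End_D End_D_ops)
  qed
qed

lemma slice_space_eq_slice: "slice_space x h y = slice"
proof (rule subset_antisym)
  show "slice_space x h y \<subseteq> slice"
    unfolding slice_space_def
    using pure_tensor_in_slice by (intro complex_vector.span_minimal csubspace_slice) blast
  show "slice \<subseteq> slice_space x h y"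
  proof
    fix c assume c: "c \<in> slice"
    have "proj i r o\<^sub>L c o\<^sub>L proj j q \<in> slice_space x h y" if jq: "(j, q) \<in> strings" for i r j q
    proof (cases "r = i \<and> q \<le> i")
      case True
      have q: "q \<le> j" using jq by (simp add: strings_def)
      obtain \<phi> where \<phi>: "clinear_on (multiplicity_space x h y j) \<phi>"
        "\<phi> ` multiplicity_space x h y j \<subseteq> multiplicity_space x h y i"
        "is_pure_tensor x h y j \<phi> (basis_vector i) (\<lambda>l. l q) (proj i i o\<^sub>L c o\<^sub>L proj j q)"
        using c True q by (auto simp: slice_def elim: block_pure_tensor)
      have "simple_y i (basis_vector i) = 0"
        by (auto simp: simple_y_def basis_vector_def fun_eq_iff)
      then have "basis_vector i \<in> ker_y i" by (simp add: ker_y_def basis_vector_simple_module)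
      \<comment> \<open>Since \<open>q < i + 1\<close>, applying \<open>y^(i+1)\<close> leaves no
        coefficient in position \<open>q\<close>.\<close>
      moreover have "(\<lambda>l. l q) \<in> ker_y_pow_dual (i + 1) j"
        using True simple_y_pow_eq_0[of q "i + 1"]
        by (simp add: ker_y_pow_dual_def dual_y_pow clinear_on_def scaleC_fun_def del: funpow.simps)
      ultimately show ?thesis
        unfolding slice_space_def using \<phi> True by (intro complex_vector.span_base) blast
    next
      case False
      then have "proj i r o\<^sub>L c o\<^sub>L proj j q = 0"
        using slice_block[OF c] by (intro blinfun_eqI) simp
      then show ?thesis by (simp add: slice_space_def complex_vector.span_zero)
    qed
    then show "c \<in> slice_space x h y"
      unfolding slice_space_def
      by (subst block_sum) (intro complex_vector.span_sum, simp)
  qed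
qed

end

section \<open>Transversality\<close>

context sl2_nilpotent
begin

section \<open>Shifting blocks modulo commutators\<close>

definition commutators :: "('d \<Rightarrow>\<^sub>L 'd) set" where
  "commutators = {lie_bracket x Z |Z. Z \<in> End_D}"

lemma csubspace_commutators: "csubspace commutators"
proof -
  have add: "lie_bracket x A + lie_bracket x B = lie_bracket x (A + B)" for A B :: "'d \<Rightarrow>\<^sub>L 'd"
    by (rule blinfun_eqI) (simp add: lie_bracket_def blinfun.bilinear_simps)
  have zero: "lie_bracket x 0 = 0" by (simp add: lie_bracket_def)
  show ?thesis
    unfolding complex_vector.subspace_def
  proof (intro conjI ballI allI)
    show "0 \<in> commutators"
      unfolding commutators_def by (rule CollectI, rule exI[of _ 0]) (simp add: zero End_D_ops)
    fix u assume "u \<in> commutators"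
    then obtain A where A: "u = lie_bracket x A" "A \<in> End_D" by (auto simp: commutators_def)
    show "u + v \<in> commutators" if v: "v \<in> commutators" for v
    proof -
      obtain B where "v = lie_bracket x B" "B \<in> End_D" using v by (auto simp: commutators_def)
      then show ?thesis
        unfolding commutators_def using A by (intro CollectI exI[of _ "A + B"]) (simp add: add End_D_ops)
    qed
    show "a *\<^sub>C u \<in> commutators" for a
      unfolding commutators_def using A xhy_End_D
      by (intro CollectI exI[of _ "a *\<^sub>C A"]) (simp add: lie_bracket_scaleC End_D_ops)
  qed
qed

definition block :: "('d \<Rightarrow>\<^sub>L 'd) \<Rightarrow> nat \<Rightarrow> nat \<Rightarrow> nat \<Rightarrow> nat \<Rightarrow> 'd \<Rightarrow>\<^sub>L 'd" where
  "block A i r j q = proj i r o\<^sub>L A o\<^sub>L proj j q"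

lemma block_apply: "block A i r j q v = proj i r (A (proj j q v))"
  by (simp add: block_def)

lemma block_End_D: "A \<in> End_D \<Longrightarrow> block A i r j q \<in> End_D"
  by (simp add: block_def proj_End_D End_D_ops)

lemma block_eq_0: "(i, r) \<notin> strings \<or> (j, q) \<notin> strings \<Longrightarrow> block A i r j q = 0"
  by (auto simp: block_def proj_eq_0)

text \<open>Both positions are lowered by one, keeping \<open>q > r\<close>, until \<open>r\<close>
  is 0 and \<open>x\<close> kills the values.\<close>

lemma block_commutator:
  assumes "A \<in> End_D" "q > r"
  shows "block A i r j q \<in> commutators"
  using assms
proof (induction r arbitrary: q A)
  \<comment> \<open>For \<open>1 \<le> q \<le> j\<close> the product \<open>y x\<close> is a nonzero
    scalar \<open>b\<close> on \<open>V j q\<close>. So \<open>Z\<close>, the block after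
    \<open>y\<close> divided by \<open>b\<close>, satisfies \<open>Z x\<close> = block, and the
    block agrees with \<open>x Z\<close> up to a commutator.\<close>
  have *: "\<exists>Z\<in>End_D. \<exists>b. x o\<^sub>L Z = b *\<^sub>C (x o\<^sub>L block A i r j (Suc q') o\<^sub>L y) \<and>
      block A i r j (Suc q') = (x o\<^sub>L Z) - lie_bracket x Z"
    if A: "A \<in> End_D" and q: "Suc q' \<le> j" for A r q'
  proof -
    define b where "b = complex_of_nat (Suc q') * (of_nat j - of_nat (Suc q') + 1)"
    have "complex_of_nat j \<noteq> of_nat q'" using q by (simp only: of_nat_eq_iff)
    then have b: "b \<noteq> 0" by (simp add: b_def del: of_nat_Suc) simp
    define Z where "Z = inverse b *\<^sub>C (block A i r j (Suc q') o\<^sub>L y)"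
    have Z: "Z \<in> End_D" using A by (simp add: Z_def block_End_D xhy_End_D End_D_ops)
    have "proj j (Suc q') (y (x v)) = b *\<^sub>C proj j (Suc q') v" for v
      by (simp add: proj_x proj_y yx_proj b_def)
    then have "Z o\<^sub>L x = block A i r j (Suc q')"
      using b by (intro blinfun_eqI)
        (simp add: Z_def blinfun_apply_scaleC block_apply End_D_scaleC[OF A] End_D_scaleC[OF proj_End_D]
          scaleC_scaleC scaleC_one)
    moreover have "x o\<^sub>L Z = inverse b *\<^sub>C (x o\<^sub>L block A i r j (Suc q') o\<^sub>L y)"
      by (rule blinfun_eqI) (simp add: Z_def blinfun_apply_scaleC xhy_scaleC)
    ultimately show ?thesis
      using Z by (intro bexI[of _ Z] exI[of _ "inverse b"]) (auto simp: lie_bracket_def)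
  qed
  {
    case (0 q A)
    then obtain q' where q: "q = Suc q'" using gr0_implies_Suc by blast
    show ?case
    proof (cases "q \<le> j")
      case True
      obtain Z b where Z: "Z \<in> End_D" "x o\<^sub>L Z = b *\<^sub>C (x o\<^sub>L block A i 0 j (Suc q') o\<^sub>L y)"
        "block A i 0 j (Suc q') = (x o\<^sub>L Z) - lie_bracket x Z"
        using *[OF 0(1), of q' 0] True q by blast
      have "x o\<^sub>L Z = 0"
        unfolding Z(2) by (rule blinfun_eqI) (simp add: blinfun_apply_scaleC block_apply x_proj_0)
      moreover have "lie_bracket x Z \<in> commutators" using Z(1) by (auto simp: commutators_def)
      ultimately show ?thesis
        using Z(3) complex_vector.subspace_neg[OF csubspace_commutators] by (simp add: q)
    next
      case False
      then have "block A i 0 j q = 0" by (intro block_eq_0) (simp add: strings_def)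
      then show ?thesis using complex_vector.subspace_0[OF csubspace_commutators] by simp
    qed
  next
    case (Suc r q A)
    then obtain q' where q: "q = Suc q'" "r < q'" by (metis Suc_lessE Suc_less_eq)
    show ?case
    proof (cases "q \<le> j")
      case True
      obtain Z b where Z: "Z \<in> End_D" "x o\<^sub>L Z = b *\<^sub>C (x o\<^sub>L block A i (Suc r) j (Suc q') o\<^sub>L y)"
        "block A i (Suc r) j (Suc q') = (x o\<^sub>L Z) - lie_bracket x Z"
        using *[OF Suc.prems(1), of q' "Suc r"] True q by blast
      have "x o\<^sub>L Z = b *\<^sub>C block (x o\<^sub>L A o\<^sub>L y) i r j q'"
        unfolding Z(2) by (rule blinfun_eqI)
          (simp add: blinfun_apply_scaleC block_apply proj_x proj_y)
      also have "\<dots> \<in> commutators"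
        using Suc.prems(1) q(2) csubspace_commutators
        by (intro complex_vector.subspace_scale Suc.IH End_D_ops xhy_End_D)
      finally have "x o\<^sub>L Z \<in> commutators" .
      moreover have "lie_bracket x Z \<in> commutators" using Z(1) by (auto simp: commutators_def)
      ultimately show ?thesis
        using Z(3) complex_vector.subspace_diff[OF csubspace_commutators] by (simp add: q(1))
    next
      case False
      then have "block A i (Suc r) j q = 0" by (intro block_eq_0) (simp add: strings_def)
      then show ?thesis using complex_vector.subspace_0[OF csubspace_commutators] by simp
    qed
  }
qed

definition complement_sum :: "('d \<Rightarrow>\<^sub>L 'd) set" where
  "complement_sum = {a + b |a b. a \<in> commutators \<and> b \<in> slice}"

lemma csubspace_complement_sum: "csubspace complement_sum"
  unfolding complement_sum_def
  by (rule complex_vector.subspace_sums[OF csubspace_commutators csubspace_slice])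

lemma complement_sumI: "A \<in> commutators \<Longrightarrow> A \<in> complement_sum" "A \<in> slice \<Longrightarrow> A \<in> complement_sum"
  using complex_vector.subspace_0[OF csubspace_slice] complex_vector.subspace_0[OF csubspace_commutators]
  by (force simp: complement_sum_def)+

text \<open>Now both positions are raised. For \<open>r < i\<close> the product \<open>x y\<close>
  is a nonzero scalar on \<open>V i r\<close>, so with \<open>Z\<close> the suitably divided
  composite of \<open>y\<close> and the block, the block is \<open>x Z\<close>, that is,
  \<open>Z x\<close> plus a commutator. At \<open>r = i\<close> the block is in the slice if
  \<open>q \<le> i\<close> and a commutator otherwise.\<close>

lemma block_complement_sum:
  assumes "A \<in> End_D" "r + d = i"
  shows "block A i r j q \<in> complement_sum"
  using assms
proof (induction d arbitrary: r q A)
  case (0 r q A)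
  then have ri: "r = i" by simp
  show ?case
  proof (cases "q \<le> i")
    case True
    then have "block A i r j q \<in> slice"
      using ri block_End_D[OF 0(1)] by (auto simp: slice_def block_apply proj_proj)
    then show ?thesis by (rule complement_sumI)
  next
    case False
    then show ?thesis using ri 0(1) by (intro complement_sumI block_commutator) auto
  qed
next
  case (Suc d r q A)
  define b where "b = complex_of_nat (Suc r) * (of_nat i - of_nat r)"
  have "complex_of_nat i \<noteq> of_nat r" using Suc.prems by (simp only: of_nat_eq_iff)
  then have b: "b \<noteq> 0" by (simp add: b_def del: of_nat_Suc)
  define Z where "Z = inverse b *\<^sub>C (y o\<^sub>L block A i r j q)"
  have Z: "Z \<in> End_D" using Suc.prems by (simp add: Z_def block_End_D xhy_End_D End_D_ops)
  have "x (y (proj i r v)) = b *\<^sub>C proj i r v" for v by (simp only: xy_proj b_def)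
  then have "x o\<^sub>L Z = block A i r j q"
    using b by (intro blinfun_eqI)
      (simp add: Z_def blinfun_apply_scaleC block_apply xhy_scaleC scaleC_scaleC scaleC_one)
  moreover have "Z o\<^sub>L x = inverse b *\<^sub>C block (y o\<^sub>L A o\<^sub>L x) i (Suc r) j (Suc q)"
    by (rule blinfun_eqI) (simp add: Z_def blinfun_apply_scaleC block_apply proj_x proj_y)
  ultimately have "block A i r j q = lie_bracket x Z + inverse b *\<^sub>C block (y o\<^sub>L A o\<^sub>L x) i (Suc r) j (Suc q)"
    by (simp add: lie_bracket_def)
  moreover have "lie_bracket x Z \<in> complement_sum"
    using Z by (intro complement_sumI) (auto simp: commutators_def)
  moreover have "block (y o\<^sub>L A o\<^sub>L x) i (Suc r) j (Suc q) \<in> complement_sum"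
    using Suc.prems by (intro Suc.IH End_D_ops xhy_End_D) auto
  ultimately show ?case
    by (simp add: complex_vector.subspace_add complex_vector.subspace_scale csubspace_complement_sum)
qed

lemma End_D_complement_sum: "End_D = complement_sum"
proof (rule subset_antisym)
  show "End_D \<subseteq> complement_sum"
  proof
    fix A :: "'d \<Rightarrow>\<^sub>L 'd" assume A: "A \<in> End_D"
    have "block A (fst a) (snd a) (fst b) (snd b) \<in> complement_sum" if "a \<in> strings" for a b
      using that A by (intro block_complement_sum[of _ _ "fst a - snd a"]) (auto simp: strings_def)
    then show "A \<in> complement_sum"
      by (subst block_sum, fold block_def)
        (intro complex_vector.subspace_sum csubspace_complement_sum)
  qed
  show "complement_sum \<subseteq> End_D"
    using xhy_End_D by (auto simp: complement_sum_def commutators_def slice_def End_D_ops)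
qed

section \<open>Rank conditions on the slice\<close>

lemma proj_x_pow: "proj i r ((blinfun_apply x ^^ n) v) = (blinfun_apply x ^^ n) (proj i (r + n) v)"
  by (induction n arbitrary: r) (simp_all add: proj_x)

lemma x_pow_string_eq_0: "w \<in> string_space i r \<Longrightarrow> r < n \<Longrightarrow> (blinfun_apply x ^^ n) w = 0"
proof (induction n arbitrary: r w)
  case (Suc n)
  have "(blinfun_apply x ^^ n) (x w) = 0"
  proof (cases r)
    case 0
    then show ?thesis using Suc.prems x_string_0 by (simp add: x_pow)
  next
    case (Suc r')
    then show ?thesis using Suc.IH[OF x_string] Suc.prems by simp
  qed
  then show ?case by (simp add: funpow_swap1)
qed simp

lemma x_pow_string_inj:
  "w \<in> string_space i r \<Longrightarrow> n \<le> r \<Longrightarrow> r \<le> i \<Longrightarrow> (blinfun_apply x ^^ n) w = 0 \<Longrightarrow> w = 0"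
proof (induction n arbitrary: r w)
  case (Suc n)
  obtain r' where r: "r = Suc r'" using Suc.prems by (metis Suc_le_D)
  have "(blinfun_apply x ^^ n) (x w) = 0" using Suc.prems by (simp add: funpow_swap1)
  then have "x w = 0" using Suc.IH[OF x_string] Suc.prems r by simp
  then have "(complex_of_nat r * (of_nat i - of_nat r + 1)) *\<^sub>C w = 0"
    using yx_string[OF Suc.prems(1)] by simp
  moreover have "complex_of_nat i \<noteq> of_nat r'" using Suc.prems r by (simp only: of_nat_eq_iff)
  moreover have "complex_of_nat i - of_nat r + 1 = of_nat i - of_nat r'" "r \<noteq> 0" by (simp_all add: r)
  ultimately show ?case by simp
qed simp

text \<open>The derivative is the sum of \<open>x^d c x^(k-1-d)\<close> over \<open>d < k\<close>.
  As \<open>c\<close> takes values in the spaces \<open>V i i\<close>, the summand with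
  \<open>x^d\<close> is the only one visible in position \<open>i - d\<close>.\<close>

lemma slice_op_power_deriv:
  assumes c: "c \<in> slice"
  shows "d \<le> i \<Longrightarrow> proj i (i - d) (op_power_deriv x c k u) =
    (if d < k then (blinfun_apply x ^^ d) (proj i i (c ((blinfun_apply x ^^ (k - Suc d)) u))) else 0)"
proof (induction k arbitrary: d)
  case (Suc k)
  have c0: "proj i r (c v) = 0" if "r \<noteq> i" for r v
    using slice_block[OF c] that by (simp add: proj_sum[of c v] blinfun.sum_right split_beta)
  have split: "proj i r (op_power_deriv x c (Suc k) u) =
      proj i r (c ((blinfun_apply x ^^ k) u)) + x (proj i (Suc r) (op_power_deriv x c k u))" for r
    by (simp add: blinfun.add_left blinfun.add_right op_power_apply proj_x)
  show ?case
  proof (cases d)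
    case 0
    then show ?thesis using split[of i] proj_eq_0[of i "Suc i"] by (simp add: strings_def)
  next
    case (Suc d')
    then have "Suc (i - d) = i - d'" "i - d \<noteq> i" using Suc.prems by auto
    then show ?thesis using split[of "i - d"] Suc.IH[of d'] Suc.prems Suc c0 by simp
  qed
qed simp

text \<open>The rank conditions on the powers of \<open>x\<close> detect each block of an element of the slice: in
  degree \<open>q + 1\<close> they concern the strings in position \<open>q\<close>.\<close>

lemma slice_rank_condition_imp_0:
  assumes c: "c \<in> slice"
    and rank: "\<And>k u. (blinfun_apply x ^^ k) u = 0 \<Longrightarrow>
      \<exists>z. op_power_deriv x c k u = (blinfun_apply x ^^ k) z"
  shows "c = 0"
proof (rule blocks_eqI)
  fix i r j q v
  show "proj i r (c (proj j q v)) = proj i r ((0 :: 'd \<Rightarrow>\<^sub>L 'd) (proj j q v))"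
  proof (cases "r = i \<and> q \<le> i")
    case True
    have "(blinfun_apply x ^^ Suc q) (proj j q v) = 0"
      by (rule x_pow_string_eq_0[OF proj_string]) simp
    then obtain z where z: "op_power_deriv x c (Suc q) (proj j q v) = (blinfun_apply x ^^ Suc q) z"
      using rank by blast
    \<comment> \<open>The power \<open>q + 1\<close> kills \<open>V j q\<close>. In position
      \<open>i - q\<close> the derivative shows \<open>x^q\<close> of the wanted block, while the
      image of \<open>x^(q+1)\<close> could come there only from the nonexistent position
      \<open>i + 1\<close>.\<close>
    have "(blinfun_apply x ^^ q) (proj i i (c (proj j q v))) = proj i (i - q) ((blinfun_apply x ^^ Suc q) z)"
      using slice_op_power_deriv[OF c, of q i "Suc q" "proj j q v"] True z by simp
    also have "\<dots> = 0"
      using True proj_eq_0[of i "Suc i"] by (simp add: proj_x_pow strings_def x_pow del: funpow.simps)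
    finally have "proj i i (c (proj j q v)) = 0"
      using x_pow_string_inj[OF proj_string] True by blast
    then show ?thesis using True by simp
  next
    case False
    then show ?thesis using slice_block[OF c] by simp
  qed
qed

lemma lie_bracket_minus: "lie_bracket x (- B) = lie_bracket B x"
  by (rule blinfun_eqI) (simp add: lie_bracket_def blinfun.bilinear_simps)

lemma commutators_alt: "commutators = {lie_bracket B x |B. B \<in> End_D}"
proof -
  have "- B \<in> End_D" if "B \<in> End_D" for B :: "'d \<Rightarrow>\<^sub>L 'd"
    using End_D_ops(4)[OF End_D_ops(1) that] by simp
  then show ?thesis
    unfolding commutators_def using lie_bracket_minus by (metis (no_types, lifting) minus_minus)
qed

lemma commutator_rank_condition:
  assumes "(blinfun_apply x ^^ k) u = 0"
  shows "op_power_deriv x (lie_bracket B x) k u = - (blinfun_apply x ^^ k) (B u)"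
  using assms by (simp add: op_power_deriv_commutator blinfun.diff_left op_power_apply)

lemma slice_commutators_disjoint: "commutators \<inter> slice = {0}"
proof
  show "commutators \<inter> slice \<subseteq> {0}"
  proof
    fix c assume c: "c \<in> commutators \<inter> slice"
    then obtain B where B: "c = lie_bracket B x" by (auto simp: commutators_alt)
    have "c = 0"
    proof (rule slice_rank_condition_imp_0)
      fix k u assume "(blinfun_apply x ^^ k) u = 0"
      then have "op_power_deriv x c k u = (blinfun_apply x ^^ k) (0 - B u)"
        unfolding x_pow by (simp add: B commutator_rank_condition x_pow)
      then show "\<exists>z. op_power_deriv x c k u = (blinfun_apply x ^^ k) z" by blast
    qed (use c in simp)
    then show "c \<in> {0}" by simp
  qed
qed (simp add: complex_vector.subspace_0 csubspace_commutators csubspace_slice)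

section \<open>The tangent spaces at \<open>x\<close>\<close>

lemma tangent_space_End_D: "tangent_space End_D x = (End_D :: ('d \<Rightarrow>\<^sub>L 'd) set)"
proof -
  have "End_D = {x + c |c. c \<in> End_D}"
  proof (intro set_eqI iffI)
    fix A :: "'d \<Rightarrow>\<^sub>L 'd" assume "A \<in> End_D"
    then show "A \<in> {x + c |c. c \<in> End_D}"
      using xhy_End_D by (intro CollectI exI[of _ "A - x"]) (simp add: End_D_ops)
  qed (use xhy_End_D in \<open>auto intro: End_D_ops\<close>)
  then show ?thesis
    using tangent_space_affine[OF csubspace_End_D closed_End_D, of x] by simp
qed

lemma tangent_space_conj_orbit: "tangent_space (conj_orbit x) x = commutators"
proof
  show "commutators \<subseteq> tangent_space (conj_orbit x) x"
    using commutator_in_tangent_space_orbit xhy_End_D by (auto simp: commutators_alt)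
  show "tangent_space (conj_orbit x) x \<subseteq> commutators"
  proof
    fix V assume V: "V \<in> tangent_space (conj_orbit x) x"
    have "conj_orbit x \<subseteq> End_D"
      using xhy_End_D by (auto simp: conj_orbit_def elim!: conj_saturationE intro!: End_D_ops)
    then have "tangent_space (conj_orbit x) x \<subseteq> tangent_space End_D x"
      unfolding tangent_space_def by blast
    then have "V \<in> complement_sum" using V tangent_space_End_D End_D_complement_sum by auto
    \<comment> \<open>The rank conditions are linear in the direction, so \<open>c\<close> inherits
      them from \<open>V\<close> and the commutator \<open>a\<close>.\<close>
    then obtain a c where ac: "V = a + c" "a \<in> commutators" "c \<in> slice" by (auto simp: complement_sum_def)
    obtain B where B: "a = lie_bracket B x" using ac(2) by (auto simp: commutators_alt)
    have "c = 0"
    proof (rule slice_rank_condition_imp_0[OF ac(3)])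
      fix k u assume u: "(blinfun_apply x ^^ k) u = 0"
      obtain z where z: "op_power_deriv x V k u = (blinfun_apply x ^^ k) z"
        using tangent_space_orbit_rank_condition[OF xhy_End_D(1) V u] by blast
      have "op_power_deriv x c k u = (blinfun_apply x ^^ k) (z + B u)"
        using z by (simp add: ac(1) B op_power_deriv_add blinfun.add_left commutator_rank_condition[OF u]
            x_pow algebra_simps)
      then show "\<exists>z. op_power_deriv x c k u = (blinfun_apply x ^^ k) z" by blast
    qed
    then show "V \<in> commutators" using ac by simp
  qed
qed

end

section \<open>The contracting action\<close>

lemma polynomial_functions_sum:
  assumes "finite K" "\<And>k. k \<in> K \<Longrightarrow> f k \<in> polynomial_functions V"
  shows "(\<lambda>q. \<Sum>k\<in>K. f k q) \<in> polynomial_functions V"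
  using assms
proof (induction K)
  case empty
  show ?case using polynomial_functions.const[of 0 V] by simp
next
  case (insert a K)
  then show ?case using polynomial_functions.add[of "f a" V "\<lambda>q. \<Sum>k\<in>K. f k q"] by simp
qed

lemma polynomial_functions_fst_power: "(\<lambda>q. fst q ^ n) \<in> polynomial_functions V"
proof (induction n)
  case 0
  show ?case using polynomial_functions.const[of 1 V] by simp
next
  case (Suc n)
  then show ?case using polynomial_functions.mult[OF polynomial_functions.param] by simp
qed

lemma power_mult_inverse_power:
  fixes t :: complex
  assumes "t \<noteq> 0" "n = e + m"
  shows "t ^ n * inverse t ^ m = t ^ e"
  using assms by (simp add: power_add power_inverse)

context sl2_nilpotent
begin

text \<open>\<open>t\<^sup>2 Ad(t\<^sup>-\<^sup>h)\<close> fixes \<open>x\<close>, and it multiplies the operators from \<open>V j q\<close> to \<open>V i i\<close> by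
  \<open>t\<^sup>2\<^sup>+\<^sup>i\<^sup>+\<^sup>j\<^sup>-\<^sup>2\<^sup>q\<close>, whose exponent is at least 2 because \<open>q \<le> i\<close> and \<open>q \<le> j\<close>.\<close>

definition weight :: "complex \<Rightarrow> nat \<times> nat \<Rightarrow> nat \<times> nat \<Rightarrow> complex" where
  "weight t a b = (if snd a = fst a \<and> snd b \<le> fst a then t ^ (2 + fst a + fst b - 2 * snd b) else 0)"

text \<open>Written with weights instead of a conjugation, it depends polynomially on
  \<open>t\<close>, which gives regularity and the limit at 0.\<close>

definition dilation :: "complex \<Rightarrow> ('d \<Rightarrow>\<^sub>L 'd) \<Rightarrow> 'd \<Rightarrow>\<^sub>L 'd" where
  "dilation t c = (\<Sum>a\<in>strings. \<Sum>b\<in>strings. weight t a b *\<^sub>C block c (fst a) (snd a) (fst b) (snd b))"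

lemma dilation_End_D: "c \<in> End_D \<Longrightarrow> dilation t c \<in> End_D"
  unfolding dilation_def by (intro End_D_sum End_D_ops block_End_D)

lemma proj_dilation:
  "proj i r (dilation t c (proj j q v)) = weight t (i, r) (j, q) *\<^sub>C proj i r (c (proj j q v))"
proof (cases "(i, r) \<in> strings \<and> (j, q) \<in> strings")
  case True
  define w where "w = weight t (i, r) (j, q) *\<^sub>C proj i r (c (proj j q v))"
  have c0: "c 0 = 0" by simp
  have "proj i r (dilation t c (proj j q v)) = (\<Sum>a\<in>strings. \<Sum>b\<in>strings.
      weight t a b *\<^sub>C proj i r (proj (fst a) (snd a) (c (proj (fst b) (snd b) (proj j q v)))))"
    by (simp add: dilation_def blinfun.sum_left blinfun.sum_right blinfun_apply_scaleC block_apply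
        End_D_scaleC[OF proj_End_D])
  also have "\<dots> = (\<Sum>a\<in>strings. \<Sum>b\<in>strings. if b = (j, q) then (if a = (i, r) then w else 0) else 0)"
    by (intro sum.cong refl) (auto simp: proj_proj w_def split: if_splits prod.splits)
  also have "\<dots> = w" using True finite_strings by simp
  finally show ?thesis by (simp add: w_def)
qed (auto simp: proj_eq_0)

lemma dilation_slice: "c \<in> End_D \<Longrightarrow> dilation t c \<in> slice"
  by (auto simp: slice_def dilation_End_D proj_dilation weight_def)

lemma slice_End_D: "slice \<subseteq> End_D"
  by (auto simp: slice_def)

lemma dilation_1:
  assumes "c \<in> slice"
  shows "dilation 1 c = c"
  by (rule blocks_eqI) (use slice_block[OF assms] in \<open>auto simp: proj_dilation weight_def scaleC_one\<close>)

lemma dilation_mult: "dilation (t * u) c = dilation t (dilation u c)"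
  by (rule blocks_eqI) (simp add: proj_dilation weight_def scaleC_scaleC power_mult_distrib)

text \<open>This is \<open>t\<^sup>N\<^sup>-\<^sup>h\<close> with \<open>N = nil_index\<close>, which makes all exponents nonnegative.\<close>

definition cocharacter :: "complex \<Rightarrow> 'd \<Rightarrow>\<^sub>L 'd" where
  "cocharacter t = (\<Sum>(j, q)\<in>strings. t ^ (nil_index + 2 * q - j) *\<^sub>C proj j q)"

lemma cocharacter_End_D: "cocharacter t \<in> End_D"
  unfolding cocharacter_def by (auto intro!: End_D_sum End_D_ops proj_End_D)

lemma cocharacter_proj: "cocharacter t (proj j q v) = t ^ (nil_index + 2 * q - j) *\<^sub>C proj j q v"
proof (cases "(j, q) \<in> strings")
  case True
  have "cocharacter t (proj j q v) = (\<Sum>a\<in>strings. if a = (j, q) then t ^ (nil_index + 2 * q - j) *\<^sub>C proj j q v else 0)"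
    unfolding cocharacter_def blinfun.sum_left
    by (intro sum.cong refl) (auto simp: blinfun_apply_scaleC proj_proj split_beta prod_eq_iff)
  then show ?thesis using True finite_strings by simp
qed (simp add: proj_eq_0)

lemma proj_cocharacter: "proj j q (cocharacter t v) = t ^ (nil_index + 2 * q - j) *\<^sub>C proj j q v"
proof -
  have "proj j q (cocharacter t v) = cocharacter t (proj j q v)"
  proof (rule proj_comm)
    fix k s v assume v: "v \<in> string_space k s"
    then have "cocharacter t v = cocharacter t (proj k s v)" by (simp add: proj_eq)
    then have ch: "cocharacter t v \<in> string_space k s"
      using cocharacter_proj[of t k s v] proj_string[of k s v] string_space_subspace(3) by simp
    show "(k, s) \<noteq> (j, q) \<Longrightarrow> proj j q (cocharacter t v) = 0" using proj_eq[OF ch] by auto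
  next
    fix v assume v: "v \<in> string_space j q"
    then have "cocharacter t v = cocharacter t (proj j q v)" by (simp add: proj_eq)
    then show "cocharacter t v \<in> string_space j q"
      using cocharacter_proj[of t j q v] proj_string[of j q v] string_space_subspace(3) by simp
  qed
  then show ?thesis by (simp add: cocharacter_proj)
qed

lemma cocharacter_inverse:
  assumes "t \<noteq> 0"
  shows "cocharacter t o\<^sub>L cocharacter (inverse t) = id_blinfun"
  using assms
  by (intro blocks_eqI) (simp add: cocharacter_proj proj_cocharacter End_D_scaleC[OF cocharacter_End_D]
      End_D_scaleC[OF proj_End_D] scaleC_scaleC power_mult_distrib[symmetric] scaleC_one)

text \<open>The right side multiplies a block from \<open>V j q\<close> to \<open>V i r\<close> by
  \<open>t\<close> to the power \<open>2 + (2 r - i) - (2 q - j)\<close>. This exponent is 0 for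
  \<open>x\<close>, where \<open>i = j\<close> and \<open>q = r + 1\<close>, and it is that of
  \<open>weight\<close> for \<open>r = i\<close>.\<close>

lemma dilation_eq_conj:
  assumes t: "t \<noteq> 0" and c: "c \<in> slice"
  shows "x + dilation t c = t ^ 2 *\<^sub>C (cocharacter t o\<^sub>L (x + c) o\<^sub>L cocharacter (inverse t))"
proof (rule blocks_eqI)
  fix i r j q v
  show "proj i r ((x + dilation t c) (proj j q v)) =
      proj i r ((t ^ 2 *\<^sub>C (cocharacter t o\<^sub>L (x + c) o\<^sub>L cocharacter (inverse t))) (proj j q v))"
  proof (cases "(i, r) \<in> strings \<and> (j, q) \<in> strings")
    case True
    define a where "a = t ^ (2 + (nil_index + 2 * r - i)) * inverse t ^ (nil_index + 2 * q - j)"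
    have c_End: "c \<in> End_D" using c by (simp add: slice_def)
    have "proj i r ((t ^ 2 *\<^sub>C (cocharacter t o\<^sub>L (x + c) o\<^sub>L cocharacter (inverse t))) (proj j q v)) =
        a *\<^sub>C proj i r (x (proj j q v)) + a *\<^sub>C proj i r (c (proj j q v))"
      by (simp add: a_def blinfun_apply_scaleC cocharacter_proj proj_cocharacter blinfun.add_left
          blinfun.add_right End_D_scaleC[OF proj_End_D] End_D_scaleC[OF cocharacter_End_D]
          End_D_scaleC[OF c_End] xhy_scaleC scaleC_add_right scaleC_scaleC power_add mult_ac
          power2_eq_square)
    also have "a *\<^sub>C proj i r (x (proj j q v)) = proj i r (x (proj j q v))"
    proof (cases "j = i \<and> q = Suc r")
      case True
      then have "a = t ^ 0"
        unfolding a_def using t \<open>(i, r) \<in> strings \<and> (j, q) \<in> strings\<close>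
        by (intro power_mult_inverse_power) (auto simp: strings_def)
      then show ?thesis by (simp add: scaleC_one)
    next
      case False
      then show ?thesis by (auto simp: proj_x proj_proj)
    qed
    also have "a *\<^sub>C proj i r (c (proj j q v)) = weight t (i, r) (j, q) *\<^sub>C proj i r (c (proj j q v))"
    proof (cases "r = i \<and> q \<le> i")
      case True
      then have "a = t ^ (2 + i + j - 2 * q)"
        unfolding a_def using t \<open>(i, r) \<in> strings \<and> (j, q) \<in> strings\<close>
        by (intro power_mult_inverse_power) (auto simp: strings_def)
      then show ?thesis using True by (simp add: weight_def)
    next
      case False
      then show ?thesis using slice_block[OF c] by simp
    qed
    finally show ?thesis by (simp add: blinfun.add_left blinfun.add_right proj_dilation)
  qed (auto simp: proj_eq_0)
qed

section \<open>The action on the slice and its strata\<close>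

definition slice_action :: "complex \<Rightarrow> ('d \<Rightarrow>\<^sub>L 'd) \<Rightarrow> 'd \<Rightarrow>\<^sub>L 'd" where
  "slice_action t s = x + dilation t (s - x)"

text \<open>For nonzero \<open>t\<close> the action is a conjugation followed by scaling with
  \<open>t^2\<close>, and strata are stable under both.\<close>

lemma slice_action_preserves_strata:
  assumes S: "S = {x + c |c. c \<in> slice}" and \<Sigma>: "\<Sigma> \<in> lusztig_strata" and t: "t \<noteq> 0" and s: "s \<in> S \<inter> \<Sigma>"
  shows "slice_action t s \<in> S \<inter> \<Sigma>"
proof -
  obtain c where c: "s = x + c" "c \<in> slice" using s S by auto
  have "slice_action t s \<in> S" using c dilation_slice[of c t] slice_End_D by (auto simp: S slice_action_def)
  moreover have inv: "cocharacter (inverse t) o\<^sub>L cocharacter t = id_blinfun"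
    using cocharacter_inverse[of "inverse t"] t by simp
  have "cocharacter t o\<^sub>L s o\<^sub>L cocharacter (inverse t) \<in> \<Sigma>"
    using s cocharacter_inverse[OF t] inv
    by (intro lusztig_strata_conj[OF \<Sigma>] cocharacter_End_D) auto
  then have "t ^ 2 *\<^sub>C (cocharacter t o\<^sub>L s o\<^sub>L cocharacter (inverse t)) \<in> \<Sigma>"
    using t by (intro lusztig_strata_scale[OF \<Sigma>]) auto
  then have "slice_action t s \<in> \<Sigma>"
    using dilation_eq_conj[OF t c(2)] by (simp add: slice_action_def c(1))
  ultimately show ?thesis by blast
qed

lemma slice_action_contracts: "((\<lambda>t. slice_action t s) \<longlongrightarrow> x) (at 0)"
proof -
  have "((\<lambda>t. weight t a b) \<longlongrightarrow> 0) (at 0)" if "b \<in> strings" for a b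
  proof (cases "snd a = fst a \<and> snd b \<le> fst a")
    case True
    then have e: "2 + fst a + fst b - 2 * snd b \<noteq> 0" using that by (auto simp: strings_def)
    have "((\<lambda>t::complex. t ^ (2 + fst a + fst b - 2 * snd b)) \<longlongrightarrow> 0 ^ (2 + fst a + fst b - 2 * snd b)) (at 0)"
      by (intro tendsto_power tendsto_ident_at)
    then show ?thesis using True e by (simp add: weight_def power_0_left)
  next
    case False
    then have "weight t a b = 0" for t by (auto simp: weight_def)
    then show ?thesis by simp
  qed
  then have "((\<lambda>t. slice_action t s) \<longlongrightarrow> x + (\<Sum>a\<in>strings. \<Sum>b\<in>strings.
      0 *\<^sub>C block (s - x) (fst a) (snd a) (fst b) (snd b))) (at 0)"
    unfolding slice_action_def dilation_def
    by (intro tendsto_add tendsto_const tendsto_sum tendsto_scaleC)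
  then show ?thesis by simp
qed

lemma slice_action_regular:
  assumes "S \<subseteq> End_D"
  shows "regular_map End_D ((- {0}) \<times> S) (\<lambda>(t, s). slice_action t s)"
  unfolding regular_map_def
proof (intro allI impI)
  fix f :: "('d \<Rightarrow>\<^sub>L 'd) \<Rightarrow> complex" assume f: "clinear_on End_D f"
  define g where "g a b A = f (block A (fst a) (snd a) (fst b) (snd b))" for a b A
  have block_lin: "block (A + B) i r j q = block A i r j q + block B i r j q"
    "block (k *\<^sub>C A) i r j q = k *\<^sub>C block A i r j q" for A B :: "'d \<Rightarrow>\<^sub>L 'd" and i r j q k
    by (rule blinfun_eqI; simp add: block_apply blinfun.add_left blinfun.add_right blinfun_apply_scaleC
        End_D_scaleC[OF proj_End_D])+
  have g: "clinear_on End_D (g a b)" for a b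
    using f by (simp add: clinear_on_def g_def block_lin block_End_D)
  have weight_poly: "(\<lambda>p. weight (fst p) a b) \<in> polynomial_functions V" for a b and V :: "('d \<Rightarrow>\<^sub>L 'd) set"
  proof (cases "snd a = fst a \<and> snd b \<le> fst a")
    case True
    then show ?thesis using polynomial_functions_fst_power by (simp add: weight_def)
  next
    case False
    then have "weight t a b = 0" for t by (auto simp: weight_def)
    then show ?thesis using polynomial_functions.const[of 0 V] by simp
  qed
  \<comment> \<open>Only functions linear on \<open>End_D\<close> are generators, so the shift from
    \<open>s\<close> to \<open>s - x\<close> enters through the constants \<open>- g a b x\<close>.
    The denominator is 1.\<close>
  define P where "P p = f x + (\<Sum>a\<in>strings. \<Sum>b\<in>strings.
      weight (fst p) a b * (g a b (snd p) + (- g a b x)))" for p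
  have P: "P \<in> polynomial_functions End_D"
    unfolding P_def[abs_def]
    by (intro polynomial_functions.add polynomial_functions.const polynomial_functions_sum finite_strings
        polynomial_functions.mult weight_poly polynomial_functions.linear g)
  have P_eq: "f (slice_action t s) = P (t, s)" if "s \<in> S" for t s
  proof -
    have s: "s \<in> End_D" "s - x \<in> End_D" using that assms xhy_End_D by (auto intro: End_D_ops)
    have gd: "g a b (s - x) = g a b s + (- g a b x)" for a b
    proof -
      have "g a b s = g a b ((s - x) + x)" by simp
      also have "\<dots> = g a b (s - x) + g a b x" using g s xhy_End_D unfolding clinear_on_def by blast
      finally show ?thesis by simp
    qed
    have B: "weight t a b *\<^sub>C block (s - x) (fst a) (snd a) (fst b) (snd b) \<in> End_D" for a b
      using s(2) by (intro End_D_ops(5) block_End_D)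
    have "f (slice_action t s) = f x + f (dilation t (s - x))"
      using f xhy_End_D dilation_End_D[OF s(2)] by (simp add: slice_action_def clinear_on_def)
    also have "f (dilation t (s - x)) = (\<Sum>a\<in>strings. \<Sum>b\<in>strings.
        f (weight t a b *\<^sub>C block (s - x) (fst a) (snd a) (fst b) (snd b)))"
      unfolding dilation_def using B
      by (subst clinear_on_sum[OF f csubspace_End_D], intro End_D_sum, simp)
        (intro sum.cong refl clinear_on_sum[OF f csubspace_End_D])
    also have "\<dots> = (\<Sum>a\<in>strings. \<Sum>b\<in>strings. weight t a b * g a b (s - x))"
      using f block_End_D[OF s(2)] by (simp add: clinear_on_def g_def scaleC_complex_def)
    finally show ?thesis by (simp add: P_def gd)
  qed
  show "regular_function End_D ((- {0}) \<times> S) (\<lambda>q. f (case q of (t, s) \<Rightarrow> slice_action t s))"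
    unfolding regular_function_def
    using P polynomial_functions.const[of 1 End_D] P_eq
    by (intro ballI bexI[of _ P] bexI[of _ "\<lambda>_. 1"]) auto
qed

lemma normal_slice_slice: "normal_slice (conj_orbit x) x {x + c |c. c \<in> slice}"
proof -
  define S where "S = {x + c |c. c \<in> slice}"
  have act_S: "slice_action t s \<in> S" if "s \<in> S" for t s
    using that slice_End_D dilation_slice by (auto simp: S_def slice_action_def subset_iff)
  have act_1: "slice_action 1 s = s" if "s \<in> S" for s
    using that by (auto simp: S_def slice_action_def dilation_1)
  have act_mult: "slice_action (t * u) s = slice_action t (slice_action u s)" for t u s
    by (simp add: slice_action_def dilation_mult)
  have S_End: "S \<subseteq> End_D" using slice_End_D xhy_End_D by (auto simp: S_def intro: End_D_ops)
  have "Gm_action End_D S slice_action"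
    unfolding Gm_action_def using act_S act_1 act_mult slice_action_regular[OF S_End] by simp
  moreover have "contracts_to S slice_action x"
    by (simp add: contracts_to_def slice_action_contracts)
  moreover have "slice_action t ` (S \<inter> \<Sigma>) = S \<inter> \<Sigma>" if \<Sigma>: "\<Sigma> \<in> lusztig_strata" and t: "t \<noteq> 0" for \<Sigma> t
  proof
    show "slice_action t ` (S \<inter> \<Sigma>) \<subseteq> S \<inter> \<Sigma>"
      using slice_action_preserves_strata[OF S_def \<Sigma> t] by blast
    show "S \<inter> \<Sigma> \<subseteq> slice_action t ` (S \<inter> \<Sigma>)"
    proof
      fix s assume s: "s \<in> S \<inter> \<Sigma>"
      have "s = slice_action t (slice_action (inverse t) s)"
        using s t act_1[of s] act_mult[of t "inverse t" s] by simp
      moreover have "slice_action (inverse t) s \<in> S \<inter> \<Sigma>"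
        using slice_action_preserves_strata[OF S_def \<Sigma> _ s] t by simp
      ultimately show "s \<in> slice_action t ` (S \<inter> \<Sigma>)" by blast
    qed
  qed
  moreover have "direct_sum_of (tangent_space End_D x) (tangent_space (conj_orbit x) x) (tangent_space S x)"
    unfolding S_def tangent_space_End_D tangent_space_conj_orbit
      tangent_space_affine[OF csubspace_slice closed_slice] direct_sum_of_def
    using csubspace_commutators csubspace_slice slice_commutators_disjoint
      End_D_complement_sum[unfolded complement_sum_def] by blast
  moreover have "csubmanifold End_D S"
    unfolding S_def using csubspace_slice slice_End_D xhy_End_D
    by (intro csubmanifold_affine csubspace_End_D)
  moreover have "x \<in> S"
    using complex_vector.subspace_0[OF csubspace_slice] by (force simp: S_def)
  ultimately show ?thesis unfolding normal_slice_def S_def[symmetric] by blast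
qed

end

theorem mainTheorem8:
  fixes x h y :: "'d::findim_complex_vector \<Rightarrow>\<^sub>L 'd"
  assumes "x \<in> End_D" and "nilpotent_op x" and "sl2_triple x h y"
  shows "normal_slice (conj_orbit x) x {x + c |c. c \<in> slice_space x h y}"
proof -
  interpret sl2_nilpotent x h y using assms by unfold_locales
  show ?thesis unfolding slice_space_eq_slice by (rule normal_slice_slice)
qed

end
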